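(* Let $\mathcal{P}$ be a palette and let $\mathcal{H}$ be a hereditary property of digraphs (with respect to $\mathcal{P}$). Let $\chi^{\mathrm{wk,dir}}_{\mathcal{P}}=\chi^{\mathrm{wk,dir}}_{\mathcal{P}}(\mathcal{H})$ and $\chi^{\mathrm{st,dir}}_{\mathcal{P}}=\chi^{\mathrm{st,dir}}_{\mathcal{P}}(\mathcal{H})$ be the weak and strong directed chromatic numbers, respectively, of $\mathcal{H}$. (If $\mathcal{P}=\{\bigcirc,-\}$ or $\mathcal{P}=\{\leftarrow,\rightarrow\}$, these two numbers coincide and their common value is denoted $\chi^{\mathrm{dir}}_{\mathcal{P}}$.) Then: (0) $\displaystyle\frac{1}{4(\chi^{\mathrm{st,dir}}_{\mathcal{P}}-1)}\leq\mathrm{dist}(\mathcal{H})\leq\frac{1}{\chi^{\mathrm{wk,dir}}_{\mathcal{P}}-1}$, if $\mathcal{P}=\mathcal{P}_0=\{\bigcirc,\leftarrow,\rightarrow,-\}$. (1) $\displaystyle\frac{1}{3(\chi^{\mathrm{st,dir}}_{\mathcal{P}}-1)}\leq\mathrm{dist}(\mathcal{H})\leq\frac{1}{\chi^{\mathrm{wk,dir}}_{\mathcal{P}}-1}$, if $\mathcal{P}=\mathcal{P}_{\mathrm{compl}}=\{-,\leftarrow,\rightarrow\}$. (2) $\displaystyle\frac{1}{3(\chi^{\mathrm{st,dir}}_{\mathcal{P}}-1)}\leq\mathrm{dist}(\mathcal{H})\leq\frac{1}{\chi^{\mathrm{wk,dir}}_{\mathcal{P}}-1}$, if $\mathcal{P}=\mathcal{P}_{\mathrm{orien}}=\{\bigcirc,\leftarrow,\rightarrow\}$.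 (3) $\displaystyle\frac{1}{2(\chi^{\mathrm{dir}}_{\mathcal{P}}-1)}\leq\mathrm{dist}(\mathcal{H})\leq\frac{1}{\chi^{\mathrm{dir}}_{\mathcal{P}}-1}$, if $\mathcal{P}=\mathcal{P}_{\mathrm{undir}}=\{\bigcirc,-\}$. (4) $\displaystyle\mathrm{dist}(\mathcal{H})=\frac{1}{2(\chi^{\mathrm{dir}}_{\mathcal{P}}-1)}$, if $\mathcal{P}=\mathcal{P}_{\mathrm{tourn}}=\{\leftarrow,\rightarrow\}$.
   Context: Digraphs. A (simple) digraph is a pair $G=(V,c)$ with $V$ a finite labeled vertex set and $c$ a function from the ordered pairs of distinct vertices to $\{\bigcirc,-,\leftarrow,\rightarrow\}$ such that, for distinct $v,w$: $c(v,w)=c(w,v)$ iff $c(v,w)\in\{\bigcirc,-\}$; and $c(v,w)=\,\rightarrow$ iff $c(w,v)=\,\leftarrow$. Here $\bigcirc$ means no arc between $v,w$ (nonedge), $-$ means both arcs are present (bidirectional edge), and $\rightarrow$ means only the arc from $v$ to $w$ is present. "Directed edges" are the pairs colored $\leftarrow$ or $\rightarrow$. A palette $\mathcal{P}$ is a subset of $\{\bigcirc,-,\leftarrow,\rightarrow\}$ containing either both or none of $\leftarrow,\rightarrow$. Hereditary properties. A hereditary property of digraphs with respect to $\mathcal{P}$ is a set of digraphs, all of whose colors lie in $\mathcal{P}$, closed under vertex-deletion and isomorphism. $\mathrm{Forb}(H)$ is the set of digraphs with colors in $\mathcal{P}$ having no induced copy of $H$, and $\mathcal{F}(\mathcal{H})$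 is a family of digraphs with colors in $\mathcal{P}$ such that $\mathcal{H}=\bigcap_{H\in\mathcal{F}(\mathcal{H})}\mathrm{Forb}(H)$. Distance. For digraphs $G,G'$ with colors in $\mathcal{P}$ on the same $n$ labeled vertices, $\mathrm{dist}(G,G')$ is the number of unordered pairs of vertices on which the colors differ, divided by $\binom n2$. $\mathrm{dist}(G,\mathcal{H})=\min\{\mathrm{dist}(G,G'):V(G')=V(G),G'\in\mathcal{H}\}$; $\mathrm{dist}(n,\mathcal{H})=\max\{\mathrm{dist}(G,\mathcal{H}):|V(G)|=n\}$ over digraphs $G$ with colors in $\mathcal{P}$; $\mathrm{dist}(\mathcal{H})=\lim_{n\to\infty}\mathrm{dist}(n,\mathcal{H})$. Weak directed chromatic number. A triple $(a_0,a_1,a_2)$ of non-negative integers is weakly-good if for some $H\in\mathcal{F}(\mathcal{H})$, $V(H)$ can be partitioned into (possibly empty) sets $S_0,S_1,S_2$, with $S_i=\emptyset$ if $a_i=0$, such that for each $i\in\{0,1,2\}$ with $a_i\neq0$ the partition can be further refined as $S_i=V_{i,1}\cup\cdots\cup V_{i,a_i}$ (parts possibly empty) where: each $V_{0,j}$ induces no edge of color $\bigcirc$; the directed edges induced by each $V_{1,j}$ form an acyclic digraph; each $V_{2,j}$ induces no edge of color $-$. The weak clique spectrum of $\mathcal{H}$ with respect to $\mathcal{P}$ is the set of triples that are not weakly-good and satisfy: $a_0=0$ if $\bigcirc\notin\mathcal{P}$; $a_1=0$ if $\{\leftarrow,\rightarrow\}\cap\mathcal{P}=\emptyset$; $a_2=0$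 if $-\notin\mathcal{P}$. $\chi^{\mathrm{wk,dir}}_{\mathcal{P}}(\mathcal{H})$ is the maximum $\ell+1$ such that some triple of non-negative integers with $a_0+a_1+a_2=\ell$ is in the weak clique spectrum. Strong directed chromatic number. A triple is strongly-good if the same holds with the conditions on the parts replaced by: every pair in each $V_{0,j}$ has color $\bigcirc$; each $V_{1,j}$ induces a transitive tournament; every pair in each $V_{2,j}$ has color $-$. The strong clique spectrum with respect to $\mathcal{P}$ is the set of triples that are not strongly-good and satisfy the same three vanishing conditions on $a_0,a_1,a_2$. $\chi^{\mathrm{st,dir}}_{\mathcal{P}}(\mathcal{H})$ is the maximum $\ell+1$ such that some triple of non-negative integers with $a_0+a_1+a_2=\ell$ is in the strong clique spectrum. *)

theory Defs
  imports Complex_Main "HOL-Library.Extended_Real" "HOL-Library.Disjoint_Sets"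
begin

text \<open>
  Vertex labels are natural numbers. The value \<open>col G v w\<close> is meaningful only for
  distinct vertices \<open>v\<close>, \<open>w\<close> of \<open>G\<close>; all notions below ignore the remaining values.
  \<open>Forward\<close> at \<open>(v, w)\<close> means that only the arc from \<open>v\<close> to \<open>w\<close> is present, \<open>Backward\<close>
  that only the arc from \<open>w\<close> to \<open>v\<close> is, and \<open>Bidir\<close> that both are.
\<close>

datatype color = Nonedge | Bidir | Backward | Forward

datatype digraph = Digraph (verts: "nat set") (col: "nat \<Rightarrow> nat \<Rightarrow> color")

definition is_digraph :: "digraph \<Rightarrow> bool" where
  "is_digraph G \<longleftrightarrow> finite (verts G) \<and>
     (\<forall>v\<in>verts G. \<forall>w\<in>verts G. v \<noteq> w \<longrightarrow>
        (col G v w = col G w v \<longleftrightarrow> col G v w \<in> {Nonedge, Bidir}) \<and>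
        (col G v w = Forward \<longleftrightarrow> col G w v = Backward))"

definition palette :: "color set \<Rightarrow> bool" where
  "palette P \<longleftrightarrow> (Backward \<in> P \<longleftrightarrow> Forward \<in> P)"

definition digraphs_over :: "color set \<Rightarrow> digraph set" where
  "digraphs_over P = {G. is_digraph G \<and>
     (\<forall>v\<in>verts G. \<forall>w\<in>verts G. v \<noteq> w \<longrightarrow> col G v w \<in> P)}"

definition digraph_iso :: "digraph \<Rightarrow> digraph \<Rightarrow> bool" where
  "digraph_iso G G' \<longleftrightarrow> (\<exists>f. bij_betw f (verts G) (verts G') \<and>
     (\<forall>v\<in>verts G. \<forall>w\<in>verts G. v \<noteq> w \<longrightarrow> col G' (f v) (f w) = col G v w))"

definition induced :: "digraph \<Rightarrow> nat set \<Rightarrow> digraph" where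
  "induced G W = Digraph (verts G \<inter> W) (col G)"

definition delete_vertex :: "digraph \<Rightarrow> nat \<Rightarrow> digraph" where
  "delete_vertex G v = induced G (verts G - {v})"

definition hereditary :: "color set \<Rightarrow> digraph set \<Rightarrow> bool" where
  "hereditary P \<H> \<longleftrightarrow> \<H> \<subseteq> digraphs_over P \<and>
     (\<forall>G\<in>\<H>. \<forall>v\<in>verts G. delete_vertex G v \<in> \<H>) \<and>
     (\<forall>G\<in>\<H>. \<forall>G'. is_digraph G' \<longrightarrow> digraph_iso G G' \<longrightarrow> G' \<in> \<H>)"

definition Forb :: "color set \<Rightarrow> digraph \<Rightarrow> digraph set" where
  "Forb P H = {G \<in> digraphs_over P. \<not> (\<exists>W\<subseteq>verts G. digraph_iso H (induced G W))}"

text \<open>The intersection is taken inside \<open>digraphs_over P\<close>, which matters only for \<open>\<F> = {}\<close>.\<close>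

definition forbidden_family :: "color set \<Rightarrow> digraph set \<Rightarrow> digraph set \<Rightarrow> bool" where
  "forbidden_family P \<H> \<F> \<longleftrightarrow> \<F> \<subseteq> digraphs_over P \<and>
     \<H> = digraphs_over P \<inter> (\<Inter>H\<in>\<F>. Forb P H)"

definition dist_digraph :: "digraph \<Rightarrow> digraph \<Rightarrow> real" where
  "dist_digraph G G' =
     real (card {{v, w} | v w. v \<in> verts G \<and> w \<in> verts G \<and> v \<noteq> w \<and> col G v w \<noteq> col G' v w})
     / real (card (verts G) choose 2)"

text \<open>
  Minima and maxima are rendered as infima and suprema in the extended reals; only finitely
  many values occur, so they are attained whenever the index set is nonempty. If no member of
  \<open>\<H>\<close> lives on the vertex set of \<open>G\<close>, the distance is \<open>\<infinity>\<close>.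
\<close>

definition dist_property :: "digraph \<Rightarrow> digraph set \<Rightarrow> ereal" where
  "dist_property G \<H> = (INF G' \<in> {G' \<in> \<H>. verts G' = verts G}. ereal (dist_digraph G G'))"

definition dist_n :: "color set \<Rightarrow> digraph set \<Rightarrow> nat \<Rightarrow> ereal" where
  "dist_n P \<H> n = (SUP G \<in> {G \<in> digraphs_over P. card (verts G) = n}. dist_property G \<H>)"

definition dist_lim :: "color set \<Rightarrow> digraph set \<Rightarrow> ereal" where
  "dist_lim P \<H> = lim (\<lambda>n. dist_n P \<H> n)"

definition dir_arcs :: "digraph \<Rightarrow> nat set \<Rightarrow> (nat \<times> nat) set" where
  "dir_arcs G X = {(v, w). v \<in> X \<and> w \<in> X \<and> v \<noteq> w \<and> col G v w = Forward}"

definition avoids_color :: "color \<Rightarrow> digraph \<Rightarrow> nat set \<Rightarrow> bool" where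
  "avoids_color k G X \<longleftrightarrow> (\<forall>v\<in>X. \<forall>w\<in>X. v \<noteq> w \<longrightarrow> col G v w \<noteq> k)"

definition all_color :: "color \<Rightarrow> digraph \<Rightarrow> nat set \<Rightarrow> bool" where
  "all_color k G X \<longleftrightarrow> (\<forall>v\<in>X. \<forall>w\<in>X. v \<noteq> w \<longrightarrow> col G v w = k)"

definition acyclic_part :: "digraph \<Rightarrow> nat set \<Rightarrow> bool" where
  "acyclic_part G X \<longleftrightarrow> acyclic (dir_arcs G X)"

definition transitive_tournament :: "digraph \<Rightarrow> nat set \<Rightarrow> bool" where
  "transitive_tournament G X \<longleftrightarrow>
     (\<forall>v\<in>X. \<forall>w\<in>X. v \<noteq> w \<longrightarrow> col G v w \<in> {Backward, Forward}) \<and> trans (dir_arcs G X)"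

text \<open>Parts may be empty; for \<open>a = 0\<close> the condition says exactly \<open>S = {}\<close>.\<close>

definition splits_into :: "(nat set \<Rightarrow> bool) \<Rightarrow> nat \<Rightarrow> nat set \<Rightarrow> bool" where
  "splits_into Q a S \<longleftrightarrow>
     (\<exists>V. S = (\<Union>j<a. V j) \<and> disjoint_family_on V {..<a} \<and> (\<forall>j<a. Q (V j)))"

definition weakly_good :: "digraph set \<Rightarrow> nat \<times> nat \<times> nat \<Rightarrow> bool" where
  "weakly_good \<F> = (\<lambda>(a0, a1, a2). \<exists>H\<in>\<F>. \<exists>S0 S1 S2.
     verts H = S0 \<union> S1 \<union> S2 \<and> S0 \<inter> S1 = {} \<and> S0 \<inter> S2 = {} \<and> S1 \<inter> S2 = {} \<and>
     splits_into (avoids_color Nonedge H) a0 S0 \<and>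
     splits_into (acyclic_part H) a1 S1 \<and>
     splits_into (avoids_color Bidir H) a2 S2)"

definition strongly_good :: "digraph set \<Rightarrow> nat \<times> nat \<times> nat \<Rightarrow> bool" where
  "strongly_good \<F> = (\<lambda>(a0, a1, a2). \<exists>H\<in>\<F>. \<exists>S0 S1 S2.
     verts H = S0 \<union> S1 \<union> S2 \<and> S0 \<inter> S1 = {} \<and> S0 \<inter> S2 = {} \<and> S1 \<inter> S2 = {} \<and>
     splits_into (all_color Nonedge H) a0 S0 \<and>
     splits_into (transitive_tournament H) a1 S1 \<and>
     splits_into (all_color Bidir H) a2 S2)"

definition admissible :: "color set \<Rightarrow> nat \<times> nat \<times> nat \<Rightarrow> bool" where
  "admissible P = (\<lambda>(a0, a1, a2).
     (Nonedge \<notin> P \<longrightarrow> a0 = 0) \<and>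
     ({Backward, Forward} \<inter> P = {} \<longrightarrow> a1 = 0) \<and>
     (Bidir \<notin> P \<longrightarrow> a2 = 0))"

definition weak_spectrum :: "color set \<Rightarrow> digraph set \<Rightarrow> (nat \<times> nat \<times> nat) set" where
  "weak_spectrum P \<F> = {t. \<not> weakly_good \<F> t \<and> admissible P t}"

definition strong_spectrum :: "color set \<Rightarrow> digraph set \<Rightarrow> (nat \<times> nat \<times> nat) set" where
  "strong_spectrum P \<F> = {t. \<not> strongly_good \<F> t \<and> admissible P t}"

text \<open>
  The maximum is a supremum in \<^typ>\<open>enat\<close>: it is \<open>\<infinity>\<close> if the spectrum is unbounded (only for
  \<open>\<F> = {}\<close>, when every digraph over the palette has the property) and \<open>0\<close> if the spectrum is
  empty (only if \<open>\<F>\<close> contains the digraph without vertices, when no digraph has the property).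
  Bounds are read in the extended reals, where \<open>1 / 0 = \<infinity>\<close> and \<open>1 / \<infinity> = 0\<close>; the truncated
  subtraction of \<^typ>\<open>enat\<close> in \<open>chi_wk P \<F> - 1\<close> matters only when the spectrum is empty.
\<close>

definition chi_wk :: "color set \<Rightarrow> digraph set \<Rightarrow> enat" where
  "chi_wk P \<F> = (SUP (a0, a1, a2) \<in> weak_spectrum P \<F>. enat (a0 + a1 + a2 + 1))"

definition chi_st :: "color set \<Rightarrow> digraph set \<Rightarrow> enat" where
  "chi_st P \<F> = (SUP (a0, a1, a2) \<in> strong_spectrum P \<F>. enat (a0 + a1 + a2 + 1))"

end

theory Submission
  imports Defs "HOL-Library.Ramsey" "HOL-Library.FuncSet"
begin

text \<open>
  Upper bounds: if a triple with \<open>l\<close> parts is not weakly good, split the vertices of a digraph into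
  \<open>l\<close> classes of almost equal size and edit inside each class according to the type of its part; no
  forbidden digraph survives, and at most the proportion \<open>1 / l\<close> of the pairs has changed.

  Lower bounds: if all triples with \<open>l + 1\<close> parts are strongly good, Ramsey's theorem shows that a
  member of the property cannot realise all \<open>(l + 1)\<close>-partite patterns of some bounded size.
  Take \<open>t\<close> blocks with a quasirandom colouring between any two of them. In a member of the
  property on the same vertices, any \<open>t\<close> large subsets of the blocks shrink to subsets of positive
  proportion such that among any \<open>l + 1\<close> of them there is a pair on which some colour is almost
  absent. By Turan's theorem about \<open>t\<^sup>2 / (2 * l)\<close> of the pairs are of this kind, and on each of
  them about the proportion \<open>1 / card P\<close> of the entries has changed. Decomposing the product of
  the blocks into such cylinders transfers this density to the whole digraph. This replaces the
  regularity lemma.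

  The limit exists because blowing up a digraph on \<open>N\<close> vertices multiplies its distance by a factor
  tending to \<open>1 - 1 / N\<close>.
\<close>

section \<open>Digraphs\<close>

text \<open>Every colour has density about \<open>1 / card P\<close> in the host, so whichever
  colour is missing between two parts costs this proportion; the factors 4, 3 and 2 are the sizes of
  the palettes. For tournaments the upper bound is halved to meet the lower one: editing along a
  vertex order or along its reverse changes complementary sets of the arcs inside the classes. The
  obstacle in the lower bound is that a member of the property is known to be sparse only on some
  small subsets, while the distance counts all pairs. The sum of the densities between the sides of
  a cylinder is an average over transversals, hence it averages over every subdivision. Each
  cylinder with large sides contains a good one of proportion at least \<open>rho ^ t\<close>, and
  the rest is again made of cylinders, so the uncovered proportion decays like
  \<open>(1 - rho ^ t) ^ s\<close>. For this \<open>rho\<close> must not depend on the host: the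
  forbidden digraphs fix the size of the pattern, this size together with \<open>eps\<close> and
  \<open>t\<close> fixes \<open>rho\<close>, then the number of rounds is fixed, and the size of the
  blocks is chosen last.\<close>

fun conv :: "color \<Rightarrow> color" where
  "conv Nonedge = Nonedge"
| "conv Bidir = Bidir"
| "conv Backward = Forward"
| "conv Forward = Backward"

lemma conv_conv [simp]: "conv (conv c) = c"
  by (cases c) auto

lemma conv_eq_iff [simp]: "conv c = conv d \<longleftrightarrow> c = d"
  by (metis conv_conv)

lemma conv_in_palette: "palette P \<Longrightarrow> conv c \<in> P \<longleftrightarrow> c \<in> P"
  by (cases c) (auto simp: palette_def)

lemma is_digraph_conv:
  "is_digraph G \<longleftrightarrow> finite (verts G) \<and>
     (\<forall>v\<in>verts G. \<forall>w\<in>verts G. v \<noteq> w \<longrightarrow> col G w v = conv (col G v w))"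
  (is "_ \<longleftrightarrow> _ \<and> ?C")
proof -
  \<comment> \<open>The last conjunct is the condition at the swapped pair; without it
    \<open>c = Backward\<close> would also admit \<open>d = Nonedge\<close>.\<close>
  have *: "(c = d \<longleftrightarrow> c \<in> {Nonedge, Bidir}) \<and> (c = Forward \<longleftrightarrow> d = Backward) \<and>
        (d = Forward \<longleftrightarrow> c = Backward) \<longleftrightarrow> d = conv c" for c d
    by (cases c; cases d) auto
  have "?C" if "is_digraph G"
  proof (intro ballI impI)
    fix v w assume vw: "v \<in> verts G" "w \<in> verts G" "v \<noteq> w"
    show "col G w v = conv (col G v w)"
      using that vw unfolding is_digraph_def *[symmetric] by simp
  qed
  moreover have "is_digraph G" if "finite (verts G)" ?C
    unfolding is_digraph_def
  proof (intro conjI ballI impI that(1))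
    fix v w assume vw: "v \<in> verts G" "w \<in> verts G" "v \<noteq> w"
    then have "col G w v = conv (col G v w)"
      using that(2) by blast
    then show "col G v w = col G w v \<longleftrightarrow> col G v w \<in> {Nonedge, Bidir}"
      "col G v w = Forward \<longleftrightarrow> col G w v = Backward"
      using *[of "col G v w" "col G w v"] by blast+
  qed
  ultimately show ?thesis
    unfolding is_digraph_def by blast
qed

lemma digraphs_over_iff:
  "G \<in> digraphs_over P \<longleftrightarrow> finite (verts G) \<and>
     (\<forall>v\<in>verts G. \<forall>w\<in>verts G. v \<noteq> w \<longrightarrow> col G w v = conv (col G v w) \<and> col G v w \<in> P)"
  unfolding digraphs_over_def is_digraph_conv by blast

lemma digraphs_over_D:
  assumes "G \<in> digraphs_over P"
  shows "finite (verts G)"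
    and "\<And>v w. v \<in> verts G \<Longrightarrow> w \<in> verts G \<Longrightarrow> v \<noteq> w \<Longrightarrow> col G w v = conv (col G v w)"
    and "\<And>v w. v \<in> verts G \<Longrightarrow> w \<in> verts G \<Longrightarrow> v \<noteq> w \<Longrightarrow> col G v w \<in> P"
  using assms unfolding digraphs_over_iff by blast+

text \<open>Hosts, blow-ups and edited digraphs are given by free choices on increasing pairs; the
  opposite colours are then forced, and only the values of \<open>a\<close> at \<open>v < w\<close>
  matter.\<close>

definition oriented_by :: "nat set \<Rightarrow> (nat \<Rightarrow> nat \<Rightarrow> color) \<Rightarrow> digraph" where
  "oriented_by V a = Digraph V (\<lambda>v w. if v < w then a v w else conv (a w v))"

lemma verts_oriented_by [simp]: "verts (oriented_by V a) = V"
  by (simp add: oriented_by_def)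

lemma col_oriented_by: "col (oriented_by V a) v w = (if v < w then a v w else conv (a w v))"
  by (simp add: oriented_by_def)

lemma oriented_by_in_digraphs_over:
  assumes "palette P" "finite V"
    and "\<And>v w. v \<in> V \<Longrightarrow> w \<in> V \<Longrightarrow> v < w \<Longrightarrow> a v w \<in> P"
  shows "oriented_by V a \<in> digraphs_over P"
  using assms by (auto simp: digraphs_over_iff col_oriented_by conv_in_palette)

lemma digraph_iso_inducedI:
  assumes "bij_betw f (verts H) W" "W \<subseteq> verts G"
    and "\<And>v w. v \<in> verts H \<Longrightarrow> w \<in> verts H \<Longrightarrow> v \<noteq> w \<Longrightarrow> col G (f v) (f w) = col H v w"
  shows "digraph_iso H (induced G W)"
proof -
  have "verts G \<inter> W = W"
    using assms(2) by auto
  then show ?thesis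
    using assms unfolding digraph_iso_def induced_def by auto
qed

section \<open>Members of the property and copies of forbidden digraphs\<close>

lemma member_no_copy:
  assumes "forbidden_family P \<H> \<F>" "G \<in> \<H>" "H \<in> \<F>"
    and "inj_on f (verts H)" "f ` verts H \<subseteq> verts G"
    and "\<And>v w. v \<in> verts H \<Longrightarrow> w \<in> verts H \<Longrightarrow> v \<noteq> w \<Longrightarrow> col G (f v) (f w) = col H v w"
  shows False
proof -
  have "digraph_iso H (induced G (f ` verts H))"
    using assms by (intro digraph_iso_inducedI[where f = f]) (auto simp: bij_betw_def)
  moreover have "G \<in> Forb P H"
    using assms(1-3) unfolding forbidden_family_def by auto
  ultimately show False
    using assms(5) unfolding Forb_def by auto
qed

lemma member_if_no_copy:
  assumes "forbidden_family P \<H> \<F>" "G \<in> digraphs_over P"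
    and "\<And>H f. H \<in> \<F> \<Longrightarrow> inj_on f (verts H) \<Longrightarrow> f ` verts H \<subseteq> verts G \<Longrightarrow>
           (\<And>v w. v \<in> verts H \<Longrightarrow> w \<in> verts H \<Longrightarrow> v \<noteq> w \<Longrightarrow> col G (f v) (f w) = col H v w) \<Longrightarrow>
           False"
  shows "G \<in> \<H>"
proof -
  have "G \<in> Forb P H" if "H \<in> \<F>" for H
  proof -
    have False if "W \<subseteq> verts G" "digraph_iso H (induced G W)" for W
    proof -
      obtain f where "bij_betw f (verts H) (verts G \<inter> W)"
        "\<forall>v\<in>verts H. \<forall>w\<in>verts H. v \<noteq> w \<longrightarrow> col G (f v) (f w) = col H v w"
        using \<open>digraph_iso H (induced G W)\<close> unfolding digraph_iso_def induced_def by auto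
      then show False
        using assms(3)[OF \<open>H \<in> \<F>\<close>, of f] by (auto simp: bij_betw_def)
    qed
    then show ?thesis
      using assms(2) unfolding Forb_def by auto
  qed
  then show ?thesis
    using assms(1,2) unfolding forbidden_family_def by auto
qed

lemma forbidden_family_digraphs_over:
  "forbidden_family P \<H> \<F> \<Longrightarrow> G \<in> \<H> \<Longrightarrow> G \<in> digraphs_over P"
  "forbidden_family P \<H> \<F> \<Longrightarrow> H \<in> \<F> \<Longrightarrow> H \<in> digraphs_over P"
  unfolding forbidden_family_def by auto

text \<open>A copy of a forbidden digraph in the pullback composes with \<open>u\<close> to a copy
  in \<open>G\<close>. For blow-ups this turns a transversal into a member on the original vertex
  set.\<close>

lemma pullback_in_property:
  assumes F: "forbidden_family P \<H> \<F>" and G: "G \<in> \<H>"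
    and V: "finite V" "inj_on u V" "u ` V \<subseteq> verts G"
  shows "Digraph V (\<lambda>v w. col G (u v) (u w)) \<in> \<H>"
proof (rule member_if_no_copy[OF F])
  have G': "G \<in> digraphs_over P"
    using forbidden_family_digraphs_over(1)[OF F G] .
  have neq: "u v \<noteq> u w" "u v \<in> verts G" "u w \<in> verts G" if "v \<in> V" "w \<in> V" "v \<noteq> w" for v w
    using V that by (simp add: inj_on_eq_iff, blast, blast)
  show "Digraph V (\<lambda>v w. col G (u v) (u w)) \<in> digraphs_over P"
    unfolding digraphs_over_iff digraph.sel
    using V(1) digraphs_over_D(2,3)[OF G' neq(2,3,1)] by blast
next
  fix H f
  assume H: "H \<in> \<F>" and f: "inj_on f (verts H)"
    "f ` verts H \<subseteq> verts (Digraph V (\<lambda>v w. col G (u v) (u w)))"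
    "\<And>v w. v \<in> verts H \<Longrightarrow> w \<in> verts H \<Longrightarrow> v \<noteq> w \<Longrightarrow>
       col (Digraph V (\<lambda>v w. col G (u v) (u w))) (f v) (f w) = col H v w"
  have "inj_on (u \<circ> f) (verts H)"
    using f(1,2) V(2) by (intro comp_inj_on) (auto intro: inj_on_subset)
  then show False
    using f(2,3) V by (intro member_no_copy[OF F G H, of "u \<circ> f"]) (auto simp: image_subset_iff)
qed

section \<open>Distance as a count of increasing pairs\<close>

definition changes :: "digraph \<Rightarrow> digraph \<Rightarrow> (nat \<times> nat) set" where
  "changes G G' = {(v, w). v \<in> verts G \<and> w \<in> verts G \<and> v < w \<and> col G v w \<noteq> col G' v w}"

lemma finite_changes [simp]: "finite (verts G) \<Longrightarrow> finite (changes G G')"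
  by (rule finite_subset[of _ "verts G \<times> verts G"]) (auto simp: changes_def)

text \<open>Two digraphs that differ at \<open>(v, w)\<close> also differ at \<open>(w, v)\<close>,
  because \<open>conv\<close> is injective, so each unordered pair is represented once, by its
  increasing order.\<close>

lemma dist_digraph_eq:
  assumes "G \<in> digraphs_over P" "G' \<in> digraphs_over P" "verts G' = verts G"
  shows "dist_digraph G G' = real (card (changes G G')) / real (card (verts G) choose 2)"
proof -
  let ?S = "{{v, w} | v w. v \<in> verts G \<and> w \<in> verts G \<and> v \<noteq> w \<and> col G v w \<noteq> col G' v w}"
  have conv: "col G w v = conv (col G v w)" "col G' w v = conv (col G' v w)"
    if "v \<in> verts G" "w \<in> verts G" "v \<noteq> w" for v w
    using digraphs_over_D(2)[OF assms(1), of v w] digraphs_over_D(2)[OF assms(2), of v w] that assms(3)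
    by simp_all
  have "?S = (\<lambda>(v, w). {v, w}) ` changes G G'"
  proof (intro set_eqI iffI)
    fix e assume "e \<in> ?S"
    then obtain v w where vw: "e = {v, w}" "v \<in> verts G" "w \<in> verts G" "v \<noteq> w"
      "col G v w \<noteq> col G' v w" by auto
    show "e \<in> (\<lambda>(v, w). {v, w}) ` changes G G'"
    proof (cases "v < w")
      case True
      then have "(v, w) \<in> changes G G'" using vw by (auto simp: changes_def)
      then show ?thesis using vw(1) by (intro image_eqI[of _ _ "(v, w)"]) auto
    next
      case False
      then have "(w, v) \<in> changes G G'"
        using vw conv[of v w] by (auto simp: changes_def)
      then show ?thesis using vw(1) by (intro image_eqI[of _ _ "(w, v)"]) (auto simp: insert_commute)
    qed
  qed (force simp: changes_def)
  moreover have "inj_on (\<lambda>(v, w). {v, w}) (changes G G')"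
    by (auto simp: inj_on_def changes_def doubleton_eq_iff)
  ultimately have "card ?S = card (changes G G')"
    by (simp add: card_image)
  then show ?thesis
    unfolding dist_digraph_def by simp
qed

section \<open>Densities of cylinders\<close>

definition den :: "('a \<Rightarrow> 'a \<Rightarrow> real) \<Rightarrow> 'a set \<Rightarrow> 'a set \<Rightarrow> real" where
  "den w A B = (\<Sum>a\<in>A. \<Sum>b\<in>B. w a b) / (real (card A) * real (card B))"

text \<open>With nonempty sides this is the expected total weight of the pairs of a random
  transversal; on an empty side \<open>den\<close> is 0 by the convention for division by
  zero.\<close>

definition cyl :: "('a \<Rightarrow> 'a \<Rightarrow> real) \<Rightarrow> nat \<Rightarrow> (nat \<Rightarrow> 'a set) \<Rightarrow> real" where
  "cyl w t Y = (\<Sum>(i, j) \<in> {(i, j). i < j \<and> j < t}. den w (Y i) (Y j))"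

lemma finite_index_pairs [simp]: "finite {(i, j). i < j \<and> j < (t::nat)}"
  by (rule finite_subset[of _ "{..<t} \<times> {..<t}"]) auto

lemma den_left:
  assumes "finite A" "A \<noteq> {}"
  shows "real (card A) * den w A B = (\<Sum>a\<in>A. den w {a} B)"
  using assms by (simp add: den_def flip: sum_divide_distrib)

lemma den_right:
  assumes "finite B" "B \<noteq> {}"
  shows "real (card B) * den w A B = (\<Sum>b\<in>B. den w A {b})"
  using assms by (simp add: den_def sum.swap[of _ A B] flip: sum_divide_distrib)

lemma den_nonneg: "(\<And>a b. w a b \<ge> 0) \<Longrightarrow> den w A B \<ge> 0"
  by (simp add: den_def sum_nonneg)

text \<open>The terms that involve side \<open>i\<close> are averages over \<open>Y i\<close>, and
  the other terms do not see the replaced side.\<close>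

lemma cyl_sum:
  assumes "finite (Y i)" "Y i \<noteq> {}"
  shows "real (card (Y i)) * cyl w t Y = (\<Sum>a\<in>Y i. cyl w t (Y(i := {a})))"
proof -
  have *: "real (card (Y i)) * den w (Y p) (Y q) =
      (\<Sum>a\<in>Y i. den w ((Y(i := {a})) p) ((Y(i := {a})) q))" if "p < q" for p q
    using den_left[OF assms, of w] den_right[OF assms, of w] that by (cases "p = i"; cases "q = i") auto
  have "real (card (Y i)) * cyl w t Y =
     (\<Sum>(p, q) \<in> {(p, q). p < q \<and> q < t}. \<Sum>a\<in>Y i. den w ((Y(i := {a})) p) ((Y(i := {a})) q))"
    unfolding cyl_def sum_distrib_left
    by (rule sum.cong) (auto simp: * simp del: fun_upd_apply)
  also have "\<dots> = (\<Sum>a\<in>Y i. cyl w t (Y(i := {a})))"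
    unfolding cyl_def case_prod_beta by (rule sum.swap)
  finally show ?thesis .
qed

text \<open>Both sides expand into the same sum over the single vertices of
  \<open>A \<union> B\<close>.\<close>

lemma cyl_split:
  assumes "finite A" "finite B" "A \<noteq> {}" "B \<noteq> {}" "A \<inter> B = {}" "Y i = A \<union> B"
  shows "(real (card A) + real (card B)) * cyl w t Y =
    real (card A) * cyl w t (Y(i := A)) + real (card B) * cyl w t (Y(i := B))"
  using cyl_sum[of Y i w t] cyl_sum[of "Y(i := A)" i w t] cyl_sum[of "Y(i := B)" i w t] assms
  by (simp add: card_Un_disjoint sum.union_disjoint)

text \<open>The method of conditional expectations: the sides are fixed one after another to a
  vertex that does not raise the average.\<close>

lemma cyl_transversal:
  assumes "\<And>i. i < t \<Longrightarrow> finite (Y i) \<and> Y i \<noteq> {}"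
  shows "\<exists>u. (\<forall>i<t. u i \<in> Y i) \<and> cyl w t (\<lambda>i. {u i}) \<le> cyl w t Y"
proof -
  have "s \<le> t \<Longrightarrow> \<exists>u. (\<forall>i<s. u i \<in> Y i) \<and> cyl w t (\<lambda>i. if i < s then {u i} else Y i) \<le> cyl w t Y" for s
  proof (induction s)
    case 0
    then show ?case by simp
  next
    case (Suc s)
    then obtain u where u: "\<forall>i<s. u i \<in> Y i"
      "cyl w t (\<lambda>i. if i < s then {u i} else Y i) \<le> cyl w t Y" (is "cyl w t ?Z \<le> _") by auto
    have fin: "finite (Y s)" "Y s \<noteq> {}" using assms Suc.prems by auto
    have "\<exists>a\<in>Y s. cyl w t (?Z(s := {a})) \<le> cyl w t ?Z"
    proof (rule ccontr)
      assume "\<not> ?thesis"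
      then have "(\<Sum>a\<in>Y s. cyl w t ?Z) < (\<Sum>a\<in>Y s. cyl w t (?Z(s := {a})))"
        using fin by (intro sum_strict_mono) (auto simp: not_le)
      then show False
        using cyl_sum[of ?Z s w t] fin by simp
    qed
    then obtain a where a: "a \<in> Y s" "cyl w t (?Z(s := {a})) \<le> cyl w t ?Z" by blast
    have "?Z(s := {a}) = (\<lambda>i. if i < Suc s then {(u(s := a)) i} else Y i)"
      by (auto simp: fun_eq_iff)
    then show ?case
      using a u by (intro exI[of _ "u(s := a)"]) (auto simp: less_Suc_eq)
  qed
  from this[of t] obtain u where u: "\<forall>i<t. u i \<in> Y i"
    "cyl w t (\<lambda>i. if i < t then {u i} else Y i) \<le> cyl w t Y" by auto
  have "cyl w t (\<lambda>i. if i < t then {u i} else Y i) = cyl w t (\<lambda>i. {u i})"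
    unfolding cyl_def by (rule sum.cong) auto
  then show ?thesis using u by auto
qed

text \<open>Cutting every side into \<open>Z i\<close> and the rest gives \<open>2 ^ t\<close>
  cylinders. The one with sides \<open>Z\<close> has the better bound \<open>\<beta>\<close> and
  makes up at least the proportion \<open>rho ^ t\<close> of the product; the others still
  contribute \<open>\<gamma>\<close>.\<close>

lemma cyl_gain:
  assumes Y: "\<And>i. i < t \<Longrightarrow> finite (Y i)"
    and Z: "\<And>i. i < t \<Longrightarrow> Z i \<subseteq> Y i \<and> Z i \<noteq> {} \<and> Y i - Z i \<noteq> {} \<and> rho * real (card (Y i)) \<le> real (card (Z i))"
    and other: "\<And>X. (\<And>i. i < t \<Longrightarrow> X i \<in> {Y i, Z i, Y i - Z i}) \<Longrightarrow> cyl w t X \<ge> \<gamma>"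
    and \<beta>: "cyl w t Z \<ge> \<beta>" "\<beta> \<ge> \<gamma>" and rho: "rho \<ge> 0"
  shows "cyl w t Y \<ge> \<gamma> + rho ^ t * (\<beta> - \<gamma>)"
proof -
  \<comment> \<open>The last \<open>s\<close> sides are whole and the others cut down. Restoring
    side \<open>t - Suc s\<close> averages \<open>g s\<close> with a cylinder to which
    \<open>other\<close> applies.\<close>
  define g where "g s = (\<lambda>i. if i < t - s then Z i else Y i)" for s
  have "s \<le> t \<Longrightarrow> cyl w t (g s) - \<gamma> \<ge> rho ^ s * (\<beta> - \<gamma>)" for s
  proof (induction s)
    case 0
    have "cyl w t (g 0) = cyl w t Z"
      unfolding cyl_def g_def by (rule sum.cong) auto
    then show ?case using \<beta> by simp
  next
    case (Suc s)
    define i where "i = t - Suc s"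
    have i: "i < t" "g (Suc s) i = Y i" using Suc.prems by (auto simp: g_def i_def)
    have gs: "(g (Suc s))(i := Z i) = g s"
      using Suc.prems by (auto simp: g_def i_def fun_eq_iff)
    let ?a = "real (card (Z i))" and ?b = "real (card (Y i - Z i))"
    have ab: "?a > 0" "?b > 0" "?a + ?b = real (card (Y i))"
      using Y[OF i(1)] Z[OF i(1)] by (auto simp: card_gt_0_iff card_Diff_subset finite_subset card_mono
          simp flip: of_nat_add)
    have sp: "(?a + ?b) * cyl w t (g (Suc s)) =
       ?a * cyl w t (g s) + ?b * cyl w t ((g (Suc s))(i := Y i - Z i))"
      unfolding gs[symmetric] using i(2) Y[OF i(1)] Z[OF i(1)]
      by (intro cyl_split) (auto intro: finite_subset)
    have "cyl w t ((g (Suc s))(i := Y i - Z i)) \<ge> \<gamma>"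
      by (rule other) (auto simp: g_def)
    then have "?b * cyl w t ((g (Suc s))(i := Y i - Z i)) \<ge> ?b * \<gamma>"
      using ab(2) by simp
    then have "(?a + ?b) * (cyl w t (g (Suc s)) - \<gamma>) \<ge> ?a * (cyl w t (g s) - \<gamma>)"
      using sp by (simp add: algebra_simps)
    moreover have "?a * (cyl w t (g s) - \<gamma>) \<ge> ?a * (rho ^ s * (\<beta> - \<gamma>))"
      using Suc ab by (intro mult_left_mono) auto
    moreover have "?a * (rho ^ s * (\<beta> - \<gamma>)) \<ge> (rho * (?a + ?b)) * (rho ^ s * (\<beta> - \<gamma>))"
      using Z[OF i(1)] ab \<beta> rho by (intro mult_right_mono) auto
    ultimately have "(?a + ?b) * (cyl w t (g (Suc s)) - \<gamma>) \<ge> (?a + ?b) * (rho ^ Suc s * (\<beta> - \<gamma>))"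
      by (simp add: mult_ac)
    then show ?case
      using ab by (simp only: mult_le_cancel_left_pos)
  qed
  from this[of t] show ?thesis
    by (simp add: g_def)
qed

text \<open>Each of the \<open>s\<close> rounds multiplies the deficit below \<open>\<beta>\<close>
  by \<open>1 - rho ^ t\<close>. What is left over is searched again in the next round, which is why
  \<open>dense\<close> asks for large complements and why the sides must start larger than
  \<open>m\<close> by the factor \<open>rho ^ s\<close>.\<close>

lemma cyl_cover:
  fixes w :: "'a \<Rightarrow> 'a \<Rightarrow> real"
  assumes w: "\<And>a b. w a b \<ge> 0" and rho: "0 < rho" "rho \<le> 1" and \<beta>: "\<beta> \<ge> 0"
    and X: "\<And>i. i < t \<Longrightarrow> finite (X i)" and m: "m > 0"
    and dense: "\<And>Y. (\<And>i. i < t \<Longrightarrow> Y i \<subseteq> X i \<and> m \<le> real (card (Y i))) \<Longrightarrow>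
      \<exists>Z. (\<forall>i<t. Z i \<subseteq> Y i \<and> rho * real (card (Y i)) \<le> real (card (Z i)) \<and>
             rho * real (card (Y i)) \<le> real (card (Y i - Z i))) \<and> cyl w t Z \<ge> \<beta>"
    and Y: "\<And>i. i < t \<Longrightarrow> Y i \<subseteq> X i \<and> m \<le> rho ^ s * real (card (Y i))"
  shows "cyl w t Y \<ge> \<beta> * (1 - (1 - rho ^ t) ^ s)"
  using Y
proof (induction s arbitrary: Y)
  case 0
  have "cyl w t Y \<ge> 0"
    unfolding cyl_def by (intro sum_nonneg) (auto intro: den_nonneg w)
  then show ?case by simp
next
  case (Suc s)
  have rho_s: "rho ^ Suc s \<le> rho ^ s" using rho by (intro power_decreasing) auto
  have le: "rho ^ Suc s * real (card (Y i)) \<le> rho ^ s * real (card (Y i))" for i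
    using rho_s by (intro mult_right_mono) auto
  have rho_1: "rho ^ Suc s \<le> 1" using rho by (intro power_le_one) auto
  have "m \<le> real (card (Y i))" if "i < t" for i
    using Suc.prems[OF that] rho_1 mult_right_mono[OF rho_1, of "real (card (Y i))"] by auto
  then obtain Z where Z: "\<forall>i<t. Z i \<subseteq> Y i \<and> rho * real (card (Y i)) \<le> real (card (Z i)) \<and>
             rho * real (card (Y i)) \<le> real (card (Y i - Z i))" "cyl w t Z \<ge> \<beta>"
    using dense[of Y] Suc.prems by blast
  have fin: "finite (Y i)" if "i < t" for i
    using Suc.prems[OF that] X[OF that] finite_subset by blast
  have pos: "real (card (Y i)) > 0" if "i < t" for i
  proof (rule ccontr)
    assume "\<not> real (card (Y i)) > 0"
    then have "real (card (Y i)) = 0" by simp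
    then show False using Suc.prems[OF that] m by simp
  qed
  define \<gamma> where "\<gamma> = \<beta> * (1 - (1 - rho ^ t) ^ s)"
  have rho_t: "0 \<le> 1 - rho ^ t" "1 - rho ^ t \<le> 1"
    using rho by (auto intro: power_le_one)
  have "\<beta> \<ge> \<gamma>"
  proof -
    have "(1 - rho ^ t) ^ s \<ge> 0" using rho_t by simp
    then show ?thesis using \<beta> unfolding \<gamma>_def by (simp add: mult_left_le)
  qed
  have ne: "Z i \<noteq> {} \<and> Y i - Z i \<noteq> {}" if "i < t" for i
  proof -
    have "rho * real (card (Y i)) > 0" using pos[OF that] rho by simp
    then have "real (card (Z i)) > 0 \<and> real (card (Y i - Z i)) > 0"
      using Z that by (meson less_le_trans)
    then show ?thesis by (metis card.empty less_irrefl of_nat_0)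
  qed
  have "cyl w t Y \<ge> \<gamma> + rho ^ t * (\<beta> - \<gamma>)"
  proof (rule cyl_gain[where Z = Z])
    fix W assume W: "\<And>i. i < t \<Longrightarrow> W i \<in> {Y i, Z i, Y i - Z i}"
    show "cyl w t W \<ge> \<gamma>"
      unfolding \<gamma>_def
    proof (rule Suc.IH)
      fix i assume i: "i < t"
      have "rho * real (card (Y i)) \<le> real (card (W i))"
        using W[OF i] Z(1) i rho by (auto simp: mult_left_le_one_le)
      then have "rho ^ s * (rho * real (card (Y i))) \<le> rho ^ s * real (card (W i))"
        using rho by (intro mult_left_mono) auto
      then show "W i \<subseteq> X i \<and> m \<le> rho ^ s * real (card (W i))"
        using Suc.prems[OF i] W[OF i] Z(1) i by (auto simp: mult_ac)
    qed
  qed (use fin Z ne \<open>\<beta> \<ge> \<gamma>\<close> rho in auto)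
  moreover have "\<gamma> + rho ^ t * (\<beta> - \<gamma>) = \<beta> * (1 - (1 - rho ^ t) ^ Suc s)"
    unfolding \<gamma>_def by (simp add: algebra_simps)
  ultimately show ?case by simp
qed

section \<open>Turan's theorem\<close>

text \<open>Induction over the neighbourhood of a vertex of maximal degree \<open>\<Delta>\<close>,
  where the forbidden clique is smaller by one vertex. An adjacent pair not inside this
  neighbourhood has an end outside it, so there are at most
  \<open>2 * (card V - \<Delta>) * \<Delta>\<close> of those. Pairs are counted in both
  orders.\<close>

lemma turan:
  fixes V :: "'a set"
  assumes "l \<ge> 1" "finite V" "\<And>u v. E u v \<Longrightarrow> E v u"
    and "\<not> (\<exists>S\<subseteq>V. card S = Suc l \<and> (\<forall>u\<in>S. \<forall>v\<in>S. u \<noteq> v \<longrightarrow> E u v))"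
    and "\<And>u. \<not> E u u"
  shows "real l * real (card {(u, v) \<in> V \<times> V. E u v}) \<le> (real l - 1) * (real (card V))\<^sup>2"
  using assms
proof (induction l arbitrary: V rule: nat_induct_at_least)
  case base
  have *: "{(u, v) \<in> V \<times> V. E u v} = {}"
  proof (rule ccontr)
    assume "\<not> ?thesis"
    then obtain u v where uv: "u \<in> V" "v \<in> V" "E u v" by auto
    then have "u \<noteq> v" using base by auto
    then show False
      using base(3) uv base.prems(2) by (auto dest!: spec[of _ "{u, v}"])
  qed
  show ?case unfolding * by simp
next
  case (Suc l)
  define nb where "nb v = {u \<in> V. E v u}" for v
  have fin: "finite (nb v)" for v using Suc.prems(1) by (simp add: nb_def)
  show ?case
  proof (cases "V = {}")
    case False
    define \<Delta> where "\<Delta> = Max ((\<lambda>v. card (nb v)) ` V)"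
    have max: "card (nb u) \<le> \<Delta>" if "u \<in> V" for u
      using Suc.prems(1) that by (auto simp: \<Delta>_def)
    have "\<Delta> \<in> (\<lambda>v. card (nb v)) ` V"
      unfolding \<Delta>_def using Suc.prems(1) False by (intro Max_in) auto
    then obtain v where v: "v \<in> V" "card (nb v) = \<Delta>" by auto
    have sub: "nb v \<subseteq> V" by (auto simp: nb_def)
    have no: "\<not> (\<exists>S\<subseteq>nb v. card S = Suc l \<and> (\<forall>u\<in>S. \<forall>w\<in>S. u \<noteq> w \<longrightarrow> E u w))"
    proof
      assume "\<exists>S\<subseteq>nb v. card S = Suc l \<and> (\<forall>u\<in>S. \<forall>w\<in>S. u \<noteq> w \<longrightarrow> E u w)"
      then obtain S where S: "S \<subseteq> nb v" "card S = Suc l" "\<forall>u\<in>S. \<forall>w\<in>S. u \<noteq> w \<longrightarrow> E u w" by auto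
      have "v \<notin> S" using S(1) Suc.prems(4) by (auto simp: nb_def)
      then have "card (insert v S) = Suc (Suc l)"
        using S fin[of v] by (simp add: finite_subset)
      moreover have "insert v S \<subseteq> V" using S(1) sub v by auto
      moreover have "\<forall>u\<in>insert v S. \<forall>w\<in>insert v S. u \<noteq> w \<longrightarrow> E u w"
        using S Suc.prems(2) by (auto simp: nb_def)
      ultimately show False using Suc.prems(3) by blast
    qed
    have IH: "real l * real (card {(u, w) \<in> nb v \<times> nb v. E u w}) \<le> (real l - 1) * (real \<Delta>)\<^sup>2"
      using Suc.IH[OF fin Suc.prems(2) no Suc.prems(4)] v(2) by simp
    let ?O = "Sigma (V - nb v) nb"
    have "{(u, w) \<in> V \<times> V. E u w} \<subseteq> {(u, w) \<in> nb v \<times> nb v. E u w} \<union> (?O \<union> prod.swap ` ?O)"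
    proof
      fix e assume e: "e \<in> {(u, w) \<in> V \<times> V. E u w}"
      obtain u w where "e = (u, w)" by (cases e)
      then have uw: "e = (u, w)" "u \<in> V" "w \<in> V" "E u w" "E w u" using e Suc.prems(2) by auto
      consider "u \<in> nb v" "w \<in> nb v" | "u \<in> V - nb v" | "w \<in> V - nb v" using uw by blast
      then show "e \<in> {(u, w) \<in> nb v \<times> nb v. E u w} \<union> (?O \<union> prod.swap ` ?O)"
      proof cases
        case 2
        then have "e \<in> ?O" using uw by (auto simp: nb_def)
        then show ?thesis by blast
      next
        case 3
        then have "(w, u) \<in> ?O" using uw by (auto simp: nb_def)
        then have "e \<in> prod.swap ` ?O" using uw(1) by force
        then show ?thesis by blast
      qed (use uw in auto)
    qed
    moreover have finO: "finite ?O" using Suc.prems(1) fin by auto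
    ultimately have "card {(u, w) \<in> V \<times> V. E u w} \<le>
        card ({(u, w) \<in> nb v \<times> nb v. E u w} \<union> (?O \<union> prod.swap ` ?O))"
      using fin[of v] by (intro card_mono finite_UnI finite_imageI)
        (auto intro: finite_subset[of _ "nb v \<times> nb v"])
    also have "\<dots> \<le> card {(u, w) \<in> nb v \<times> nb v. E u w} + (card ?O + card (prod.swap ` ?O))"
      by (intro order_trans[OF card_Un_le] add_left_mono card_Un_le)
    also have "\<dots> \<le> card {(u, w) \<in> nb v \<times> nb v. E u w} + 2 * card ?O"
      using card_image_le[OF finO, of prod.swap] by simp
    finally have e: "card {(u, w) \<in> V \<times> V. E u w} \<le> card {(u, w) \<in> nb v \<times> nb v. E u w} + 2 * card ?O" .
    have "card ?O = (\<Sum>u\<in>V - nb v. card (nb u))"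
      using Suc.prems(1) fin by simp
    also have "\<dots> \<le> card (V - nb v) * \<Delta>"
      using sum_bounded_above[of "V - nb v" "\<lambda>u. card (nb u)" \<Delta>] max by simp
    finally have "real (card ?O) \<le> real (card (V - nb v)) * real \<Delta>"
      by (metis of_nat_le_iff of_nat_mult)
    moreover have "real (card (V - nb v)) = real (card V) - real \<Delta>"
      using card_Diff_subset[OF fin sub] v(2) card_mono[OF Suc.prems(1) sub] by (simp add: of_nat_diff)
    ultimately have O: "real (card ?O) \<le> (real (card V) - real \<Delta>) * real \<Delta>" by simp
    define e0 e1 T D L where "e0 = real (card {(u, w) \<in> nb v \<times> nb v. E u w})"
      and "e1 = real (card {(u, w) \<in> V \<times> V. E u w})" and "T = real (card V)" and "D = real \<Delta>"
      and "L = real l"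
    have L: "L \<ge> 1" using Suc.hyps by (simp add: L_def)
    have "e1 \<le> e0 + 2 * real (card ?O)"
      using e unfolding e0_def e1_def by linarith
    then have "e1 \<le> e0 + 2 * ((T - D) * D)"
      using O unfolding T_def D_def by linarith
    then have "L * e1 \<le> L * e0 + L * (2 * ((T - D) * D))"
      using L by (metis distrib_left mult_left_mono order_trans zero_le_one)
    also have "\<dots> \<le> (L - 1) * D\<^sup>2 + L * (2 * ((T - D) * D))"
      using IH unfolding e0_def L_def D_def by simp
    finally have "(L + 1) * (L * e1) \<le> (L + 1) * ((L - 1) * D\<^sup>2 + L * (2 * ((T - D) * D)))"
      using L by (intro mult_left_mono) auto
    \<comment> \<open>Completing the square in the degree \<open>D\<close>; the square is then
      dropped.\<close>
    also have "\<dots> = L\<^sup>2 * T\<^sup>2 - (L * T - (L + 1) * D)\<^sup>2"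
      by (simp add: power2_eq_square algebra_simps)
    also have "\<dots> \<le> L * (L * T\<^sup>2)"
      by (simp add: power2_eq_square)
    finally have "L * ((L + 1) * e1) \<le> L * (L * T\<^sup>2)" by (simp add: mult_ac)
    then have "(L + 1) * e1 \<le> L * T\<^sup>2"
      using L by (simp only: mult_le_cancel_left_pos)
    then show ?thesis
      by (simp add: L_def e1_def T_def algebra_simps)
  qed simp
qed

text \<open>The relation is symmetrised, which counts every pair twice; a clique found in it is
  listed in increasing order, and then its pairs lie in \<open>E\<close> itself.\<close>

lemma turan_increasing:
  fixes E :: "(nat \<times> nat) set"
  assumes l: "l \<ge> 1" and E: "E \<subseteq> {(i, j). i < j \<and> j < t}"
    and no: "\<not> (\<exists>s. (\<forall>a<Suc l. s a < t) \<and> (\<forall>a b. a < b \<and> b < Suc l \<longrightarrow> (s a, s b) \<in> E))"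
  shows "2 * real l * real (card E) \<le> (real l - 1) * (real t)\<^sup>2"
proof -
  define R where "R u v \<longleftrightarrow> (u, v) \<in> E \<or> (v, u) \<in> E" for u v
  have "real l * real (card {(u, v) \<in> {..<t} \<times> {..<t}. R u v}) \<le> (real l - 1) * (real (card {..<t}))\<^sup>2"
  proof (rule turan[OF l])
    show "\<not> (\<exists>S\<subseteq>{..<t}. card S = Suc l \<and> (\<forall>u\<in>S. \<forall>v\<in>S. u \<noteq> v \<longrightarrow> R u v))"
    proof
      assume "\<exists>S\<subseteq>{..<t}. card S = Suc l \<and> (\<forall>u\<in>S. \<forall>v\<in>S. u \<noteq> v \<longrightarrow> R u v)"
      then obtain S where S: "S \<subseteq> {..<t}" "card S = Suc l" "\<forall>u\<in>S. \<forall>v\<in>S. u \<noteq> v \<longrightarrow> R u v" by auto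
      define s where "s a = sorted_list_of_set S ! a" for a
      have fin: "finite S" using S(1) finite_subset by blast
      have len: "length (sorted_list_of_set S) = Suc l" using S(2) by simp
      have inS: "s a \<in> S" if "a < Suc l" for a
        using that len fin nth_mem[of a "sorted_list_of_set S"] by (simp add: s_def)
      have mono: "s a < s b" if "a < b" "b < Suc l" for a b
        using that len sorted_wrt_nth_less[OF strict_sorted_list_of_set, of a b S]
        by (simp add: s_def)
      have "(s a, s b) \<in> E" if "a < b" "b < Suc l" for a b
      proof -
        have "R (s a) (s b)" using S(3) inS mono[OF that] that by auto
        then show ?thesis using E mono[OF that] by (auto simp: R_def)
      qed
      then show False using no inS S(1) by blast
    qed
  qed (use E in \<open>auto simp: R_def\<close>)
  moreover have "card {(u, v) \<in> {..<t} \<times> {..<t}. R u v} = 2 * card E"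
  proof -
    have finE: "finite E" using E by (rule finite_subset) (rule finite_subset[of _ "{..<t} \<times> {..<t}"], auto)
    have "{(u, v) \<in> {..<t} \<times> {..<t}. R u v} = E \<union> prod.swap ` E"
      using E by (force simp: R_def)
    moreover have "card (E \<union> prod.swap ` E) = card E + card (prod.swap ` E)"
    proof (rule card_Un_disjoint)
      have "i < j" if "(i, j) \<in> E" for i j using E that by auto
      then show "E \<inter> prod.swap ` E = {}" by (auto, meson less_asym)
    qed (use finE in auto)
    moreover have "card (prod.swap ` E) = card E" by (simp add: card_image)
    ultimately show ?thesis by simp
  qed
  ultimately show ?thesis by simp
qed

section \<open>Embedding a pattern or finding a sparse pair\<close>

text \<open>The total weight can only drop, while the product of the sizes drops by at most the
  factor \<open>rho\<^sup>2\<close>.\<close>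

lemma den_shrink:
  assumes w: "\<And>a b. w a b \<ge> 0" and fin: "finite A" "finite B"
    and sub: "A' \<subseteq> A" "B' \<subseteq> B" and rho: "rho > 0"
    and big: "rho * real (card A) \<le> real (card A')" "rho * real (card B) \<le> real (card B')"
    and d: "den w A B \<le> \<delta>" and \<delta>: "\<delta> \<ge> 0"
  shows "den w A' B' \<le> \<delta> / rho\<^sup>2"
proof (cases "A' = {} \<or> B' = {}")
  case True
  then show ?thesis using \<delta> rho by (auto simp: den_def)
next
  case False
  have pos: "real (card A') > 0" "real (card B') > 0"
    using False fin sub by (auto simp: card_gt_0_iff intro: finite_subset)
  then have pos': "real (card A) > 0" "real (card B) > 0"
    using fin sub False by (auto simp: card_gt_0_iff)
  have "(\<Sum>a\<in>A'. \<Sum>b\<in>B'. w a b) \<le> (\<Sum>a\<in>A. \<Sum>b\<in>B. w a b)"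
  proof -
    have "(\<Sum>a\<in>A'. \<Sum>b\<in>B'. w a b) \<le> (\<Sum>a\<in>A'. \<Sum>b\<in>B. w a b)"
      using fin sub w by (intro sum_mono sum_mono2) auto
    also have "\<dots> \<le> (\<Sum>a\<in>A. \<Sum>b\<in>B. w a b)"
      using fin sub w by (intro sum_mono2) (auto intro: sum_nonneg)
    finally show ?thesis .
  qed
  also have "\<dots> \<le> \<delta> * (real (card A) * real (card B))"
    using d pos' by (simp add: den_def divide_le_eq)
  finally have 1: "rho\<^sup>2 * (\<Sum>a\<in>A'. \<Sum>b\<in>B'. w a b) \<le> rho\<^sup>2 * (\<delta> * (real (card A) * real (card B)))"
    by (intro mult_left_mono) auto
  have "(rho * real (card A)) * (rho * real (card B)) \<le> real (card A') * real (card B')"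
    using big rho by (intro mult_mono) auto
  then have "\<delta> * ((rho * real (card A)) * (rho * real (card B))) \<le> \<delta> * (real (card A') * real (card B'))"
    using \<delta> by (rule mult_left_mono)
  with 1 have "rho\<^sup>2 * (\<Sum>a\<in>A'. \<Sum>b\<in>B'. w a b) \<le> \<delta> * (real (card A') * real (card B'))"
    by (simp add: power2_eq_square mult_ac)
  then show ?thesis
    using pos rho by (simp add: den_def field_simps)
qed

lemma den_swap: "den w A B = den (\<lambda>a b. w b a) B A"
  by (simp add: den_def sum.swap[of _ A B] mult.commute)

text \<open>Greedy embedding. If some \<open>x \<in> C v\<close> has an
  \<open>eps\<close>-proportion of compatible partners in every \<open>C u\<close>, it is chosen and
  the candidate sets shrink to these partners. Otherwise every \<open>x\<close> fails for some
  \<open>u\<close>, so many fail for the same \<open>u\<close> and form a sparse pair with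
  \<open>C u\<close>. Note that \<open>rho\<close> is chosen before \<open>K\<close> and
  \<open>C\<close>.\<close>

lemma embed_or_sparse:
  fixes X :: "'v set" and eps :: real
  assumes "finite X" "0 < eps" "eps \<le> 1"
  shows "\<exists>rho>0. rho \<le> 1 \<and> (\<forall>(K :: 'v \<Rightarrow> 'v \<Rightarrow> 'a \<Rightarrow> 'a \<Rightarrow> bool) C.
     (\<forall>u v x y. K u v x y \<longrightarrow> K v u y x) \<longrightarrow> (\<forall>v\<in>X. finite (C v) \<and> C v \<noteq> {}) \<longrightarrow>
     (\<exists>f. (\<forall>v\<in>X. f v \<in> C v) \<and> (\<forall>u\<in>X. \<forall>v\<in>X. u \<noteq> v \<longrightarrow> K u v (f u) (f v))) \<or>
     (\<exists>u\<in>X. \<exists>v\<in>X. u \<noteq> v \<and> (\<exists>A\<subseteq>C u. \<exists>B\<subseteq>C v.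
        rho * real (card (C u)) \<le> real (card A) \<and> rho * real (card (C v)) \<le> real (card B) \<and>
        den (\<lambda>a b. of_bool (K u v a b)) A B \<le> eps)))"
  using assms(1)
proof (induction X)
  case empty
  then show ?case by (intro exI[of _ 1]) auto
next
  case (insert v X)
  obtain rho where rho: "rho > 0" "rho \<le> 1" and IH: "\<And>(K :: 'v \<Rightarrow> 'v \<Rightarrow> 'a \<Rightarrow> 'a \<Rightarrow> bool) C.
     (\<forall>u v x y. K u v x y \<longrightarrow> K v u y x) \<Longrightarrow> (\<forall>v\<in>X. finite (C v) \<and> C v \<noteq> {}) \<Longrightarrow>
     (\<exists>f. (\<forall>v\<in>X. f v \<in> C v) \<and> (\<forall>u\<in>X. \<forall>v\<in>X. u \<noteq> v \<longrightarrow> K u v (f u) (f v))) \<or>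
     (\<exists>u\<in>X. \<exists>v\<in>X. u \<noteq> v \<and> (\<exists>A\<subseteq>C u. \<exists>B\<subseteq>C v.
        rho * real (card (C u)) \<le> real (card A) \<and> rho * real (card (C v)) \<le> real (card B) \<and>
        den (\<lambda>a b. of_bool (K u v a b)) A B \<le> eps))"
    using insert.IH by blast
  \<comment> \<open>The first bound pays for one more restriction of the candidate sets, the second
    for the pigeonhole over \<open>X\<close>; \<open>Suc\<close> makes that argument strict and
    avoids a zero denominator.\<close>
  define rho' where "rho' = min (eps * rho) (1 / real (Suc (card X)))"
  have rho': "rho' > 0" "rho' \<le> 1" "rho' \<le> eps * rho" "rho' \<le> 1 / real (Suc (card X))"
    using assms rho by (auto simp: rho'_def min_le_iff_disj)
  show ?case
  proof (intro exI[of _ rho'] conjI rho' allI impI)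
    fix K :: "'v \<Rightarrow> 'v \<Rightarrow> 'a \<Rightarrow> 'a \<Rightarrow> bool" and C :: "'v \<Rightarrow> 'a set"
    assume sym: "\<forall>u v x y. K u v x y \<longrightarrow> K v u y x"
      and C: "\<forall>v\<in>insert v X. finite (C v) \<and> C v \<noteq> {}"
    let ?goal = "(\<exists>f. (\<forall>v\<in>insert v X. f v \<in> C v) \<and>
       (\<forall>u\<in>insert v X. \<forall>w\<in>insert v X. u \<noteq> w \<longrightarrow> K u w (f u) (f w))) \<or>
     (\<exists>u\<in>insert v X. \<exists>w\<in>insert v X. u \<noteq> w \<and> (\<exists>A\<subseteq>C u. \<exists>B\<subseteq>C w.
        rho' * real (card (C u)) \<le> real (card A) \<and> rho' * real (card (C w)) \<le> real (card B) \<and>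
        den (\<lambda>a b. of_bool (K u w a b)) A B \<le> eps))"
    define N where "N x u = {y \<in> C u. K v u x y}" for x u
    show ?goal
    proof (cases "\<exists>x\<in>C v. \<forall>u\<in>X. eps * real (card (C u)) \<le> real (card (N x u))")
      case True
      then obtain x where x: "x \<in> C v" "\<And>u. u \<in> X \<Longrightarrow> eps * real (card (C u)) \<le> real (card (N x u))"
        by auto
      have "\<forall>u\<in>X. finite (N x u) \<and> N x u \<noteq> {}"
      proof
        fix u assume u: "u \<in> X"
        then have "card (C u) > 0" using C by (auto simp: card_gt_0_iff)
        then have "eps * real (card (C u)) > 0" using assms(2) by simp
        then have "card (N x u) > 0" using x(2)[OF u] by linarith
        then show "finite (N x u) \<and> N x u \<noteq> {}" by (simp add: card_gt_0_iff)
      qed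
      from IH[OF sym this] show ?goal
      proof
        assume "\<exists>f. (\<forall>u\<in>X. f u \<in> N x u) \<and> (\<forall>u\<in>X. \<forall>w\<in>X. u \<noteq> w \<longrightarrow> K u w (f u) (f w))"
        then obtain f where f: "\<forall>u\<in>X. f u \<in> N x u" "\<forall>u\<in>X. \<forall>w\<in>X. u \<noteq> w \<longrightarrow> K u w (f u) (f w)"
          by auto
        have "\<forall>u\<in>insert v X. (f(v := x)) u \<in> C u" using f(1) x(1) by (auto simp: N_def)
        moreover have "\<forall>u\<in>insert v X. \<forall>w\<in>insert v X. u \<noteq> w \<longrightarrow> K u w ((f(v := x)) u) ((f(v := x)) w)"
          using f sym by (auto simp: N_def)
        ultimately show ?goal by blast
      next
        assume "\<exists>u\<in>X. \<exists>w\<in>X. u \<noteq> w \<and> (\<exists>A\<subseteq>N x u. \<exists>B\<subseteq>N x w.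
          rho * real (card (N x u)) \<le> real (card A) \<and> rho * real (card (N x w)) \<le> real (card B) \<and>
          den (\<lambda>a b. of_bool (K u w a b)) A B \<le> eps)"
        then obtain u w A B where uw: "u \<in> X" "w \<in> X" "u \<noteq> w" "A \<subseteq> N x u" "B \<subseteq> N x w"
          "rho * real (card (N x u)) \<le> real (card A)" "rho * real (card (N x w)) \<le> real (card B)"
          "den (\<lambda>a b. of_bool (K u w a b)) A B \<le> eps" by auto
        have "rho' * real (card (C z)) \<le> rho * real (card (N x z))" if "z \<in> X" for z
        proof -
          have "rho' * real (card (C z)) \<le> (eps * rho) * real (card (C z))"
            using rho'(3) by (rule mult_right_mono) simp
          also have "\<dots> = rho * (eps * real (card (C z)))" by simp
          also have "\<dots> \<le> rho * real (card (N x z))"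
            using x(2)[OF that] rho by (intro mult_left_mono) auto
          finally show ?thesis .
        qed
        then have "rho' * real (card (C u)) \<le> real (card A)" "rho' * real (card (C w)) \<le> real (card B)"
          using uw by (meson order_trans)+
        moreover have "A \<subseteq> C u" "B \<subseteq> C w" using uw(4,5) by (auto simp: N_def)
        ultimately show ?goal using uw(1,2,3,8) by blast
      qed
    next
      case False
      define bad where "bad u = {x \<in> C v. real (card (N x u)) < eps * real (card (C u))}" for u
      have cov: "C v \<subseteq> (\<Union>u\<in>X. bad u)"
        using False by (force simp: bad_def not_le)
      have finbad: "finite (bad u)" for u using C by (auto simp: bad_def)
      have "\<exists>u\<in>X. rho' * real (card (C v)) \<le> real (card (bad u))"
      proof (rule ccontr)
        assume "\<not> ?thesis"
        then have less: "real (card (bad u)) \<le> rho' * real (card (C v))" if "u \<in> X" for u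
          using that by (auto simp: not_le less_imp_le)
        have "real (card (C v)) \<le> real (card (\<Union>u\<in>X. bad u))"
          using cov finbad insert.hyps by (intro of_nat_mono card_mono) auto
        also have "\<dots> \<le> real (\<Sum>u\<in>X. card (bad u))"
          using card_UN_le[OF insert.hyps(1), of bad] by (rule of_nat_mono)
        also have "\<dots> \<le> real (card X) * (rho' * real (card (C v)))"
          using sum_bounded_above[of X "\<lambda>u. real (card (bad u))", OF less] by simp
        also have "\<dots> \<le> real (card X) * (1 / real (Suc (card X)) * real (card (C v)))"
          using rho'(4) by (intro mult_left_mono mult_right_mono) auto
        also have "\<dots> = real (card X) / real (Suc (card X)) * real (card (C v))" by simp
        also have "\<dots> < 1 * real (card (C v))"
          using C by (intro mult_strict_right_mono) (auto simp: card_gt_0_iff)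
        finally show False by simp
      qed
      then obtain u where u: "u \<in> X" "rho' * real (card (C v)) \<le> real (card (bad u))" by auto
      have "(\<Sum>a\<in>bad u. \<Sum>b\<in>C u. of_bool (K v u a b)) \<le> (\<Sum>a\<in>bad u. eps * real (card (C u)))"
      proof (intro sum_mono)
        fix a assume "a \<in> bad u"
        then have "real (card (N a u)) \<le> eps * real (card (C u))" by (simp add: bad_def)
        moreover have "(\<Sum>b\<in>C u. of_bool (K v u a b)) = real (card (N a u))"
          using C u(1) by (simp add: N_def Int_def flip: sum.inter_filter)
        ultimately show "(\<Sum>b\<in>C u. of_bool (K v u a b)) \<le> eps * real (card (C u))" by simp
      qed
      then have "den (\<lambda>a b. of_bool (K v u a b)) (bad u) (C u) \<le> eps"
        using assms(2) by (cases "real (card (bad u)) * real (card (C u)) = 0")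
          (auto simp: den_def divide_le_eq mult_ac zero_less_mult_iff)
      moreover have "bad u \<subseteq> C v" by (auto simp: bad_def)
      moreover have "rho' * real (card (C u)) \<le> real (card (C u))"
        using rho' by (simp add: mult_left_le_one_le)
      moreover have "v \<noteq> u" using u insert.hyps by auto
      ultimately show ?goal using u by blast
    qed
  qed
qed

lemma equal_pieces:
  assumes "finite Y"
  shows "\<exists>Q. (\<forall>x<n. Q x \<subseteq> Y \<and> card (Q x) = card Y div n) \<and> disjoint_family_on Q {..<n}"
proof -
  define q where "q = card Y div n"
  obtain h where h: "bij_betw h {0..<card Y} Y"
    using ex_bij_betw_nat_finite[OF assms] by blast
  have sub: "{x * q..<x * q + q} \<subseteq> {0..<card Y}" if "x < n" for x
  proof -
    have "x * q + q = Suc x * q" by simp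
    also have "\<dots> \<le> n * q" using that by (intro mult_right_mono) auto
    also have "\<dots> \<le> card Y" by (simp add: q_def)
    finally show ?thesis by auto
  qed
  define Q where "Q x = h ` {x * q..<x * q + q}" for x
  have inj: "inj_on h {0..<card Y}" using h by (simp add: bij_betw_def)
  have "Q x \<subseteq> Y" "card (Q x) = card Y div n" if "x < n" for x
    using sub[OF that] h inj_on_subset[OF inj sub[OF that]]
    by (auto simp: Q_def bij_betw_def card_image q_def)
  moreover have "disjoint_family_on Q {..<n}"
    unfolding disjoint_family_on_def
  proof (intro ballI impI)
    fix x y assume xy: "x \<in> {..<n}" "y \<in> {..<n}" "x \<noteq> y"
    have "{x * q..<x * q + q} \<inter> {y * q..<y * q + q} = {}"
    proof (rule ccontr)
      assume "\<not> ?thesis"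
      then obtain z where "z \<in> {x * q..<x * q + q} \<inter> {y * q..<y * q + q}" by blast
      then have z: "x * q \<le> z" "z < x * q + q" "y * q \<le> z" "z < y * q + q" by auto
      then have "z div q = x" "z div q = y"
        by (auto intro!: div_nat_eqI simp: mult_ac)
      then show False using xy(3) by simp
    qed
    moreover have "Q x \<inter> Q y = h ` ({x * q..<x * q + q} \<inter> {y * q..<y * q + q})"
      unfolding Q_def using sub xy by (intro inj_on_image_Int[OF inj, symmetric]) auto
    ultimately show "Q x \<inter> Q y = {}" by simp
  qed
  ultimately show ?thesis by blast
qed

section \<open>Multipartite patterns and simultaneous shrinking of the blocks\<close>

definition realizes ::
  "('a \<Rightarrow> 'a \<Rightarrow> color) \<Rightarrow> 'a set \<Rightarrow> nat \<Rightarrow> nat \<Rightarrow> (nat \<times> nat \<Rightarrow> nat \<times> nat \<Rightarrow> color) \<Rightarrow> (nat \<times> nat \<Rightarrow> 'a) \<Rightarrow> bool"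
where
  "realizes g V L n c f \<longleftrightarrow> inj_on f ({..<L} \<times> {..<n}) \<and> f ` ({..<L} \<times> {..<n}) \<subseteq> V \<and>
     (\<forall>i j x y. i < j \<and> j < L \<and> x < n \<and> y < n \<longrightarrow> g (f (i, x)) (f (j, y)) = c (i, x) (j, y))"

definition has_clique :: "nat \<Rightarrow> nat \<Rightarrow> (nat \<times> nat) set \<Rightarrow> bool" where
  "has_clique L t E \<longleftrightarrow> (\<exists>s. (\<forall>a<L. s a < t) \<and> (\<forall>a b. a < b \<and> b < L \<longrightarrow> (s a, s b) \<in> E))"

definition sparse_pair :: "real \<Rightarrow> ('a \<Rightarrow> 'a \<Rightarrow> color) \<Rightarrow> color set \<Rightarrow> 'a set \<Rightarrow> 'a set \<Rightarrow> bool" where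
  "sparse_pair eps g P A B \<longleftrightarrow> (\<exists>q\<in>P. den (\<lambda>a b. of_bool (g a b = q)) A B \<le> eps)"

text \<open>\<open>E\<close> holds the pairs not yet known to be sparse, and \<open>r\<close> bounds
  its size so that an induction is possible. The colouring, the pattern and the sets are quantified
  inside, so \<open>rho\<close> depends on \<open>eps\<close>, \<open>L\<close>, \<open>n\<close>,
  \<open>t\<close> and \<open>r\<close> only.\<close>

definition shrink_factor :: "real \<Rightarrow> nat \<Rightarrow> nat \<Rightarrow> nat \<Rightarrow> nat \<Rightarrow> real \<Rightarrow> bool" where
  "shrink_factor eps L n t r rho \<longleftrightarrow> 0 < rho \<and> rho \<le> 1 \<and> (\<forall>(g :: nat \<Rightarrow> nat \<Rightarrow> color) V P c Y E.
    (\<forall>u v. c u v \<in> P) \<longrightarrow> (\<nexists>f. realizes g V L n c f) \<longrightarrow>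
    (\<forall>i<t. finite (Y i) \<and> Y i \<subseteq> V \<and> real n \<le> rho * real (card (Y i))) \<longrightarrow>
    disjoint_family_on Y {..<t} \<longrightarrow> E \<subseteq> {(i, j). i < j \<and> j < t} \<longrightarrow> card E \<le> r \<longrightarrow>
    (\<exists>Z E'. (\<forall>i<t. Z i \<subseteq> Y i \<and> rho * real (card (Y i)) \<le> real (card (Z i))) \<and> E' \<subseteq> E \<and>
      \<not> has_clique L t E' \<and> (\<forall>(i, j) \<in> E - E'. sparse_pair eps g P (Z i) (Z j))))"

lemma shrink_factorD:
  fixes g :: "nat \<Rightarrow> nat \<Rightarrow> color"
  assumes "shrink_factor eps L n t r rho" "\<forall>u v. c u v \<in> P" "\<nexists>f. realizes g V L n c f"
    "\<forall>i<t. finite (Y i) \<and> Y i \<subseteq> V \<and> real n \<le> rho * real (card (Y i))"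
    "disjoint_family_on Y {..<t}" "E \<subseteq> {(i, j). i < j \<and> j < t}" "card E \<le> r"
  shows "\<exists>Z E'. (\<forall>i<t. Z i \<subseteq> Y i \<and> rho * real (card (Y i)) \<le> real (card (Z i))) \<and> E' \<subseteq> E \<and>
      \<not> has_clique L t E' \<and> (\<forall>(i, j) \<in> E - E'. sparse_pair eps g P (Z i) (Z j))"
  using assms(1)[unfolded shrink_factor_def, THEN conjunct2, THEN conjunct2, THEN spec, THEN spec,
    THEN spec, THEN spec, THEN spec, THEN spec, THEN mp, OF assms(2), THEN mp, OF assms(3), THEN mp,
    OF assms(4), THEN mp, OF assms(5), THEN mp, OF assms(6), THEN mp, OF assms(7)] .

lemma shrink_factor_bounds: "shrink_factor eps L n t r rho \<Longrightarrow> 0 < rho \<and> rho \<le> 1"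
  unfolding shrink_factor_def by (elim conjE) (intro conjI)

text \<open>While \<open>E\<close> contains a clique on \<open>L\<close> blocks, the failure to
  embed the pattern into them yields a sparse pair of subsets; the two blocks shrink to these, the
  pair leaves \<open>E\<close>, and the induction hypothesis treats the rest.
  \<open>L \<ge> 2\<close> makes the empty \<open>E\<close> free of cliques, and
  \<open>eps < 1\<close> excludes a sparse pair inside one block.\<close>

lemma shrink:
  fixes eps :: real and L n t r :: nat
  assumes eps: "0 < eps" "eps < 1" and L: "L \<ge> 2" and n: "n \<ge> 1"
  shows "\<exists>rho. shrink_factor eps L n t r rho"
proof (induction r)
  case 0
  have "shrink_factor eps L n t 0 1"
    unfolding shrink_factor_def
  proof (intro conjI allI impI)
    fix g :: "nat \<Rightarrow> nat \<Rightarrow> color" and P and Y :: "nat \<Rightarrow> nat set" and E :: "(nat \<times> nat) set"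
    assume E: "E \<subseteq> {(i, j). i < j \<and> j < t}" "card E \<le> 0"
    then have E0: "E = {}" using finite_subset[OF E(1) finite_index_pairs] by simp
    have no: "\<not> has_clique L t {}"
    proof
      assume "has_clique L t {}"
      then obtain s :: "nat \<Rightarrow> nat" where s: "\<And>a b. a < b \<and> b < L \<Longrightarrow> (s a, s b) \<in> ({} :: (nat \<times> nat) set)"
        unfolding has_clique_def by blast
      show False using s[of 0 1] L by simp
    qed
    show "\<exists>Z E'. (\<forall>i<t. Z i \<subseteq> Y i \<and> 1 * real (card (Y i)) \<le> real (card (Z i))) \<and> E' \<subseteq> E \<and>
      \<not> has_clique L t E' \<and> (\<forall>(i, j) \<in> E - E'. sparse_pair eps g P (Z i) (Z j))"
      using no by (intro exI[of _ Y] exI[of _ "{}"]) (simp add: E0)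
  qed simp_all
  then show ?case by blast
next
  case (Suc r)
  then obtain rho_r where rho_r: "shrink_factor eps L n t r rho_r" "rho_r > 0" "rho_r \<le> 1"
    using shrink_factor_bounds by blast
  \<comment> \<open>The first pair is made so sparse that shrinking its sides by \<open>rho_r\<close> later leaves it \<open>eps\<close>-sparse.\<close>
  define \<delta> where "\<delta> = eps * rho_r\<^sup>2"
  have \<delta>: "0 < \<delta>" "\<delta> < 1"
  proof -
    show "0 < \<delta>" using eps rho_r(2) by (simp add: \<delta>_def)
    have "rho_r\<^sup>2 \<le> 1" using rho_r(2,3) by (simp add: power_le_one)
    then have "\<delta> \<le> eps" using eps by (simp add: \<delta>_def mult_left_le)
    then show "\<delta> < 1" using eps by simp
  qed
  obtain rho_e where rho_e: "rho_e > 0" "rho_e \<le> 1" and embed: "\<And>(K :: nat \<times> nat \<Rightarrow> nat \<times> nat \<Rightarrow> nat \<Rightarrow> nat \<Rightarrow> bool) C.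
     (\<forall>u v x y. K u v x y \<longrightarrow> K v u y x) \<Longrightarrow> (\<forall>v\<in>{..<L} \<times> {..<n}. finite (C v) \<and> C v \<noteq> {}) \<Longrightarrow>
     (\<exists>f. (\<forall>v\<in>{..<L} \<times> {..<n}. f v \<in> C v) \<and> (\<forall>u\<in>{..<L} \<times> {..<n}. \<forall>v\<in>{..<L} \<times> {..<n}. u \<noteq> v \<longrightarrow> K u v (f u) (f v))) \<or>
     (\<exists>u\<in>{..<L} \<times> {..<n}. \<exists>v\<in>{..<L} \<times> {..<n}. u \<noteq> v \<and> (\<exists>A\<subseteq>C u. \<exists>B\<subseteq>C v.
        rho_e * real (card (C u)) \<le> real (card A) \<and> rho_e * real (card (C v)) \<le> real (card B) \<and>
        den (\<lambda>a b. of_bool (K u v a b)) A B \<le> \<delta>))"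
    using embed_or_sparse[of "{..<L} \<times> {..<n}" \<delta>, where 'a = nat] \<delta> by auto
  \<comment> \<open>A piece of a block of size at least \<open>n\<close> has size at least
    \<open>card (Y i) / (2 * n)\<close>, and the sparse pair keeps the proportion
    \<open>rho_e\<close> of it.\<close>
  define rho_h where "rho_h = rho_e / (2 * real n)"
  have rho_h: "rho_h > 0" "rho_h \<le> 1" using rho_e n by (auto simp: rho_h_def divide_le_eq)
  define rho where "rho = rho_r * rho_h"
  have rho: "rho > 0" "rho \<le> 1" "rho \<le> rho_r" using rho_r(2,3) rho_h by (auto simp: rho_def mult_le_one mult_left_le)
  have "shrink_factor eps L n t (Suc r) rho"
    unfolding shrink_factor_def
  proof (intro conjI rho(1,2) allI impI)
    fix g :: "nat \<Rightarrow> nat \<Rightarrow> color" and V P c and Y :: "nat \<Rightarrow> nat set" and E :: "(nat \<times> nat) set"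
    assume c: "\<forall>u v. c u v \<in> P" and free: "\<nexists>f. realizes g V L n c f"
      and Y: "\<forall>i<t. finite (Y i) \<and> Y i \<subseteq> V \<and> real n \<le> rho * real (card (Y i))"
      and disj: "disjoint_family_on Y {..<t}" and E: "E \<subseteq> {(i, j). i < j \<and> j < t}" "card E \<le> Suc r"
    let ?goal = "\<exists>Z E'. (\<forall>i<t. Z i \<subseteq> Y i \<and> rho * real (card (Y i)) \<le> real (card (Z i))) \<and> E' \<subseteq> E \<and>
      \<not> has_clique L t E' \<and> (\<forall>(i, j) \<in> E - E'. sparse_pair eps g P (Z i) (Z j))"
    show ?goal
    proof (cases "has_clique L t E")
      case False
      have "\<forall>i<t. Y i \<subseteq> Y i \<and> rho * real (card (Y i)) \<le> real (card (Y i))"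
        using rho by (simp add: mult_left_le_one_le)
      then show ?thesis using False by (intro exI[of _ Y] exI[of _ E]) simp
    next
      case True
      then obtain s where s: "\<And>a. a < L \<Longrightarrow> s a < t" "\<And>a b. a < b \<Longrightarrow> b < L \<Longrightarrow> (s a, s b) \<in> E"
        unfolding has_clique_def by auto
      have s_mono: "s a < s b" if "a < b" "b < L" for a b using s(2)[OF that] E(1) by auto
      \<comment> \<open>Disjoint pieces of the blocks serve as candidate sets for the
        \<open>L * n\<close> pattern vertices, which makes the embedding injective.\<close>
      define Q where "Q i = (SOME Q. (\<forall>x<n. Q x \<subseteq> Y i \<and> card (Q x) = card (Y i) div n) \<and>
        disjoint_family_on Q {..<n})" for i
      have Q0: "(\<forall>x<n. Q i x \<subseteq> Y i \<and> card (Q i x) = card (Y i) div n) \<and> disjoint_family_on (Q i) {..<n}"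
        if "i < t" for i
        unfolding Q_def by (rule someI_ex[OF equal_pieces]) (use Y that in simp)
      then have Q: "\<And>i x. i < t \<Longrightarrow> x < n \<Longrightarrow> Q i x \<subseteq> Y i \<and> card (Q i x) = card (Y i) div n"
        "\<And>i. i < t \<Longrightarrow> disjoint_family_on (Q i) {..<n}" by simp_all
      have Ybig: "n \<le> card (Y i)" if "i < t" for i
      proof -
        have "real n \<le> rho * real (card (Y i))" using Y that by blast
        also have "\<dots> \<le> real (card (Y i))" using rho by (simp add: mult_left_le_one_le)
        finally show ?thesis by simp
      qed
      have Qbig: "real (card (Y i)) \<le> 2 * real n * real (card (Q i x))" if "i < t" "x < n" for i x
      proof -
        define q where "q = card (Y i) div n"
        have "q \<ge> 1" using Ybig[OF that(1)] n by (simp add: q_def Suc_le_eq div_greater_zero_iff)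
        have "card (Y i) mod n < n" using n by simp
        moreover have "card (Y i) = n * q + card (Y i) mod n" by (simp add: q_def)
        ultimately have "card (Y i) \<le> n * q + n" by linarith
        also have "\<dots> \<le> n * q + n * q" using \<open>q \<ge> 1\<close> by simp
        finally have "real (card (Y i)) \<le> real (2 * n * q)" by (intro of_nat_mono) simp
        then show ?thesis using Q(1)[OF that] by (simp add: q_def)
      qed
      define C where "C = (\<lambda>(a, x). Q (s a) x)"
      \<comment> \<open>Two vertices of the same part are always compatible, so a sparse pair
        necessarily comes from different parts.\<close>
      define K where "K u v x y \<longleftrightarrow> (fst u < fst v \<longrightarrow> g x y = c u v) \<and> (fst v < fst u \<longrightarrow> g y x = c v u)"
        for u v :: "nat \<times> nat" and x y
      have finC: "\<forall>v\<in>{..<L} \<times> {..<n}. finite (C v) \<and> C v \<noteq> {}"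
      proof safe
        fix a x assume ax: "a < L" "x < n"
        have sa: "s a < t" using s ax by auto
        show "finite (C (a, x))" using Q(1)[OF sa ax(2)] Y sa by (auto simp: C_def intro: finite_subset)
        have "card (C (a, x)) > 0"
          using Q(1)[OF sa ax(2)] Ybig[OF sa] n by (simp add: C_def div_greater_zero_iff)
        then show "C (a, x) = {} \<Longrightarrow> False" by simp
      qed
      have symK: "\<forall>u v x y. K u v x y \<longrightarrow> K v u y x" by (auto simp: K_def)
      from embed[OF symK finC] show ?goal
      proof (elim disjE exE bexE conjE, goal_cases)
        case (1 f)
        have Cdisj: "C u \<inter> C v = {}" if "u \<in> {..<L} \<times> {..<n}" "v \<in> {..<L} \<times> {..<n}" "u \<noteq> v" for u v
        proof -
          obtain a x b y where uv: "u = (a, x)" "v = (b, y)" by (cases u, cases v) auto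
          have lt: "a < L" "b < L" "x < n" "y < n" using that uv by auto
          show ?thesis
          proof (cases "a = b")
            case True
            then have "x \<noteq> y" using that uv by auto
            then show ?thesis
              using Q(2)[OF s(1)[OF lt(1)]] lt True by (auto simp: C_def uv disjoint_family_on_def)
          next
            case False
            then have "s a \<noteq> s b"
              using s_mono[of a b] s_mono[of b a] lt by (cases a b rule: linorder_cases) auto
            then have "Y (s a) \<inter> Y (s b) = {}"
              using disj s(1) lt by (auto simp: disjoint_family_on_def)
            then show ?thesis using Q(1)[OF s(1)[OF lt(1)] lt(3)] Q(1)[OF s(1)[OF lt(2)] lt(4)]
              by (auto simp: C_def uv)
          qed
        qed
        have "realizes g V L n c f"
          unfolding realizes_def
        proof (intro conjI allI impI)
          show "inj_on f ({..<L} \<times> {..<n})"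
            using 1(1) Cdisj by (intro inj_onI) (metis IntI empty_iff)
          show "f ` ({..<L} \<times> {..<n}) \<subseteq> V"
          proof (intro image_subsetI, clarify)
            fix i x assume ix: "i < L" "x < n"
            then have "f (i, x) \<in> C (i, x)" using 1(1) by simp
            also have "C (i, x) \<subseteq> Y (s i)" using Q(1)[OF s(1)[OF ix(1)] ix(2)] by (simp add: C_def)
            also have "\<dots> \<subseteq> V" using Y s(1)[OF ix(1)] by simp
            finally show "f (i, x) \<in> V" .
          qed
          fix i j x y assume "i < j \<and> j < L \<and> x < n \<and> y < n"
          then show "g (f (i, x)) (f (j, y)) = c (i, x) (j, y)"
            using 1(2) by (auto simp: K_def)
        qed
        then show ?thesis using free by blast
      next
        case (2 u v A B)
        have "\<exists>u v A B. fst u < fst v \<and> u \<in> {..<L} \<times> {..<n} \<and> v \<in> {..<L} \<times> {..<n} \<and> A \<subseteq> C u \<and> B \<subseteq> C v \<and>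
          rho_e * real (card (C u)) \<le> real (card A) \<and> rho_e * real (card (C v)) \<le> real (card B) \<and>
          den (\<lambda>a b. of_bool (g a b = c u v)) A B \<le> \<delta>"
        proof (cases "fst u" "fst v" rule: linorder_cases)
          case less
          then have "(\<lambda>a b. of_bool (K u v a b)) = (\<lambda>a b. of_bool (g a b = c u v) :: real)"
            by (auto simp: K_def fun_eq_iff)
          then show ?thesis using 2 less by metis
        next
          case greater
          then have "(\<lambda>a b. of_bool (K u v a b)) = (\<lambda>a b. of_bool (g b a = c v u) :: real)"
            by (auto simp: K_def fun_eq_iff)
          then have "den (\<lambda>a b. of_bool (g a b = c v u)) B A \<le> \<delta>"
            using 2(8) den_swap[of "\<lambda>a b. of_bool (g a b = c v u)" B A] by simp
          then show ?thesis using 2 greater by blast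
        next
          case equal
          then have "K u v a b" for a b by (simp add: K_def)
          moreover have "card A > 0" "card B > 0"
          proof -
            have "card (C u) > 0" "card (C v) > 0"
              using \<open>\<forall>v\<in>{..<L} \<times> {..<n}. finite (C v) \<and> C v \<noteq> {}\<close> 2(1,2) by (auto simp: card_gt_0_iff)
            then have "rho_e * real (card (C u)) > 0" "rho_e * real (card (C v)) > 0" using rho_e by auto
            then show "card A > 0" "card B > 0" using 2(6,7) by linarith+
          qed
          ultimately have "den (\<lambda>a b. of_bool (K u v a b)) A B = 1" by (simp add: den_def)
          then show ?thesis using 2(8) \<delta> by simp
        qed
        then obtain u v A B where *: "fst u < fst v" "u \<in> {..<L} \<times> {..<n}" "v \<in> {..<L} \<times> {..<n}"
          "A \<subseteq> C u" "B \<subseteq> C v"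
          "rho_e * real (card (C u)) \<le> real (card A)" "rho_e * real (card (C v)) \<le> real (card B)"
          "den (\<lambda>a b. of_bool (g a b = c u v)) A B \<le> \<delta>" by blast
        obtain a x b y where uv: "u = (a, x)" "v = (b, y)" by (cases u, cases v) auto
        have ab: "a < b" "a < L" "b < L" "x < n" "y < n" using * uv by auto
        have st: "s a < t" "s b < t" "s a < s b" using s(1) s_mono ab by auto
        define Y1 where "Y1 = Y(s a := A, s b := B)"
        have AB: "A \<subseteq> Y (s a)" "B \<subseteq> Y (s b)"
          using *(4,5) Q(1)[OF st(1) ab(4)] Q(1)[OF st(2) ab(5)] by (auto simp: C_def uv)
        have half: "rho_h * real (card (Y i)) \<le> rho_e * real (card (Q i x))" if "i < t" "x < n" for i x
          using mult_left_mono[OF Qbig[OF that], of "rho_e / (2 * real n)"] rho_e n by (simp add: rho_h_def)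
        have Y1: "Y1 i \<subseteq> Y i \<and> rho_h * real (card (Y i)) \<le> real (card (Y1 i))" if "i < t" for i
        proof -
          have "rho_h * real (card (Y (s a))) \<le> real (card A)" "rho_h * real (card (Y (s b))) \<le> real (card B)"
            using half[OF st(1) ab(4)] half[OF st(2) ab(5)] *(6,7) by (auto simp: C_def uv)
          moreover have "rho_h * real (card (Y i)) \<le> real (card (Y i))"
            using rho_h by (simp add: mult_left_le_one_le)
          ultimately show ?thesis using AB st by (auto simp: Y1_def)
        qed
        have finY1: "finite (Y1 i)" if "i < t" for i using Y1 Y that finite_subset by blast
        have rr: "rho * real (card (Y i)) \<le> rho_r * real (card (Y1 i))" if "i < t" for i
          using mult_left_mono[OF conjunct2[OF Y1[OF that]], of rho_r] rho_r(2,3) by (simp add: rho_def mult_ac)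
        have "\<exists>Z E'. (\<forall>i<t. Z i \<subseteq> Y1 i \<and> rho_r * real (card (Y1 i)) \<le> real (card (Z i))) \<and>
           E' \<subseteq> E - {(s a, s b)} \<and>
          \<not> has_clique L t E' \<and>
          (\<forall>(i, j) \<in> (E - {(s a, s b)}) - E'. sparse_pair eps g P (Z i) (Z j))"
        proof (rule shrink_factorD[OF rho_r(1) c free])
          show "\<forall>i<t. finite (Y1 i) \<and> Y1 i \<subseteq> V \<and> real n \<le> rho_r * real (card (Y1 i))"
          proof (intro allI impI conjI)
            fix i assume i: "i < t"
            show "finite (Y1 i)" by (rule finY1[OF i])
            show "Y1 i \<subseteq> V" using Y1[OF i] Y i by blast
            have "real n \<le> rho * real (card (Y i))" using Y i by blast
            then show "real n \<le> rho_r * real (card (Y1 i))" using rr[OF i] by linarith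
          qed
          show "disjoint_family_on Y1 {..<t}"
            unfolding disjoint_family_on_def
          proof (intro ballI impI)
            fix i k assume ik: "i \<in> {..<t}" "k \<in> {..<t}" "i \<noteq> k"
            then have "Y i \<inter> Y k = {}" using disj unfolding disjoint_family_on_def by simp
            then show "Y1 i \<inter> Y1 k = {}" using Y1[of i] Y1[of k] ik by auto
          qed
          show "card (E - {(s a, s b)}) \<le> r"
            using E(2) s(2)[OF ab(1,3)] by (simp add: card_Diff_singleton)
        qed (use E in auto)
        then obtain Z E' where Z: "\<And>i. i < t \<Longrightarrow> Z i \<subseteq> Y1 i \<and> rho_r * real (card (Y1 i)) \<le> real (card (Z i))"
           "E' \<subseteq> E - {(s a, s b)}"
          "\<not> has_clique L t E'"
          "\<forall>(i, j) \<in> (E - {(s a, s b)}) - E'. sparse_pair eps g P (Z i) (Z j)"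
          by blast
        have "den (\<lambda>a b. of_bool (g a b = c u v)) (Z (s a)) (Z (s b)) \<le> \<delta> / rho_r\<^sup>2"
          using Z(1)[OF st(1)] Z(1)[OF st(2)] finY1[OF st(1)] finY1[OF st(2)] st rho_r(2,3) *(8) \<delta>
          by (intro den_shrink[of _ A B]) (auto simp: Y1_def)
        then have "den (\<lambda>a b. of_bool (g a b = c u v)) (Z (s a)) (Z (s b)) \<le> eps"
          using rho_r(2) by (simp add: \<delta>_def)
        then have "sparse_pair eps g P (Z (s a)) (Z (s b))"
          using c unfolding sparse_pair_def by blast
        then have "\<forall>(i, j) \<in> E - E'. sparse_pair eps g P (Z i) (Z j)"
          using Z(4) by blast
        moreover have "\<forall>i<t. Z i \<subseteq> Y i \<and> rho * real (card (Y i)) \<le> real (card (Z i))"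
          using Z(1) Y1 rr by (meson order_trans)
        ultimately show ?thesis using Z(2,3) by blast
      qed
    qed
  qed
  then show ?case by blast
qed

section \<open>Homogeneous parts\<close>

lemma finite_colors [simp]: "finite (A :: color set)"
proof -
  have "(UNIV :: color set) = {Nonedge, Bidir, Backward, Forward}"
    using color.exhaust by auto
  then show ?thesis
    by (metis finite.emptyI finite_insert finite_subset subset_UNIV)
qed

lemma ramsey_colors:
  "\<exists>N. \<forall>\<chi> :: nat \<Rightarrow> nat \<Rightarrow> color. \<exists>S q. S \<subseteq> {..<N} \<and> card S = n \<and>
     (\<forall>x\<in>S. \<forall>y\<in>S. x < y \<longrightarrow> \<chi> x y = q)"
proof -
  obtain N :: nat where N: "partn_lst {..<N} (replicate 4 n) 2"
    using ramsey_full by blast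
  define enc :: "color \<Rightarrow> nat" where
    "enc q = (case q of Nonedge \<Rightarrow> 0 | Bidir \<Rightarrow> 1 | Backward \<Rightarrow> 2 | Forward \<Rightarrow> 3)" for q
  have enc: "enc q < 4" "enc q = enc q' \<Longrightarrow> q = q'" for q q'
    by (cases q; auto simp: enc_def) (cases q; cases q'; auto simp: enc_def)
  show ?thesis
  proof (intro exI[of _ N] allI)
    fix \<chi> :: "nat \<Rightarrow> nat \<Rightarrow> color"
    \<comment> \<open>Reading a pair as \<open>(Min s, Max s)\<close> turns the colouring of ordered
      pairs into one of 2-sets; \<open>enc\<close> numbers the colours as \<open>partn_lst\<close>
      expects.\<close>
    define f where "f s = enc (\<chi> (Min s) (Max s))" for s
    have "f \<in> nsets {..<N} 2 \<rightarrow> {..<4}" by (auto simp: f_def enc)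
    then obtain i S where i: "i < length (replicate 4 n)"
      "S \<in> nsets {..<N} (replicate 4 n ! i)" "f ` nsets S 2 \<subseteq> {i}"
      using partn_lstE[OF N, of f 4] by auto
    have S: "S \<subseteq> {..<N}" "card S = n" using i(1,2) by (auto simp: nsets_def)
    have "\<chi> x y = \<chi> x' y'" if "x \<in> S" "y \<in> S" "x < y" "x' \<in> S" "y' \<in> S" "x' < y'" for x y x' y'
    proof -
      have "f {x, y} = i" "f {x', y'} = i" using i(3) that by (auto simp: nsets_def image_subset_iff)
      then show ?thesis using that enc(2) by (auto simp: f_def)
    qed
    then show "\<exists>S q. S \<subseteq> {..<N} \<and> card S = n \<and> (\<forall>x\<in>S. \<forall>y\<in>S. x < y \<longrightarrow> \<chi> x y = q)"
      using S by (intro exI[of _ S]) metis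
  qed
qed

text \<open>\<open>Backward\<close> is excluded because such a part read in reverse order is
  \<open>Forward\<close>; the three remaining types match the entries of a triple.\<close>

definition homogeneous_below :: "digraph \<Rightarrow> nat \<Rightarrow> nat \<Rightarrow> (nat \<times> nat \<Rightarrow> nat) \<Rightarrow> bool" where
  "homogeneous_below G n j f \<longleftrightarrow>
     (\<forall>i<j. \<exists>q. q \<noteq> Backward \<and> (\<forall>x y. x < y \<and> y < n \<longrightarrow> col G (f (i, x)) (f (i, y)) = q))"

text \<open>\<open>j\<close> counts the parts already made homogeneous: \<open>j = 0\<close> is
  plain realisability of all prescriptions, and \<open>j = L\<close> is what produces a copy of a
  forbidden digraph.\<close>

definition universal :: "color set \<Rightarrow> digraph \<Rightarrow> nat \<Rightarrow> nat \<Rightarrow> nat \<Rightarrow> bool" where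
  "universal P G L n j \<longleftrightarrow> (\<forall>c. (\<forall>u v. c u v \<in> P) \<longrightarrow>
     (\<exists>f. realizes (col G) (verts G) L n c f \<and> homogeneous_below G n j f))"

text \<open>Part \<open>j\<close> of the larger pattern is made so large that Ramsey's theorem applies to it; a vertex
  of any other part is replaced by one copy for every map \<open>\<phi>\<close> from part \<open>j\<close> of the small pattern
  into part \<open>j\<close> of the large one, so that some copies have the right colours to whichever
  homogeneous set Ramsey's theorem returns.\<close>

lemma universal_step:
  assumes j: "j < L"
  shows "\<exists>n'. \<forall>G\<in>digraphs_over P. universal P G L n' j \<longrightarrow> universal P G L n (Suc j)"
proof -
  obtain N where N: "\<And>\<chi> :: nat \<Rightarrow> nat \<Rightarrow> color. \<exists>S q. S \<subseteq> {..<N} \<and> card S = n \<and>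
     (\<forall>x\<in>S. \<forall>y\<in>S. x < y \<longrightarrow> \<chi> x y = q)"
    using ramsey_colors[of n] by blast
  define \<Phi> where "\<Phi> = ({..<n} \<rightarrow>\<^sub>E {..<N})"
  have fin\<Phi>: "finite \<Phi>" by (simp add: \<Phi>_def finite_PiE)
  define K where "K = card \<Phi>"
  obtain e where e: "bij_betw e \<Phi> {0..<K}"
    using ex_bij_betw_finite_nat[OF fin\<Phi>] unfolding K_def by blast
  define d where "d = inv_into \<Phi> e"
  \<comment> \<open>Arbitrary when \<open>u\<close> is not a value of \<open>\<phi>\<close> below
    \<open>n\<close>; the pattern entries affected by this are never read.\<close>
  define pos where "pos \<phi> u = (SOME a. a < n \<and> \<phi> a = u)" for \<phi> :: "nat \<Rightarrow> nat" and u
  \<comment> \<open>\<open>N\<close> positions for the part to which Ramsey's theorem is applied and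
    \<open>n * K\<close> for each other part, where copy \<open>m\<close> of vertex \<open>b\<close>
    sits at \<open>b * K + m\<close>.\<close>
  define n' where "n' = N + n * K"
  show ?thesis
  proof (intro exI[of _ n'] ballI impI)
    fix G assume G: "G \<in> digraphs_over P" and U: "universal P G L n' j"
    show "universal P G L n (Suc j)"
      unfolding universal_def
    proof (intro allI impI)
      fix c :: "nat \<times> nat \<Rightarrow> nat \<times> nat \<Rightarrow> color" assume c: "\<forall>u v. c u v \<in> P"
      \<comment> \<open>In a part other than \<open>j\<close>, the quotient by \<open>K\<close> is
        the vertex and the remainder is the number of the map to which this copy is dedicated; a
        vertex of part \<open>j\<close> is interpreted through the map of its partner.\<close>
      define c' where "c' = (\<lambda>(i, u) (k, v).
        c (i, if i = j then pos (d (v mod K)) u else u div K)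
          (k, if k = j then pos (d (u mod K)) v else v div K))"
      have "\<forall>u v. c' u v \<in> P" using c by (auto simp: c'_def)
      then obtain F where F: "realizes (col G) (verts G) L n' c' F" "homogeneous_below G n' j F"
        using U unfolding universal_def by blast
      from N[of "\<lambda>x y. col G (F (j, x)) (F (j, y))"] obtain S q where S: "S \<subseteq> {..<N}" "card S = n"
        and Sq: "\<forall>x\<in>S. \<forall>y\<in>S. x < y \<longrightarrow> col G (F (j, x)) (F (j, y)) = q"
        by (elim exE conjE)
      have finS: "finite S" using S(1) finite_subset by blast
      define s where "s a = sorted_list_of_set S ! a" for a
      have len: "length (sorted_list_of_set S) = n" using S(2) by simp
      have inS: "s a \<in> S" if "a < n" for a
        using that len finS nth_mem[of a "sorted_list_of_set S"] by (simp add: s_def)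
      have s_mono: "s a < s b" if "a < b" "b < n" for a b
        using that len sorted_wrt_nth_less[OF strict_sorted_list_of_set, of a b S]
        by (simp add: s_def)
      define q' where "q' = (if q = Backward then Forward else q)"
      \<comment> \<open>Listing a \<open>Backward\<close> set in decreasing order makes it
        \<open>Forward\<close>, as \<open>homogeneous_below\<close> demands.\<close>
      define \<phi> where "\<phi> = restrict (\<lambda>a. if q = Backward then s (n - 1 - a) else s a) {..<n}"
      have \<phi>S: "\<phi> a \<in> S" if "a < n" for a using that inS by (auto simp: \<phi>_def)
      have \<phi>: "\<phi> \<in> \<Phi>"
      proof -
        have "\<phi> a \<in> {..<N}" if "a \<in> {..<n}" for a using \<phi>S[of a] S(1) that by blast
        moreover have "\<phi> a = undefined" if "a \<notin> {..<n}" for a using that by (simp add: \<phi>_def)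
        ultimately show ?thesis unfolding \<Phi>_def by (intro PiE_I)
      qed
      have inj: "\<phi> a \<noteq> \<phi> b" if "a < b" "b < n" for a b
      proof -
        have "n - 1 - b < n - 1 - a" "n - 1 - a < n" using that by linarith+
        then show ?thesis
          using that s_mono[of a b] s_mono[of "n - 1 - b" "n - 1 - a"] by (auto simp: \<phi>_def)
      qed
      have pos: "pos \<phi> (\<phi> a) = a" if "a < n" for a
      proof -
        have "(SOME b. b < n \<and> \<phi> b = \<phi> a) = a"
          using inj that by (intro some_equality) (auto, metis nat_neq_iff)
        then show ?thesis by (simp add: pos_def)
      qed
      have vF: "F (i, x) \<in> verts G" if "i < L" "x < n'" for i x
        using F(1) that by (auto simp: realizes_def)
      have \<phi>n': "\<phi> a < n'" if "a < n" for a using \<phi>S[OF that] S(1) by (auto simp: n'_def)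
      have Fneq: "F (i, x) \<noteq> F (k, y)" if "i < L" "x < n'" "k < L" "y < n'" "(i, x) \<noteq> (k, y)" for i x k y
        using F(1) that by (auto simp: realizes_def dest!: inj_onD)
      have hom: "col G (F (j, \<phi> a)) (F (j, \<phi> b)) = q'" if "a < b" "b < n" for a b
      proof (cases "q = Backward")
        case False
        then show ?thesis using that Sq inS s_mono[OF that] by (simp add: \<phi>_def q'_def)
      next
        case True
        have "n - 1 - b < n - 1 - a" "n - 1 - a < n" using that by linarith+
        then have "col G (F (j, \<phi> b)) (F (j, \<phi> a)) = q"
          using that True Sq inS s_mono[of "n - 1 - b" "n - 1 - a"]
          by (simp add: \<phi>_def)
        then show ?thesis
          using True digraphs_over_D(2)[OF G, of "F (j, \<phi> b)" "F (j, \<phi> a)"] vF[OF j] \<phi>n' that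
            Fneq[OF j _ j, of "\<phi> b" "\<phi> a"] inj[OF that] by (simp add: q'_def)
      qed
      define m where "m = e \<phi>"
      have m: "m < K" "d m = \<phi>"
        using e \<phi> by (auto simp: m_def d_def bij_betw_def)
      define \<psi> where "\<psi> = (\<lambda>(i, b). (i, if i = j then \<phi> b else b * K + m))"
      have bK: "b * K + m < n'" if "b < n" for b
      proof -
        have "b * K + m < Suc b * K" using m by simp
        also have "\<dots> \<le> n * K" using that by (intro mult_right_mono) auto
        finally show ?thesis by (simp add: n'_def)
      qed
      have \<psi>: "\<psi> ` ({..<L} \<times> {..<n}) \<subseteq> {..<L} \<times> {..<n'}"
        using bK \<phi>n' by (auto simp: \<psi>_def)
      have inj\<psi>: "inj_on \<psi> ({..<L} \<times> {..<n})"
        using inj m(1) by (auto simp: \<psi>_def inj_on_def split: if_splits) (metis nat_neq_iff)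
      have md: "(b * K + m) mod K = m" "(b * K + m) div K = b" for b using m(1) by auto
      have "realizes (col G) (verts G) L n c (F \<circ> \<psi>)"
        unfolding realizes_def
      proof (intro conjI allI impI)
        show "inj_on (F \<circ> \<psi>) ({..<L} \<times> {..<n})"
          using F(1) \<psi> by (intro comp_inj_on inj\<psi>) (auto simp: realizes_def intro: inj_on_subset)
        show "(F \<circ> \<psi>) ` ({..<L} \<times> {..<n}) \<subseteq> verts G"
        proof -
          have "(F \<circ> \<psi>) ` ({..<L} \<times> {..<n}) \<subseteq> F ` ({..<L} \<times> {..<n'})"
            using image_mono[OF \<psi>, of F] by (simp add: image_comp)
          also have "\<dots> \<subseteq> verts G" using F(1) unfolding realizes_def by blast
          finally show ?thesis .
        qed
        fix i k x y assume *: "i < k \<and> k < L \<and> x < n \<and> y < n"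
        have cross: "col G (F (i, u)) (F (k, v)) = c' (i, u) (k, v)" if "u < n'" "v < n'" for u v
          using F(1) * that by (auto simp: realizes_def)
        show "col G ((F \<circ> \<psi>) (i, x)) ((F \<circ> \<psi>) (k, y)) = c (i, x) (k, y)"
          using * cross bK \<phi>n' md pos m(2) by (simp add: \<psi>_def c'_def)
      qed
      moreover have "homogeneous_below G n (Suc j) (F \<circ> \<psi>)"
        unfolding homogeneous_below_def
      proof (intro allI impI)
        fix i assume "i < Suc j"
        show "\<exists>q. q \<noteq> Backward \<and> (\<forall>x y. x < y \<and> y < n \<longrightarrow> col G ((F \<circ> \<psi>) (i, x)) ((F \<circ> \<psi>) (i, y)) = q)"
        proof (cases "i = j")
          case True
          then show ?thesis using hom by (intro exI[of _ q']) (auto simp: \<psi>_def q'_def)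
        next
          case False
          then obtain r where r: "r \<noteq> Backward" "\<And>x y. x < y \<Longrightarrow> y < n' \<Longrightarrow> col G (F (i, x)) (F (i, y)) = r"
            using F(2) \<open>i < Suc j\<close> by (auto simp: homogeneous_below_def less_Suc_eq)
          have "x * K + m < y * K + m" if "x < y" for x y using that m(1) by simp
          then show ?thesis using r bK False by (intro exI[of _ r]) (auto simp: \<psi>_def)
        qed
      qed
      ultimately show "\<exists>f. realizes (col G) (verts G) L n c f \<and> homogeneous_below G n (Suc j) f" by blast
    qed
  qed
qed

lemma universal_homogeneous:
  "j \<le> L \<Longrightarrow> \<exists>n'. \<forall>G\<in>digraphs_over P. universal P G L n' 0 \<longrightarrow> universal P G L n j"
proof (induction j arbitrary: n)
  case (Suc j)
  then obtain n1 where "\<forall>G\<in>digraphs_over P. universal P G L n1 j \<longrightarrow> universal P G L n (Suc j)"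
    using universal_step[of j L P n] by auto
  moreover obtain n2 where "\<forall>G\<in>digraphs_over P. universal P G L n2 0 \<longrightarrow> universal P G L n1 j"
    using Suc by auto
  ultimately show ?case by blast
qed blast

text \<open>No pair of vertices of a digraph has colour \<open>Forward\<close> in both orders, so
  for the directed type the role of a monochromatic set is taken by a transitive tournament.\<close>

definition homogeneous :: "color \<Rightarrow> digraph \<Rightarrow> nat set \<Rightarrow> bool" where
  "homogeneous q H X \<longleftrightarrow> (if q = Forward then transitive_tournament H X else all_color q H X)"

text \<open>A triple only counts parts, whereas Ramsey's theorem assigns a type to each part. For
  every type a bijection between its indices and the initial segment of the same size redistributes
  the parts.\<close>

lemma strongly_good_partition:
  fixes L :: nat
  assumes good: "strongly_good \<F> (card {i \<in> {..<L}. \<tau> i = Nonedge}, card {i \<in> {..<L}. \<tau> i = Forward},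
      card {i \<in> {..<L}. \<tau> i = Bidir})"
    and \<tau>: "\<And>i. i < L \<Longrightarrow> \<tau> i \<noteq> Backward"
  shows "\<exists>H\<in>\<F>. \<exists>V. verts H = (\<Union>i<L. V i) \<and> disjoint_family_on V {..<L} \<and>
    (\<forall>i<L. homogeneous (\<tau> i) H (V i))"
proof -
  let ?I = "\<lambda>q. {i \<in> {..<L}. \<tau> i = q}"
  obtain H S0 S1 S2 where H: "H \<in> \<F>" "verts H = S0 \<union> S1 \<union> S2" "S0 \<inter> S1 = {}" "S0 \<inter> S2 = {}" "S1 \<inter> S2 = {}"
    and sp: "splits_into (all_color Nonedge H) (card (?I Nonedge)) S0"
     "splits_into (transitive_tournament H) (card (?I Forward)) S1"
     "splits_into (all_color Bidir H) (card (?I Bidir)) S2"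
    using good unfolding strongly_good_def by auto
  define S where "S q = (case q of Nonedge \<Rightarrow> S0 | Bidir \<Rightarrow> S2 | _ \<Rightarrow> S1)" for q
  have S: "S q \<inter> S r = {}" if "q \<noteq> r" "q \<noteq> Backward" "r \<noteq> Backward" for q r
    using that H(3-5) by (cases q; cases r) (auto simp: S_def)
  define fits where "fits q W \<longleftrightarrow> S q = (\<Union>i\<in>?I q. W i) \<and> disjoint_family_on W (?I q) \<and>
    (\<forall>i\<in>?I q. homogeneous q H (W i))" for q W
  have "\<exists>W. fits q W"
    if "q \<noteq> Backward" for q
  proof -
    have "splits_into (homogeneous q H) (card (?I q)) (S q)"
      using sp that by (cases q) (auto simp: S_def homogeneous_def splits_into_def)
    then obtain W where W: "S q = (\<Union>j<card (?I q). W j)" "disjoint_family_on W {..<card (?I q)}"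
      "\<forall>j<card (?I q). homogeneous q H (W j)" by (auto simp: splits_into_def)
    have finI: "finite (?I q)" by simp
    obtain b where b: "bij_betw b (?I q) {0..<card (?I q)}"
      using ex_bij_betw_finite_nat[OF finI] by blast
    then have b': "b ` ?I q = {..<card (?I q)}" "inj_on b (?I q)"
      by (auto simp: bij_betw_def lessThan_atLeast0)
    have "S q = (\<Union>i\<in>?I q. (W \<circ> b) i)"
      unfolding W(1) b'(1)[symmetric] by auto
    moreover have "disjoint_family_on (W \<circ> b) (?I q)"
      unfolding disjoint_family_on_def
    proof (intro ballI impI)
      fix x y assume xy: "x \<in> ?I q" "y \<in> ?I q" "x \<noteq> y"
      then have "b x \<noteq> b y" using b'(2) by (auto dest: inj_onD)
      moreover have "b x \<in> {..<card (?I q)}" "b y \<in> {..<card (?I q)}" using xy b'(1) by blast+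
      ultimately show "(W \<circ> b) x \<inter> (W \<circ> b) y = {}"
        using W(2) unfolding disjoint_family_on_def comp_def by blast
    qed
    moreover have "\<forall>i\<in>?I q. homogeneous q H ((W \<circ> b) i)"
      using W(3) b'(1) by auto
    ultimately show ?thesis unfolding fits_def by blast
  qed
  then have "\<forall>q\<in>{q. q \<noteq> Backward}. \<exists>W. fits q W" by simp
  from bchoice[OF this] obtain W where fits: "\<forall>q\<in>{q. q \<noteq> Backward}. fits q (W q)"
    by (elim exE)
  then have W: "\<And>q. q \<noteq> Backward \<Longrightarrow> S q = (\<Union>i\<in>?I q. W q i)"
     "\<And>q. q \<noteq> Backward \<Longrightarrow> disjoint_family_on (W q) (?I q)"
     "\<And>q i. q \<noteq> Backward \<Longrightarrow> i \<in> ?I q \<Longrightarrow> homogeneous q H (W q i)"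
    by (simp_all add: fits_def)
  define V where "V i = W (\<tau> i) i" for i
  have VS: "V i \<subseteq> S (\<tau> i)" if "i < L" for i
    using W(1)[OF \<tau>[OF that]] that by (auto simp: V_def)
  have "verts H = S Nonedge \<union> S Forward \<union> S Bidir" using H(2) by (simp add: S_def)
  also have "\<dots> = (\<Union>i<L. V i)"
  proof
    show "S Nonedge \<union> S Forward \<union> S Bidir \<subseteq> (\<Union>i<L. V i)"
      using W(1)[of Nonedge] W(1)[of Forward] W(1)[of Bidir] by (auto simp: V_def)
    show "(\<Union>i<L. V i) \<subseteq> S Nonedge \<union> S Forward \<union> S Bidir"
    proof
      fix x assume "x \<in> (\<Union>i<L. V i)"
      then obtain i where "i < L" "x \<in> V i" by auto
      then show "x \<in> S Nonedge \<union> S Forward \<union> S Bidir"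
        using VS[of i] \<tau>[of i] by (cases "\<tau> i") auto
    qed
  qed
  finally have "verts H = (\<Union>i<L. V i)" .
  moreover have "disjoint_family_on V {..<L}"
    unfolding disjoint_family_on_def
  proof (intro ballI impI)
    fix i k assume ik: "i \<in> {..<L}" "k \<in> {..<L}" "i \<noteq> k"
    show "V i \<inter> V k = {}"
    proof (cases "\<tau> i = \<tau> k")
      case True
      then show ?thesis
        using W(2)[OF \<tau>[of i]] ik unfolding disjoint_family_on_def V_def by auto
    next
      case False
      then show ?thesis using S[of "\<tau> i" "\<tau> k"] \<tau> VS ik by blast
    qed
  qed
  moreover have "\<forall>i<L. homogeneous (\<tau> i) H (V i)"
    using W(3) \<tau> by (auto simp: V_def)
  ultimately show ?thesis using H(1) by blast
qed

text \<open>In a transitive tournament the number of predecessors strictly increases along arcs, so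
  it is a bijection onto an initial segment, and its inverse lists the vertices with all arcs
  pointing forward. For the other types any listing works.\<close>

lemma enumerate_homogeneous:
  assumes H: "H \<in> digraphs_over P" and X: "X \<subseteq> verts H" and hom: "homogeneous q H X"
  shows "\<exists>v. bij_betw v {..<card X} X \<and> (\<forall>a b. a < b \<and> b < card X \<longrightarrow> col H (v a) (v b) = q)"
proof (cases "q = Forward")
  case False
  have "finite X" using X digraphs_over_D(1)[OF H] finite_subset by blast
  then obtain v where v: "bij_betw v {0..<card X} X" using ex_bij_betw_nat_finite by blast
  have "col H (v a) (v b) = q" if "a < b" "b < card X" for a b
  proof -
    have "v a \<in> X" "v b \<in> X" "v a \<noteq> v b"
      using v that by (auto simp: bij_betw_def inj_on_eq_iff)
    then show ?thesis using hom False by (auto simp: homogeneous_def all_color_def)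
  qed
  then show ?thesis using v by (auto simp: lessThan_atLeast0)
next
  case True
  have fin: "finite X" using X digraphs_over_D(1)[OF H] finite_subset by blast
  let ?R = "dir_arcs H X"
  have tr: "trans ?R" and tour: "\<And>x y. x \<in> X \<Longrightarrow> y \<in> X \<Longrightarrow> x \<noteq> y \<Longrightarrow> col H x y \<in> {Backward, Forward}"
    using hom True by (auto simp: homogeneous_def transitive_tournament_def)
  have conv: "col H y x = conv (col H x y)" if "x \<in> X" "y \<in> X" "x \<noteq> y" for x y
    using digraphs_over_D(2)[OF H, of x y] that X by auto
  have total: "(x, y) \<in> ?R \<or> (y, x) \<in> ?R" if "x \<in> X" "y \<in> X" "x \<noteq> y" for x y
    using tour[OF that] conv[OF that] that by (auto simp: dir_arcs_def)
  define rk where "rk y = card {x \<in> X. (x, y) \<in> ?R}" for y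
  have less: "rk x < rk y" if "(x, y) \<in> ?R" for x y
    unfolding rk_def
  proof (rule psubset_card_mono)
    have "x \<in> X" "(x, x) \<notin> ?R" using that by (auto simp: dir_arcs_def)
    then show "{z \<in> X. (z, x) \<in> ?R} \<subset> {z \<in> X. (z, y) \<in> ?R}"
      using that transD[OF tr] by blast
  qed (use fin in auto)
  have inj: "inj_on rk X"
    using total less by (intro inj_onI) (metis less_irrefl)
  have "rk ` X \<subseteq> {..<card X}"
  proof
    fix r assume "r \<in> rk ` X"
    then obtain y where y: "y \<in> X" "r = rk y" by auto
    have "{x \<in> X. (x, y) \<in> ?R} \<subset> X" using y by (auto simp: dir_arcs_def)
    then show "r \<in> {..<card X}" using y fin by (simp add: rk_def psubset_card_mono)
  qed
  moreover have "card (rk ` X) = card {..<card X}" using inj by (simp add: card_image)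
  ultimately have "rk ` X = {..<card X}" by (intro card_subset_eq) auto
  then have bij: "bij_betw rk X {..<card X}" using inj by (simp add: bij_betw_def)
  define v where "v = inv_into X rk"
  have v: "bij_betw v {..<card X} X" unfolding v_def by (rule bij_betw_inv_into[OF bij])
  have rkv: "rk (v a) = a" if "a < card X" for a
    using that bij by (auto simp: v_def bij_betw_def f_inv_into_f)
  have "col H (v a) (v b) = q" if "a < b" "b < card X" for a b
  proof -
    have "v a \<in> X" "v b \<in> X" "v a \<noteq> v b"
      using v that by (auto simp: bij_betw_def inj_on_eq_iff)
    moreover have "(v b, v a) \<notin> ?R" using less[of "v b" "v a"] rkv that by auto
    ultimately have "(v a, v b) \<in> ?R" using total by blast
    then show ?thesis using True by (auto simp: dir_arcs_def)
  qed
  then show ?thesis using v by blast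
qed

text \<open>The type vector of a homogeneous realisation is not known in advance. Hence one pattern
  stores, for every possible vector \<open>\<tau>\<close>, the colours between the parts of a
  forbidden digraph \<open>Hs \<tau>\<close> split according to \<open>\<tau>\<close>; whichever
  vector occurs, the colours inside the parts complete a copy of the matching digraph.\<close>

lemma not_universal:
  assumes P: "palette P" "P \<noteq> {}" and F: "forbidden_family P \<H> \<F>" and L: "L \<ge> 1"
    and good: "\<And>a0 a1 a2. admissible P (a0, a1, a2) \<Longrightarrow> a0 + a1 + a2 = L \<Longrightarrow> strongly_good \<F> (a0, a1, a2)"
  shows "\<exists>n\<ge>1. \<forall>G\<in>\<H>. \<not> universal P G L n 0"
proof -
  define T where "T = ({..<L} \<rightarrow>\<^sub>E P - {Backward})"
  have finT: "finite T" by (simp add: T_def finite_PiE)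
  obtain q0 where q0: "q0 \<in> P" "q0 \<noteq> Backward"
    using P unfolding palette_def by (metis color.distinct(11) ex_in_conv)
  have T_ne: "restrict (\<lambda>_. q0) {..<L} \<in> T" using q0 by (auto simp: T_def)
  have \<tau>P: "\<tau> i \<in> P" "\<tau> i \<noteq> Backward" if "\<tau> \<in> T" "i < L" for \<tau> i
    using that by (auto simp: T_def PiE_iff)
  define fits where "fits \<tau> H V \<longleftrightarrow> H \<in> \<F> \<and> verts H = (\<Union>i<L. V i) \<and> disjoint_family_on V {..<L} \<and>
    (\<forall>i<L. homogeneous (\<tau> i) H (V i))" for \<tau> H V
  have "\<exists>X. fits \<tau> (fst X) (snd X)" if \<tau>: "\<tau> \<in> T" for \<tau>
  proof -
    let ?I = "\<lambda>q. {i \<in> {..<L}. \<tau> i = q}"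
    have "?I q = {}" if "q \<notin> P" for q using \<tau>P[OF \<tau>] that by auto
    then have I0: "card (?I q) = 0" if "q \<notin> P" for q using that by simp
    have adm: "admissible P (card (?I Nonedge), card (?I Forward), card (?I Bidir))"
      unfolding admissible_def using I0[of Nonedge] I0[of Forward] I0[of Bidir] P(1)
      by (auto simp: palette_def)
    have "card (?I Nonedge) + card (?I Forward) + card (?I Bidir) =
       card (?I Nonedge \<union> ?I Forward \<union> ?I Bidir)"
      by (subst card_Un_disjoint, auto)+
    also have "?I Nonedge \<union> ?I Forward \<union> ?I Bidir = {..<L}"
    proof -
      have "i \<in> ?I Nonedge \<union> ?I Forward \<union> ?I Bidir" if "i < L" for i
        using \<tau>P(2)[OF \<tau> that] that by (cases "\<tau> i") auto
      then show ?thesis by blast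
    qed
    finally have "strongly_good \<F> (card (?I Nonedge), card (?I Forward), card (?I Bidir))"
      using good[OF adm] by simp
    from strongly_good_partition[OF this \<tau>P(2)[OF \<tau>]] obtain H V where "fits \<tau> H V"
      unfolding fits_def by blast
    then show ?thesis by (intro exI[of _ "(H, V)"]) simp
  qed
  then have "\<forall>\<tau>\<in>T. \<exists>X. fits \<tau> (fst X) (snd X)" by blast
  from bchoice[OF this] obtain X where "\<forall>\<tau>\<in>T. fits \<tau> (fst (X \<tau>)) (snd (X \<tau>))"
    by (elim exE)
  moreover define Hs Vs where "Hs = fst \<circ> X" and "Vs = snd \<circ> X"
  ultimately have HV: "\<And>\<tau>. \<tau> \<in> T \<Longrightarrow> Hs \<tau> \<in> \<F>"
    "\<And>\<tau>. \<tau> \<in> T \<Longrightarrow> verts (Hs \<tau>) = (\<Union>i<L. Vs \<tau> i)"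
    "\<And>\<tau>. \<tau> \<in> T \<Longrightarrow> disjoint_family_on (Vs \<tau>) {..<L}"
    "\<And>\<tau> i. \<tau> \<in> T \<Longrightarrow> i < L \<Longrightarrow> homogeneous (\<tau> i) (Hs \<tau>) (Vs \<tau> i)"
    by (simp_all add: fits_def)
  have Hover: "Hs \<tau> \<in> digraphs_over P" if "\<tau> \<in> T" for \<tau>
    using forbidden_family_digraphs_over(2)[OF F HV(1)[OF that]] .
  have Vsub: "Vs \<tau> i \<subseteq> verts (Hs \<tau>)" if "\<tau> \<in> T" "i < L" for \<tau> i
    using HV(2)[OF that(1)] that(2) by auto
  define enum where "enum \<tau> i = (SOME v. bij_betw v {..<card (Vs \<tau> i)} (Vs \<tau> i) \<and>
     (\<forall>a b. a < b \<and> b < card (Vs \<tau> i) \<longrightarrow> col (Hs \<tau>) (v a) (v b) = \<tau> i))" for \<tau> i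
  have enum: "bij_betw (enum \<tau> i) {..<card (Vs \<tau> i)} (Vs \<tau> i) \<and>
     (\<forall>a b. a < b \<and> b < card (Vs \<tau> i) \<longrightarrow> col (Hs \<tau>) (enum \<tau> i a) (enum \<tau> i b) = \<tau> i)"
    if "\<tau> \<in> T" "i < L" for \<tau> i
    unfolding enum_def
    by (rule someI_ex[OF enumerate_homogeneous[OF Hover[OF that(1)] Vsub[OF that] HV(4)[OF that]]])
  \<comment> \<open>All parts are smaller than \<open>h\<close>, so \<open>x div h\<close> can
    select a type vector and \<open>x mod h\<close> a vertex of a part; the summand 2 provides the
    positions 0 and 1 from which a type is read off.\<close>
  define h where "h = 2 + (\<Sum>\<tau>\<in>T. card (verts (Hs \<tau>)))"
  have h: "h \<ge> 2" by (simp add: h_def)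
  have hV: "card (Vs \<tau> i) < h" if "\<tau> \<in> T" "i < L" for \<tau> i
  proof -
    have "card (Vs \<tau> i) \<le> card (verts (Hs \<tau>))"
      using Vsub[OF that] digraphs_over_D(1)[OF Hover[OF that(1)]] by (rule card_mono[rotated])
    also have "\<dots> \<le> (\<Sum>\<tau>\<in>T. card (verts (Hs \<tau>)))"
      using finT that(1) by (intro member_le_sum) auto
    finally show ?thesis by (simp add: h_def)
  qed
  obtain e where e: "bij_betw e T {0..<card T}" using ex_bij_betw_finite_nat[OF finT] by blast
  define d where "d = inv_into T e"
  define n where "n = card T * h"
  have "card T \<ge> 1" using T_ne finT by (auto simp: Suc_le_eq card_gt_0_iff)
  then have n2: "n \<ge> 2" using mult_le_mono[OF _ h, of 1 "card T"] by (simp add: n_def)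
  \<comment> \<open>Entries outside the stored tables are filled with \<open>q0\<close>, so that
    \<open>c\<close> takes values in \<open>P\<close> everywhere. The vector is read from
    \<open>x\<close> alone; the copy built below uses the same vector for \<open>y\<close>.\<close>
  define ok where "ok i x k y \<longleftrightarrow> i < k \<and> k < L \<and> x div h < card T \<and>
     x mod h < card (Vs (d (x div h)) i) \<and> y mod h < card (Vs (d (x div h)) k)" for i x k y
  define c where "c = (\<lambda>(i, x) (k, y). if ok i x k y
      then col (Hs (d (x div h))) (enum (d (x div h)) i (x mod h)) (enum (d (x div h)) k (y mod h)) else q0)"
  have dT: "d z \<in> T" if "z < card T" for z
    using e that unfolding d_def bij_betw_def by (metis atLeastLessThan_iff inv_into_into zero_le)
  have enumV: "enum \<tau> i a \<in> Vs \<tau> i" if "\<tau> \<in> T" "i < L" "a < card (Vs \<tau> i)" for \<tau> i a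
    using enum[OF that(1,2)] that(3) by (auto simp: bij_betw_def)
  have enum_neq: "enum \<tau> i a \<noteq> enum \<tau> k b"
    if "\<tau> \<in> T" "i < L" "a < card (Vs \<tau> i)" "k < L" "b < card (Vs \<tau> k)" "i \<noteq> k" for \<tau> i a k b
  proof -
    have "Vs \<tau> i \<inter> Vs \<tau> k = {}"
      using HV(3)[OF that(1)] that(2,4,6) unfolding disjoint_family_on_def by simp
    then show ?thesis using enumV[OF that(1-3)] enumV[OF that(1,4,5)] by auto
  qed
  have cP: "c u v \<in> P" for u v
  proof -
    obtain i x k y where uv: "u = (i, x)" "v = (k, y)" by (cases u, cases v) auto
    show ?thesis
    proof (cases "ok i x k y")
      case True
      define \<tau> where "\<tau> = d (x div h)"
      have *: "\<tau> \<in> T" "i < L" "k < L" "i \<noteq> k" "x mod h < card (Vs \<tau> i)" "y mod h < card (Vs \<tau> k)"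
        using True dT by (auto simp: ok_def \<tau>_def)
      have "col (Hs \<tau>) (enum \<tau> i (x mod h)) (enum \<tau> k (y mod h)) \<in> P"
        by (rule digraphs_over_D(3)[OF Hover[OF *(1)] subsetD[OF Vsub[OF *(1,2)] enumV[OF *(1,2,5)]]
            subsetD[OF Vsub[OF *(1,3)] enumV[OF *(1,3,6)]] enum_neq[OF *(1,2,5,3,6,4)]])
      then show ?thesis using True by (simp add: c_def uv \<tau>_def)
    qed (simp add: c_def uv q0)
  qed
  obtain n' where n': "\<forall>G\<in>digraphs_over P. universal P G L n' 0 \<longrightarrow> universal P G L n L"
    using universal_homogeneous[of L L P n] by auto
  have no: "\<not> universal P G L n L" if G: "G \<in> \<H>" for G
  proof
    assume "universal P G L n L"
    then obtain f where f: "realizes (col G) (verts G) L n c f" "homogeneous_below G n L f"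
      using cP unfolding universal_def by blast
    have Gover: "G \<in> digraphs_over P" using forbidden_family_digraphs_over(1)[OF F G] .
    have fv: "f (i, x) \<in> verts G" if "i < L" "x < n" for i x
      using f(1) that unfolding realizes_def by blast
    have f_inj: "f (i, x) \<noteq> f (k, y)" if "i < L" "x < n" "k < L" "y < n" "(i, x) \<noteq> (k, y)" for i x k y
    proof -
      have "inj_on f ({..<L} \<times> {..<n})" using f(1) unfolding realizes_def by blast
      from inj_onD[OF this, of "(i, x)" "(k, y)"] show ?thesis using that by auto
    qed
    define \<tau> where "\<tau> = restrict (\<lambda>i. col G (f (i, 0)) (f (i, 1))) {..<L}"
    have \<tau>: "col G (f (i, x)) (f (i, y)) = \<tau> i \<and> \<tau> i \<noteq> Backward" if "i < L" "x < y" "y < n" for i x y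
    proof -
      obtain q where "q \<noteq> Backward" "\<forall>x y. x < y \<and> y < n \<longrightarrow> col G (f (i, x)) (f (i, y)) = q"
        using f(2) \<open>i < L\<close> unfolding homogeneous_below_def by blast
      then show ?thesis using that n2 by (simp add: \<tau>_def)
    qed
    have "\<tau> \<in> T"
      unfolding T_def
    proof (rule PiE_I)
      fix i assume "i \<in> {..<L}"
      then have "i < L" by simp
      then have "\<tau> i \<in> P"
        using digraphs_over_D(3)[OF Gover fv fv f_inj, of i 0 i 1] n2 by (simp add: \<tau>_def)
      then show "\<tau> i \<in> P - {Backward}" using \<tau>[OF \<open>i < L\<close>, of 0 1] n2 by simp
    qed (simp add: \<tau>_def)
    define H V m where "H = Hs \<tau>" and "V = Vs \<tau>" and "m = e \<tau>"
    have m: "m < card T" "d m = \<tau>"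
      using e \<open>\<tau> \<in> T\<close> by (auto simp: m_def d_def bij_betw_def)
    have ex: "\<exists>ia. fst ia < L \<and> snd ia < card (V (fst ia)) \<and> enum \<tau> (fst ia) (snd ia) = w" if w: "w \<in> verts H" for w
    proof -
      obtain i where i: "i < L" "w \<in> V i" using w unfolding H_def V_def HV(2)[OF \<open>\<tau> \<in> T\<close>] by blast
      then have "w \<in> enum \<tau> i ` {..<card (V i)}"
        using enum[OF \<open>\<tau> \<in> T\<close> i(1)] by (auto simp: bij_betw_def V_def)
      then obtain a where "a < card (V i)" "enum \<tau> i a = w" by auto
      then show ?thesis using i(1) by (intro exI[of _ "(i, a)"]) simp
    qed
    then have "\<forall>w\<in>verts H. \<exists>ia. fst ia < L \<and> snd ia < card (V (fst ia)) \<and> enum \<tau> (fst ia) (snd ia) = w"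
      by blast
    from bchoice[OF this] obtain ia where "\<forall>w\<in>verts H. fst (ia w) < L \<and>
        snd (ia w) < card (V (fst (ia w))) \<and> enum \<tau> (fst (ia w)) (snd (ia w)) = w"
      by (elim exE)
    moreover define I A where "I = fst \<circ> ia" and "A = snd \<circ> ia"
    ultimately have IA: "\<And>w. w \<in> verts H \<Longrightarrow> I w < L"
      "\<And>w. w \<in> verts H \<Longrightarrow> A w < card (V (I w))" "\<And>w. w \<in> verts H \<Longrightarrow> enum \<tau> (I w) (A w) = w"
      by simp_all
    define X where "X w = m * h + A w" for w
    have Ah: "A w < h" if "w \<in> verts H" for w
      using IA(2)[OF that] hV[OF \<open>\<tau> \<in> T\<close> IA(1)[OF that]] by (simp add: V_def)
    have Xn: "X w < n" if "w \<in> verts H" for w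
    proof -
      have "X w < Suc m * h" using Ah[OF that] by (simp add: X_def)
      also have "\<dots> \<le> card T * h" using m by (intro mult_right_mono) auto
      finally show ?thesis by (simp add: n_def)
    qed
    have Xdm: "X w div h = m" "X w mod h = A w" if "w \<in> verts H" for w
      using Ah[OF that] by (auto simp: X_def)
    define \<phi> where "\<phi> w = f (I w, X w)" for w
    have neq: "(I w, X w) \<noteq> (I z, X z)" if "w \<in> verts H" "z \<in> verts H" "w \<noteq> z" for w z
      using IA(3)[OF that(1)] IA(3)[OF that(2)] that(3) by (auto simp: X_def)
    have \<phi>_neq: "\<phi> w \<noteq> \<phi> z" if "w \<in> verts H" "z \<in> verts H" "w \<noteq> z" for w z
      unfolding \<phi>_def using that by (intro f_inj IA(1) Xn neq)
    have \<phi>v: "\<phi> w \<in> verts G" if "w \<in> verts H" for w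
      unfolding \<phi>_def using that by (intro fv IA(1) Xn)
    \<comment> \<open>In the lexicographic order the colour comes from the pattern if the parts
      differ, and otherwise from homogeneity together with the listing of the part. The reverse
      pairs follow by \<open>conv\<close>.\<close>
    have dir: "col G (\<phi> w) (\<phi> z) = col H w z"
      if wz: "w \<in> verts H" "z \<in> verts H" and lt: "I w < I z \<or> I w = I z \<and> A w < A z" for w z
      using lt
    proof
      assume lt: "I w < I z"
      have "ok (I w) (X w) (I z) (X z)"
        using lt IA(1)[OF wz(2)] IA(2)[OF wz(1)] IA(2)[OF wz(2)] Xdm[OF wz(1)] Xdm[OF wz(2)] m
        by (simp add: ok_def V_def)
      then have "c (I w, X w) (I z, X z) = col H w z"
        using Xdm[OF wz(1)] Xdm[OF wz(2)] m IA(3)[OF wz(1)] IA(3)[OF wz(2)] by (simp add: c_def H_def)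
      moreover have "col G (\<phi> w) (\<phi> z) = c (I w, X w) (I z, X z)"
        using f(1) lt IA(1)[OF wz(2)] Xn wz unfolding realizes_def \<phi>_def by blast
      ultimately show ?thesis by simp
    next
      assume lt: "I w = I z \<and> A w < A z"
      have "col G (\<phi> w) (\<phi> z) = \<tau> (I z)"
        using \<tau>[OF IA(1)[OF wz(2)] _ Xn[OF wz(2)], of "X w"] lt by (simp add: \<phi>_def X_def)
      moreover have "col H (enum \<tau> (I z) (A w)) (enum \<tau> (I z) (A z)) = \<tau> (I z)"
        using enum[OF \<open>\<tau> \<in> T\<close> IA(1)[OF wz(2)]] lt IA(2)[OF wz(2)] by (simp add: H_def V_def)
      ultimately show ?thesis using IA(3)[OF wz(1)] IA(3)[OF wz(2)] lt by simp
    qed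
    show False
    proof (rule member_no_copy[OF F G HV(1)[OF \<open>\<tau> \<in> T\<close>], of \<phi>, folded H_def])
      show "inj_on \<phi> (verts H)" using \<phi>_neq by (intro inj_onI) blast
      show "\<phi> ` verts H \<subseteq> verts G" using \<phi>v by blast
      fix w z assume wz: "w \<in> verts H" "z \<in> verts H" "w \<noteq> z"
      have "\<not> (I w = I z \<and> A w = A z)" using neq[OF wz] by (auto simp: X_def)
      then consider "I w < I z \<or> I w = I z \<and> A w < A z" | "I z < I w \<or> I z = I w \<and> A z < A w"
        by linarith
      then show "col G (\<phi> w) (\<phi> z) = col H w z"
      proof cases
        case 1
        then show ?thesis by (rule dir[OF wz(1,2)])
      next
        case 2
        have "col G (\<phi> w) (\<phi> z) = conv (col G (\<phi> z) (\<phi> w))"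
          using digraphs_over_D(2)[OF Gover \<phi>v[OF wz(2)] \<phi>v[OF wz(1)]] \<phi>_neq[OF wz] by simp
        also have "\<dots> = conv (col H z w)" using dir[OF wz(2,1) 2] by simp
        also have "\<dots> = col H w z"
          using digraphs_over_D(2)[OF Hover[OF \<open>\<tau> \<in> T\<close>], of z w] wz by (simp add: H_def)
        finally show ?thesis .
      qed
    qed
  qed
  \<comment> \<open>The size handed on has to be at least 1; a realisation of the larger size
    restricts to the smaller one.\<close>
  have mono: "universal P G L n' 0" if G: "universal P G L (max n' 1) 0" for G
    unfolding universal_def
  proof (intro allI impI)
    fix c :: "nat \<times> nat \<Rightarrow> nat \<times> nat \<Rightarrow> color" assume "\<forall>u v. c u v \<in> P"
    then obtain f where f: "realizes (col G) (verts G) L (max n' 1) c f"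
      using G unfolding universal_def by blast
    have sub: "{..<L} \<times> {..<n'} \<subseteq> {..<L} \<times> {..<max n' 1}" by auto
    have "realizes (col G) (verts G) L n' c f"
      using f inj_on_subset[OF _ sub] image_mono[OF sub, of f] unfolding realizes_def
      by (auto simp: less_max_iff_disj)
    then show "\<exists>f. realizes (col G) (verts G) L n' c f \<and> homogeneous_below G n' 0 f"
      by (auto simp: homogeneous_below_def)
  qed
  show ?thesis
  proof (intro exI[of _ "max n' 1"] conjI ballI notI)
    fix G assume "G \<in> \<H>" "universal P G L (max n' 1) 0"
    then show False using no mono n' forbidden_family_digraphs_over(1)[OF F] by blast
  qed simp
qed

section \<open>A quasirandom pattern\<close>

text \<open>The sum over all words is a product of sums over single letters, in which the factors at
  \<open>r\<close> and \<open>s\<close> vanish: distinct positions are independent and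
  \<open>p\<close> has mean zero.\<close>

lemma sum_two_factors:
  fixes p :: "color \<Rightarrow> real" and r s m :: nat
  assumes P: "finite P" and p: "(\<Sum>q\<in>P. p q) = 0" and rs: "r < m" "s < m" "r \<noteq> s"
  shows "(\<Sum>f\<in>({..<m} \<rightarrow>\<^sub>E P). p (f r) * p (f s)) = 0"
proof -
  define g where "g i q = (if i = r \<or> i = s then p q else 1)" for i :: nat and q
  have "p (f r) * p (f s) = (\<Prod>i<m. g i (f i))" for f
  proof -
    have "(\<Prod>i<m. g i (f i)) = (\<Prod>i\<in>{r, s}. g i (f i))"
      using rs by (intro prod.mono_neutral_right) (auto simp: g_def)
    then show ?thesis using rs by (simp add: g_def)
  qed
  then have "(\<Sum>f\<in>({..<m} \<rightarrow>\<^sub>E P). p (f r) * p (f s)) = (\<Prod>i<m. \<Sum>q\<in>P. g i q)"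
    using P by (subst prod_sum_PiE) auto
  also have "\<dots> = 0"
  proof (rule prod_zero)
    show "\<exists>i\<in>{..<m}. (\<Sum>q\<in>P. g i q) = 0" using rs p by (auto simp: g_def intro!: bexI[of _ r])
  qed simp
  finally show ?thesis .
qed

text \<open>A vertex consists of a row and a column of the matrix whose columns are all words of
  length \<open>m\<close> over \<open>P\<close>; distinct rows are uncorrelated, so the second moment method applies.\<close>

lemma quasirandom_pattern:
  fixes P :: "color set" and eps \<eta> :: real and N0 :: nat
  assumes P: "finite P" "P \<noteq> {}" and eps: "eps > 0" and \<eta>: "\<eta> > 0"
  shows "\<exists>n \<ge> N0. \<exists>A. (\<forall>x y. A x y \<in> P) \<and>
    (\<forall>Y\<subseteq>{..<n}. \<forall>Z\<subseteq>{..<n}. \<eta> * real n \<le> real (card Y) \<longrightarrow> \<eta> * real n \<le> real (card Z) \<longrightarrow>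
       (\<forall>q\<in>P. den (\<lambda>x y. of_bool (A x y = q)) Y Z \<ge> 1 / real (card P) - eps))"
proof -
  \<comment> \<open>An error of \<open>eps' * (real n)\<^sup>2\<close> divided by sizes of at least
    \<open>\<eta> * real n\<close> on both sides leaves \<open>eps\<close>.\<close>
  define eps' where "eps' = eps * \<eta>\<^sup>2"
  have eps': "eps' > 0" using eps \<eta> by (simp add: eps'_def)
  \<comment> \<open>The first summand ensures \<open>m * eps'\<^sup>2 \<ge> 1\<close>, which makes
    the diagonal terms of the second moment small enough; the last one ensures
    \<open>n \<ge> N0\<close>.\<close>
  define m where "m = nat \<lceil>1 / eps'\<^sup>2\<rceil> + 1 + N0"
  have m: "real m \<ge> 1 / eps'\<^sup>2" "m \<ge> 1" "m \<ge> N0"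
    unfolding m_def by linarith+
  have m': "1 \<le> real m * eps'\<^sup>2" using m(1) eps' by (simp add: field_simps)
  define W where "W = ({..<m} \<rightarrow>\<^sub>E P)"
  have finW: "finite W" using P by (simp add: W_def finite_PiE)
  define K where "K = card W"
  have K: "K \<ge> 1" using P finW by (auto simp: K_def W_def Suc_le_eq card_gt_0_iff PiE_eq_empty_iff)
  define n where "n = m * K"
  have n: "n \<ge> 1" "real n > 0" using m K by (auto simp: n_def Suc_le_eq)
  have "m * 1 \<le> n" unfolding n_def using K by (intro mult_le_mono) auto
  then have nN0: "n \<ge> N0" using m(3) by simp
  have "finite ({..<m} \<times> W)" "card ({..<m} \<times> W) = n" using finW by (auto simp: n_def K_def)
  then obtain h where h: "bij_betw h {0..<n} ({..<m} \<times> W)" using ex_bij_betw_nat_finite by metis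
  then have h: "bij_betw h {..<n} ({..<m} \<times> W)" by (simp add: lessThan_atLeast0)
  obtain p0 where p0: "p0 \<in> P" using P by auto
  \<comment> \<open>The row is taken from \<open>x\<close> and the column from \<open>y\<close>, so
    the pattern need not be symmetric.\<close>
  define A where "A x y = (if x < n \<and> y < n then snd (h y) (fst (h x)) else p0)" for x y
  have hin: "fst (h x) < m" "snd (h x) \<in> W" if "x < n" for x
    using bij_betwE[OF h] that by (auto simp: mem_Times_iff)
  have AP: "A x y \<in> P" for x y
    using hin[of x] hin[of y] p0 by (auto simp: A_def W_def PiE_iff)
  have "den (\<lambda>x y. of_bool (A x y = q)) Y Z \<ge> 1 / real (card P) - eps"
    if Y: "Y \<subseteq> {..<n}" "\<eta> * real n \<le> real (card Y)" and Z: "Z \<subseteq> {..<n}" "\<eta> * real n \<le> real (card Z)"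
      and q: "q \<in> P" for Y Z q
  proof -
    have finYZ: "finite Y" "finite Z" using Y Z finite_subset by blast+
    have posYZ: "real (card Y) > 0" "real (card Z) > 0"
      using Y(2) Z(2) mult_pos_pos[OF \<eta> n(2)] by linarith+
    define p where "p r = of_bool (r = q) - 1 / real (card P)" for r :: color
    have p0: "(\<Sum>r\<in>P. p r) = 0"
      using P q by (simp add: p_def sum_subtractf Int_absorb1 flip: sum.inter_filter)
    have p1: "\<bar>p r\<bar> \<le> 1" for r
      using P by (auto simp: p_def field_simps of_bool_def card_gt_0_iff Suc_le_eq)
    \<comment> \<open>The deviation of column \<open>f\<close> from uniform density, summed over the
      rows of the vertices in \<open>Y\<close>.\<close>
    define S where "S f = (\<Sum>y\<in>Y. p (f (fst (h y))))" for f
    have corr: "(\<Sum>f\<in>W. p (f r) * p (f s)) \<le> (if r = s then real K else 0)" if "r < m" "s < m" for r s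
    proof (cases "r = s")
      case True
      have "p x * p x \<le> 1" for x using p1[of x] by (metis abs_le_square_iff abs_one power2_eq_square one_power2)
      then have "(\<Sum>f\<in>W. p (f r) * p (f r)) \<le> (\<Sum>f\<in>W. 1)" by (intro sum_mono)
      then show ?thesis using True by (simp add: K_def)
    next
      case False
      then show ?thesis using sum_two_factors[OF P(1) p0 that] by (simp add: W_def)
    qed
    have "(\<Sum>f\<in>W. (S f)\<^sup>2) = (\<Sum>f\<in>W. \<Sum>y\<in>Y. \<Sum>y'\<in>Y. p (f (fst (h y))) * p (f (fst (h y'))))"
      by (simp add: S_def power2_eq_square sum_product)
    also have "\<dots> = (\<Sum>y\<in>Y. \<Sum>y'\<in>Y. \<Sum>f\<in>W. p (f (fst (h y))) * p (f (fst (h y'))))"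
      by (subst sum.swap, rule sum.cong[OF refl], rule sum.swap)
    also have "\<dots> \<le> (\<Sum>y\<in>Y. \<Sum>y'\<in>Y. if fst (h y) = fst (h y') then real K else 0)"
      using Y(1) hin(1) by (intro sum_mono corr) auto
    \<comment> \<open>For fixed \<open>y\<close> only the vertices in the same row count, at most
      one for each of the \<open>K\<close> columns.\<close>
    also have "\<dots> \<le> (\<Sum>y\<in>Y. real K * real K)"
    proof (intro sum_mono)
      fix y assume "y \<in> Y"
      have "card {y' \<in> Y. fst (h y) = fst (h y')} \<le> card W"
      proof (rule card_inj_on_le[of "snd \<circ> h"])
        show "inj_on (snd \<circ> h) {y' \<in> Y. fst (h y) = fst (h y')}"
        proof (rule inj_onI)
          fix a b assume ab: "a \<in> {y' \<in> Y. fst (h y) = fst (h y')}" "b \<in> {y' \<in> Y. fst (h y) = fst (h y')}"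
            "(snd \<circ> h) a = (snd \<circ> h) b"
          then have "h a = h b" by (auto simp: prod_eq_iff)
          then show "a = b" using h ab Y(1) by (auto simp: bij_betw_def dest!: inj_onD)
        qed
      qed (use Y(1) hin finW in auto)
      then show "(\<Sum>y'\<in>Y. if fst (h y) = fst (h y') then real K else 0) \<le> real K * real K"
        using finYZ by (simp add: K_def mult_right_mono flip: sum.inter_filter)
    qed
    also have "\<dots> \<le> real n * (real K * real K)"
      using card_mono[OF _ Y(1)] by (simp add: mult_right_mono)
    finally have S2: "(\<Sum>f\<in>W. (S f)\<^sup>2) \<le> real n * (real K * real K)" .
    \<comment> \<open>Young's inequality takes the place of Cauchy-Schwarz; this
      \<open>\<mu>\<close> makes each of the two resulting terms at most
      \<open>eps' * (real n)\<^sup>2 / 2\<close>.\<close>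
    define \<mu> where "\<mu> = eps' * real n"
    have \<mu>: "\<mu> > 0" using eps' n by (simp add: \<mu>_def)
    have young: "- x \<le> x\<^sup>2 / (2 * \<mu>) + \<mu> / 2" for x :: real
    proof -
      have "0 \<le> (x + \<mu>)\<^sup>2 / (2 * \<mu>)" using \<mu> by simp
      also have "\<dots> = x\<^sup>2 / (2 * \<mu>) + x + \<mu> / 2"
        using \<mu> by (simp add: power2_eq_square field_simps)
      finally show ?thesis by simp
    qed
    have "- (\<Sum>z\<in>Z. S (snd (h z))) = (\<Sum>z\<in>Z. - S (snd (h z)))" by (simp add: sum_negf)
    also have "\<dots> \<le> (\<Sum>z\<in>Z. (S (snd (h z)))\<^sup>2 / (2 * \<mu>) + \<mu> / 2)"
      by (intro sum_mono young)
    \<comment> \<open>The terms are nonnegative, so \<open>Z\<close> may be enlarged to all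
      vertices, among which every column occurs exactly \<open>m\<close> times.\<close>
    also have "\<dots> \<le> (\<Sum>z<n. (S (snd (h z)))\<^sup>2 / (2 * \<mu>) + \<mu> / 2)"
      using Z(1) \<mu> by (intro sum_mono2) auto
    also have "\<dots> = (\<Sum>z<n. (S (snd (h z)))\<^sup>2) / (2 * \<mu>) + real n * \<mu> / 2"
      by (simp add: sum.distrib sum_divide_distrib)
    also have "(\<Sum>z<n. (S (snd (h z)))\<^sup>2) = (\<Sum>w\<in>{..<m} \<times> W. (S (snd w))\<^sup>2)"
      by (rule sum.reindex_bij_betw[OF h])
    also have "\<dots> = (\<Sum>r<m. \<Sum>f\<in>W. (S f)\<^sup>2)"
      by (subst sum.cartesian_product) (simp add: case_prod_beta)
    also have "\<dots> = real m * (\<Sum>f\<in>W. (S f)\<^sup>2)" by simp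
    also have "\<dots> / (2 * \<mu>) + real n * \<mu> / 2 \<le> real m * (real n * (real K * real K)) / (2 * \<mu>) + real n * \<mu> / 2"
      using S2 \<mu> by (intro add_right_mono divide_right_mono mult_left_mono) auto
    also have "\<dots> \<le> eps' * (real n)\<^sup>2"
    proof -
      have "real m * (real n * (real K * real K)) / (2 * \<mu>) = real m * real K * real K / (2 * eps')"
        using n eps' by (simp add: \<mu>_def field_simps)
      also have "\<dots> \<le> (real m * eps'\<^sup>2) * (real m * real K * real K / (2 * eps'))"
        using mult_right_mono[OF m', of "real m * real K * real K / (2 * eps')"] eps' by simp
      also have "\<dots> = eps' * (real n)\<^sup>2 / 2"
        using eps' by (simp add: n_def power2_eq_square field_simps)
      finally show ?thesis using n by (simp add: \<mu>_def power2_eq_square field_simps)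
    qed
    finally have S: "- (\<Sum>z\<in>Z. S (snd (h z))) \<le> eps' * (real n)\<^sup>2" .
    have "eps' * (real n)\<^sup>2 = eps * ((\<eta> * real n) * (\<eta> * real n))"
      by (simp add: eps'_def power2_eq_square)
    also have "\<dots> \<le> eps * (real (card Y) * real (card Z))"
      using eps \<eta> Y(2) Z(2) by (intro mult_left_mono mult_mono) auto
    finally have S': "(\<Sum>z\<in>Z. S (snd (h z))) \<ge> - eps * (real (card Y) * real (card Z))"
      using S by simp
    have "(\<Sum>x\<in>Y. \<Sum>y\<in>Z. of_bool (A x y = q)) = (\<Sum>x\<in>Y. \<Sum>y\<in>Z. p (snd (h y) (fst (h x))) + 1 / real (card P))"
    proof (intro sum.cong refl)
      fix x y assume "x \<in> Y" "y \<in> Z"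
      then have "x < n" "y < n" using Y(1) Z(1) by auto
      then show "of_bool (A x y = q) = p (snd (h y) (fst (h x))) + 1 / real (card P)"
        by (simp add: A_def p_def)
    qed
    also have "\<dots> = (\<Sum>z\<in>Z. S (snd (h z))) + real (card Y) * real (card Z) / real (card P)"
      unfolding S_def by (subst sum.swap) (simp add: sum.distrib)
    also have "\<dots> \<ge> (1 / real (card P) - eps) * (real (card Y) * real (card Z))"
      using S' by (simp add: algebra_simps)
    finally show ?thesis
      using posYZ by (simp add: den_def le_divide_eq)
  qed
  then show ?thesis using nN0 AP by blast
qed

section \<open>Digraphs far from the property\<close>

definition block :: "nat \<Rightarrow> nat \<Rightarrow> nat set" where
  "block q i = {i * q..<i * q + q}"

lemma block_facts [simp]: "finite (block q i)" "card (block q i) = q"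
  by (auto simp: block_def)

lemma block_div: "v \<in> block q i \<Longrightarrow> v div q = i"
  by (auto simp: block_def intro!: div_nat_eqI simp: mult_ac)

lemma block_subset: "i < t \<Longrightarrow> block q i \<subseteq> {..<t * q}"
proof
  fix v assume "i < t" "v \<in> block q i"
  then have "v < Suc i * q" by (simp add: block_def)
  also have "\<dots> \<le> t * q" using \<open>i < t\<close> by (intro mult_right_mono) auto
  finally show "v \<in> {..<t * q}" by simp
qed

lemma block_less: "i < j \<Longrightarrow> v \<in> block q i \<Longrightarrow> w \<in> block q j \<Longrightarrow> v < w"
proof -
  assume *: "i < j" "v \<in> block q i" "w \<in> block q j"
  then have "v < Suc i * q" by (simp add: block_def)
  also have "\<dots> \<le> j * q" using *(1) by (intro mult_right_mono) auto
  also have "\<dots> \<le> w" using *(3) by (simp add: block_def)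
  finally show ?thesis .
qed

text \<open>The sets of changes for different pairs of blocks are disjoint, since
  \<open>div q\<close> recovers the blocks; changes inside a block are not counted.\<close>

lemma block_cyl_le_changes:
  assumes fin: "finite (verts G)" and sub: "{..<t * q} \<subseteq> verts G" and q: "q \<ge> 1"
  shows "cyl (\<lambda>a b. of_bool (col G a b \<noteq> col G' a b)) t (block q) * (real q)\<^sup>2 \<le> real (card (changes G G'))"
proof -
  let ?E = "{(i, j). i < j \<and> j < t}"
  define D where "D e = {(a, b) \<in> block q (fst e) \<times> block q (snd e). col G a b \<noteq> col G' a b}" for e
  have finD: "finite (D e)" for e
    by (rule finite_subset[of _ "block q (fst e) \<times> block q (snd e)"]) (auto simp: D_def)
  have "den (\<lambda>a b. of_bool (col G a b \<noteq> col G' a b)) (block q i) (block q j) * (real q)\<^sup>2 = real (card (D (i, j)))" for i j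
  proof -
    have "D (i, j) = (SIGMA a:block q i. block q j \<inter> {b. col G a b \<noteq> col G' a b})"
      by (auto simp: D_def)
    then have "(\<Sum>a\<in>block q i. \<Sum>b\<in>block q j. of_bool (col G a b \<noteq> col G' a b)) = real (card (D (i, j)))"
      by simp
    then show ?thesis using q by (simp add: den_def power2_eq_square)
  qed
  then have "cyl (\<lambda>a b. of_bool (col G a b \<noteq> col G' a b)) t (block q) * (real q)\<^sup>2 = (\<Sum>e\<in>?E. real (card (D e)))"
    unfolding cyl_def sum_distrib_right by (intro sum.cong) (auto simp: case_prod_beta)
  also have "\<dots> = real (card (Sigma ?E D))"
    using finD by (simp add: card_SigmaI)
  also have "card (Sigma ?E D) \<le> card (changes G G')"
  proof (rule card_inj_on_le[of snd])
    show "inj_on snd (Sigma ?E D)"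
      by (rule inj_onI) (auto simp: D_def dest!: block_div)
    show "snd ` Sigma ?E D \<subseteq> changes G G'"
    proof (rule image_subsetI)
      fix x assume "x \<in> Sigma ?E D"
      then obtain i j a b where ij: "i < j" "j < t" "(a, b) \<in> D (i, j)" and x: "x = ((i, j), a, b)"
        by auto
      then have ab: "a \<in> block q i" "b \<in> block q j" "col G a b \<noteq> col G' a b" by (auto simp: D_def)
      have "a < b" using block_less[OF ij(1) ab(1,2)] .
      moreover have "a \<in> verts G" "b \<in> verts G"
        using ab(1,2) block_subset[of i t q] block_subset[of j t q] ij(1,2) sub by auto
      ultimately show "snd x \<in> changes G G'" using ab(3) by (simp add: x changes_def)
    qed
  qed (use fin in simp)
  finally show ?thesis by simp
qed

lemma card_index_pairs: "2 * real (card {(i, j). i < j \<and> j < (t::nat)}) = real t * (real t - 1)"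
proof -
  have eq: "{(i, j). i < j \<and> j < t} = (\<lambda>(j, i). (i, j)) ` (SIGMA j:{..<t}. {..<j})" by force
  have "card {(i, j). i < j \<and> j < t} = card (SIGMA j:{..<t}. {..<j})"
    unfolding eq by (rule card_image) (auto simp: inj_on_def)
  also have "\<dots> = \<Sum>{..<t}" by simp
  finally have "card {(i, j). i < j \<and> j < t} = \<Sum>{..<t}" .
  moreover have "2 * real (\<Sum>{..<t}) = real t * (real t - 1)"
    by (induction t) (auto simp: algebra_simps)
  ultimately show ?thesis by simp
qed

lemma den_image:
  assumes "inj_on f A" "inj_on g B"
  shows "den w (f ` A) (g ` B) = den (\<lambda>a b. w (f a) (g b)) A B"
  using assms by (simp add: den_def sum.reindex card_image)

lemma den_cong: "(\<And>a b. a \<in> A \<Longrightarrow> b \<in> B \<Longrightarrow> w a b = w' a b) \<Longrightarrow> den w A B = den w' A B"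
  by (simp add: den_def)

lemma den_changed:
  fixes c c' :: "'a \<Rightarrow> 'a \<Rightarrow> color"
  shows "den (\<lambda>a b. of_bool (c a b \<noteq> c' a b)) A B \<ge>
    den (\<lambda>a b. of_bool (c a b = q)) A B - den (\<lambda>a b. of_bool (c' a b = q)) A B"
  unfolding den_def diff_divide_distrib[symmetric] sum_subtractf[symmetric]
  by (intro divide_right_mono sum_mono) auto

text \<open>The host: \<open>t\<close> blocks, with a quasirandom pattern between any two of them. Deleting a colour
  between two large parts of different blocks costs almost the proportion \<open>1 / card P\<close>.\<close>

lemma far_digraph:
  fixes eps :: real
  assumes P: "palette P" "P \<noteq> {}" and F: "forbidden_family P \<H> \<F>" and l: "l \<ge> 1" and n: "n \<ge> 1"
    and nu: "\<forall>G\<in>\<H>. \<not> universal P G (Suc l) n 0"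
    and eps: "0 < eps" "eps < 1" "2 * eps \<le> 1 / real (card P)" and t: "t \<ge> 2" "t \<ge> l"
  shows "\<exists>G\<in>digraphs_over P. card (verts G) \<ge> t \<and> (\<forall>G'\<in>\<H>. verts G' = verts G \<longrightarrow>
    dist_digraph G G' \<ge> (1 / real l - 1 / real t) * (1 / real (card P) - 2 * eps) * (1 - eps))"
proof -
  define k where "k = 1 / real (card P) - 2 * eps"
  have k: "k \<ge> 0" using eps by (simp add: k_def)
  obtain rho_s where rho_s: "shrink_factor eps (Suc l) n t (t * t) rho_s"
    using shrink[of eps "Suc l" n t "t * t"] eps l n by auto
  have rho_s': "0 < rho_s" "rho_s \<le> 1" using shrink_factor_bounds[OF rho_s] by auto
  \<comment> \<open>Only one half of each \<open>Y i\<close> is shrunk, so that the other half keeps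
    the complement large; after rounding, a half is still at least a third.\<close>
  define rho where "rho = rho_s / 3"
  have rho: "0 < rho" "rho \<le> 1" "rho \<le> 1 / 3" using rho_s' by (auto simp: rho_def)
  \<comment> \<open>Turan's theorem bounds from below the number of pairs outside \<open>E'\<close>,
    and each of them contributes at least \<open>k\<close>.\<close>
  define \<beta> where "\<beta> = ((real t)\<^sup>2 / (2 * real l) - real t / 2) * k"
  have "(real t)\<^sup>2 / (2 * real l) - real t / 2 \<ge> 0"
  proof -
    have "real l * real t \<le> real t * real t" using t by (intro mult_right_mono) auto
    then show ?thesis using l by (simp add: field_simps power2_eq_square)
  qed
  then have \<beta>: "\<beta> \<ge> 0" using k by (simp add: \<beta>_def)
  have "0 \<le> 1 - rho ^ t" "1 - rho ^ t < 1"
    using rho by (auto intro: power_le_one)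
  then obtain s where s: "(1 - rho ^ t) ^ s < eps" using real_arch_pow_inv eps(1) by blast
  \<comment> \<open>The smallest proportion of a block that occurs: \<open>s\<close> rounds, then
    one more shrinking inside the last cylinder.\<close>
  define \<eta> where "\<eta> = rho ^ Suc s"
  have \<eta>: "\<eta> > 0" using rho by (simp add: \<eta>_def)
  define N0 where "N0 = nat \<lceil>real n / \<eta>\<rceil> + 1"
  obtain N A where N: "N \<ge> N0" and A: "\<And>x y. A x y \<in> P"
    and quasi: "\<forall>Y\<subseteq>{..<N}. \<forall>Z\<subseteq>{..<N}. \<eta> * real N \<le> real (card Y) \<longrightarrow> \<eta> * real N \<le> real (card Z) \<longrightarrow>
       (\<forall>q\<in>P. den (\<lambda>x y. of_bool (A x y = q)) Y Z \<ge> 1 / real (card P) - eps)"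
    using quasirandom_pattern[OF finite_colors P(2) eps(1) \<eta>, of N0] by blast
  have N1: "N \<ge> 1" using N by (simp add: N0_def)
  have N\<eta>: "real n \<le> \<eta> * real N"
  proof -
    have "real n / \<eta> \<le> real N" using N unfolding N0_def by linarith
    then show ?thesis using \<eta> by (simp add: field_simps)
  qed
  obtain c0 where c0: "c0 \<in> P" using P by auto
  \<comment> \<open>The same matrix serves every pair of blocks, since quasirandomness is only used
    for one pair at a time.\<close>
  define a where "a v w = (if v div N = w div N then c0 else A (v mod N) (w mod N))" for v w
  define G where "G = oriented_by {..<t * N} a"
  have vG: "verts G = {..<t * N}" by (simp add: G_def)
  have G: "G \<in> digraphs_over P"
    unfolding G_def using P(1) c0 A by (intro oriented_by_in_digraphs_over) (auto simp: a_def)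
  have "dist_digraph G G' \<ge> (1 / real l - 1 / real t) * k * (1 - eps)" if G': "G' \<in> \<H>" "verts G' = verts G" for G'
  proof -
    have G'P: "G' \<in> digraphs_over P" using forbidden_family_digraphs_over(1)[OF F G'(1)] .
    obtain c where c: "\<forall>u v. c u v \<in> P" "\<nexists>f. realizes (col G') (verts G') (Suc l) n c f"
      using nu G'(1) unfolding universal_def homogeneous_below_def by auto
    define w :: "nat \<Rightarrow> nat \<Rightarrow> real" where "w = (\<lambda>a b. of_bool (col G a b \<noteq> col G' a b))"
    have "cyl w t (block N) \<ge> \<beta> * (1 - (1 - rho ^ t) ^ s)"
    proof (rule cyl_cover[where m = "rho ^ s * real N" and X = "block N"])
      fix Y assume Y: "\<And>i. i < t \<Longrightarrow> Y i \<subseteq> block N i \<and> rho ^ s * real N \<le> real (card (Y i))"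
      have finY: "finite (Y i)" if "i < t" for i using Y[OF that] by (auto intro: finite_subset)
      have Y3: "3 * real n \<le> rho_s * real (card (Y i))" "card (Y i) \<ge> 2" if "i < t" for i
      proof -
        have "rho * (rho ^ s * real N) \<le> rho * real (card (Y i))"
          using Y[OF that] rho by (intro mult_left_mono) auto
        then have "real n \<le> rho * real (card (Y i))" using N\<eta> by (simp add: \<eta>_def mult_ac)
        then show 1: "3 * real n \<le> rho_s * real (card (Y i))" by (simp add: rho_def)
        have "rho_s * real (card (Y i)) \<le> real (card (Y i))" using rho_s' by (simp add: mult_left_le_one_le)
        then have "3 * real n \<le> real (card (Y i))" using 1 by linarith
        then show "card (Y i) \<ge> 2" using n by linarith
      qed
      define H where "H i = (SOME Q. (\<forall>x<2. Q x \<subseteq> Y i \<and> card (Q x) = card (Y i) div 2) \<and>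
         disjoint_family_on Q {..<(2::nat)})" for i
      have H: "(\<forall>x<2. H i x \<subseteq> Y i \<and> card (H i x) = card (Y i) div 2) \<and> disjoint_family_on (H i) {..<2}"
        if "i < t" for i
        unfolding H_def by (rule someI_ex[OF equal_pieces[OF finY[OF that]]])
      define Y0 Y1 where "Y0 i = H i 0" and "Y1 i = H i 1" for i
      have H': "Y0 i \<subseteq> Y i" "Y1 i \<subseteq> Y i" "Y0 i \<inter> Y1 i = {}"
         "real (card (Y i)) \<le> 3 * real (card (Y0 i))" "card (Y1 i) = card (Y0 i)" if "i < t" for i
      proof -
        show "Y0 i \<subseteq> Y i" "Y1 i \<subseteq> Y i" "card (Y1 i) = card (Y0 i)"
          using H[OF that] by (auto simp: Y0_def Y1_def)
        show "Y0 i \<inter> Y1 i = {}"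
          using H[OF that] unfolding disjoint_family_on_def Y0_def Y1_def by auto
        have "card (Y i) \<le> 3 * (card (Y i) div 2)" using Y3(2)[OF that] by linarith
        then have "real (card (Y i)) \<le> real (3 * (card (Y i) div 2))" by (rule of_nat_mono)
        then show "real (card (Y i)) \<le> 3 * real (card (Y0 i))"
          using H[OF that] by (simp add: Y0_def)
      qed
      let ?E = "{(i, j). i < j \<and> j < t}"
      have "\<exists>Z E'. (\<forall>i<t. Z i \<subseteq> Y0 i \<and> rho_s * real (card (Y0 i)) \<le> real (card (Z i))) \<and> E' \<subseteq> ?E \<and>
        \<not> has_clique (Suc l) t E' \<and> (\<forall>(i, j) \<in> ?E - E'. sparse_pair eps (col G') P (Z i) (Z j))"
      proof (rule shrink_factorD[OF rho_s c])
        show "\<forall>i<t. finite (Y0 i) \<and> Y0 i \<subseteq> verts G' \<and> real n \<le> rho_s * real (card (Y0 i))"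
        proof (intro allI impI conjI)
          fix i assume i: "i < t"
          show "finite (Y0 i)" using H'(1)[OF i] finY[OF i] finite_subset by blast
          show "Y0 i \<subseteq> verts G'" using H'(1)[OF i] Y[OF i] block_subset[OF i, of N] vG G'(2) by auto
          have "rho_s * real (card (Y i)) \<le> rho_s * (3 * real (card (Y0 i)))"
            using H'(4)[OF i] rho_s' by (intro mult_left_mono) auto
          then show "real n \<le> rho_s * real (card (Y0 i))" using Y3(1)[OF i] by linarith
        qed
        show "disjoint_family_on Y0 {..<t}"
          unfolding disjoint_family_on_def
        proof (intro ballI impI)
          fix i j assume ij: "i \<in> {..<t}" "j \<in> {..<t}" "i \<noteq> j"
          then have "Y0 i \<subseteq> block N i" "Y0 j \<subseteq> block N j" using H'(1) Y by blast+
          then show "Y0 i \<inter> Y0 j = {}" using ij(3) block_div by blast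
        qed
        have "card ?E \<le> card ({..<t} \<times> {..<t})" by (rule card_mono) auto
        then show "card ?E \<le> t * t" by simp
      qed simp
      then obtain Z E' where Z: "\<forall>i<t. Z i \<subseteq> Y0 i \<and> rho_s * real (card (Y0 i)) \<le> real (card (Z i))"
        and E': "E' \<subseteq> ?E" "\<not> has_clique (Suc l) t E'"
        and sparse: "\<forall>(i, j) \<in> ?E - E'. sparse_pair eps (col G') P (Z i) (Z j)"
        by (elim exE conjE)
      have Z1: "Z i \<subseteq> Y i \<and> rho * real (card (Y i)) \<le> real (card (Z i)) \<and>
             rho * real (card (Y i)) \<le> real (card (Y i - Z i))" if "i < t" for i
      proof (intro conjI)
        have sub: "Z i \<subseteq> Y0 i" "rho_s * real (card (Y0 i)) \<le> real (card (Z i))" using Z that by blast+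
        show "Z i \<subseteq> Y i" using sub(1) H'(1)[OF that] by blast
        have "rho * real (card (Y i)) \<le> rho * (3 * real (card (Y0 i)))"
          using H'(4)[OF that] rho by (intro mult_left_mono) auto
        also have "\<dots> = rho_s * real (card (Y0 i))" by (simp add: rho_def)
        finally show "rho * real (card (Y i)) \<le> real (card (Z i))" using sub(2) by linarith
        have "card (Y1 i) \<le> card (Y i - Z i)"
          using H'(2,3)[OF that] sub(1) finY[OF that] by (intro card_mono) auto
        moreover have "rho * real (card (Y i)) \<le> 1 / 3 * real (card (Y i))"
          using rho by (intro mult_right_mono) auto
        ultimately show "rho * real (card (Y i)) \<le> real (card (Y i - Z i))"
          using H'(4,5)[OF that] by linarith
      qed
      \<comment> \<open>The missing colour \<open>q\<close> has density at least
        \<open>1 / card P - eps\<close> in the host and at most \<open>eps\<close> in the member;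
        the difference has been changed.\<close>
      have kd: "den w (Z i) (Z j) \<ge> k" if ij: "(i, j) \<in> ?E - E'" for i j
      proof -
        have lt: "i < j" "i < t" "j < t" using ij by auto
        have Zb: "Z i \<subseteq> block N i" "Z j \<subseteq> block N j" using Z1[OF lt(2)] Z1[OF lt(3)] Y[OF lt(2)] Y[OF lt(3)] by auto
        obtain q where q: "q \<in> P" "den (\<lambda>a b. of_bool (col G' a b = q)) (Z i) (Z j) \<le> eps"
          using sparse ij unfolding sparse_pair_def by blast
        let ?m = "\<lambda>v. v mod N"
        have inj: "inj_on ?m (Z r)" if "Z r \<subseteq> block N r" for r
        proof (rule inj_onI)
          fix u v assume "u \<in> Z r" "v \<in> Z r" "u mod N = v mod N"
          moreover from this have "u div N = v div N" using that block_div by blast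
          ultimately show "u = v" by (metis div_mult_mod_eq)
        qed
        have big: "\<eta> * real N \<le> real (card (?m ` Z r))" "?m ` Z r \<subseteq> {..<N}" if r: "r < t" "Z r \<subseteq> block N r" for r
        proof -
          have "rho * (rho ^ s * real N) \<le> rho * real (card (Y r))"
            using Y[OF r(1)] rho by (intro mult_left_mono) auto
          then show "\<eta> * real N \<le> real (card (?m ` Z r))"
            using Z1[OF r(1)] card_image[OF inj[OF r(2)]] by (simp add: \<eta>_def mult_ac)
          show "?m ` Z r \<subseteq> {..<N}" using N1 by auto
        qed
        have "1 / real (card P) - eps \<le> den (\<lambda>x y. of_bool (A x y = q)) (?m ` Z i) (?m ` Z j)"
          using quasi big[OF lt(2) Zb(1)] big[OF lt(3) Zb(2)] q(1) by blast
        also have "\<dots> = den (\<lambda>x y. of_bool (A (x mod N) (y mod N) = q)) (Z i) (Z j)"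
          using inj Zb by (simp add: den_image)
        also have "\<dots> = den (\<lambda>x y. of_bool (col G x y = q)) (Z i) (Z j)"
        proof (rule den_cong)
          fix x y assume xy: "x \<in> Z i" "y \<in> Z j"
          then have "x div N = i" "y div N = j" "x < y"
            using Zb block_div block_less[OF lt(1), of x N y] by blast+
          then show "of_bool (A (x mod N) (y mod N) = q) = (of_bool (col G x y = q) :: real)"
            using lt(1) by (simp add: G_def col_oriented_by a_def)
        qed
        finally show ?thesis
          using den_changed[of "col G" q "Z i" "Z j" "col G'"] q(2) unfolding w_def k_def by linarith
      qed
      have "2 * real l * real (card E') \<le> (real l - 1) * (real t)\<^sup>2"
        using turan_increasing[OF l E'(1)] E'(2) unfolding has_clique_def by blast
      moreover have finE: "finite ?E" by simp
      have diff: "real (card (?E - E')) = real (card ?E) - real (card E')"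
        using E'(1) card_mono[OF finE E'(1)] by (simp add: card_Diff_subset finite_subset[OF E'(1) finE] of_nat_diff)
      have "2 * real l * real (card (?E - E')) = real l * (2 * real (card ?E)) - 2 * real l * real (card E')"
        unfolding diff by (simp add: algebra_simps)
      ultimately have "2 * real l * real (card (?E - E')) \<ge> real l * (real t * (real t - 1)) - (real l - 1) * (real t)\<^sup>2"
        unfolding card_index_pairs by linarith
      also have "real l * (real t * (real t - 1)) - (real l - 1) * (real t)\<^sup>2 = (real t)\<^sup>2 - real l * real t"
        by (simp add: algebra_simps power2_eq_square)
      finally have cnt: "real (card (?E - E')) \<ge> (real t)\<^sup>2 / (2 * real l) - real t / 2"
        using l by (simp add: field_simps power2_eq_square)
      have "\<beta> \<le> real (card (?E - E')) * k"
        unfolding \<beta>_def using cnt k by (rule mult_right_mono)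
      also have "\<dots> \<le> (\<Sum>(i, j)\<in>?E - E'. den w (Z i) (Z j))"
      proof -
        have "(\<Sum>e\<in>?E - E'. k) \<le> (\<Sum>(i, j)\<in>?E - E'. den w (Z i) (Z j))"
          using kd by (intro sum_mono) auto
        then show ?thesis by simp
      qed
      also have "\<dots> \<le> cyl w t Z"
        unfolding cyl_def by (intro sum_mono2 finE) (auto intro!: den_nonneg simp: w_def)
      finally show "\<exists>Z. (\<forall>i<t. Z i \<subseteq> Y i \<and> rho * real (card (Y i)) \<le> real (card (Z i)) \<and>
             rho * real (card (Y i)) \<le> real (card (Y i - Z i))) \<and> cyl w t Z \<ge> \<beta>"
        using Z1 by blast
    next
      show "0 < rho ^ s * real N" using rho N1 by simp
    qed (use rho \<beta> in \<open>auto simp: w_def\<close>)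
    moreover have "\<beta> * (1 - (1 - rho ^ t) ^ s) \<ge> \<beta> * (1 - eps)"
      using s \<beta> by (intro mult_left_mono) auto
    ultimately have "\<beta> * (1 - eps) * (real N)\<^sup>2 \<le> cyl w t (block N) * (real N)\<^sup>2"
      by (intro mult_right_mono) auto
    also have "\<dots> \<le> real (card (changes G G'))"
      unfolding w_def using vG N1 by (intro block_cyl_le_changes) auto
    finally have ch: "\<beta> * (1 - eps) * (real N)\<^sup>2 \<le> real (card (changes G G'))" .
    define M where "M = t * N"
    have M: "M \<ge> 2" using t(1) N1 mult_le_mono[of 2 t 1 N] by (simp add: M_def)
    have bin: "0 < real (M choose 2)" "real (M choose 2) \<le> (real M)\<^sup>2 / 2"
    proof -
      show "0 < real (M choose 2)" using M by simp
      have "M choose 2 \<le> M * M div 2" unfolding choose_two by (intro div_le_mono mult_le_mono) auto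
      then have "real (M choose 2) \<le> real (M * M div 2)" by (rule of_nat_mono)
      also have "\<dots> \<le> real (M * M) / 2" using of_nat_div_le_of_nat[of "M * M" 2] by simp
      finally show "real (M choose 2) \<le> (real M)\<^sup>2 / 2" by (simp add: power2_eq_square)
    qed
    have pos: "\<beta> * (1 - eps) * (real N)\<^sup>2 \<ge> 0" using \<beta> eps by simp
    have "(1 / real l - 1 / real t) * k * (1 - eps) = \<beta> * (1 - eps) * (real N)\<^sup>2 / ((real M)\<^sup>2 / 2)"
      using t N1 l by (simp add: \<beta>_def M_def power2_eq_square field_simps)
    also have "\<dots> \<le> \<beta> * (1 - eps) * (real N)\<^sup>2 / real (M choose 2)"
      using pos bin by (intro divide_left_mono) auto
    also have "\<dots> \<le> real (card (changes G G')) / real (M choose 2)"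
      using ch by (intro divide_right_mono) auto
    also have "\<dots> = dist_digraph G G'"
      using dist_digraph_eq[OF G G'P G'(2)] by (simp add: vG M_def)
    finally show ?thesis .
  qed
  moreover have "card (verts G) \<ge> t" using N1 by (simp add: vG)
  ultimately show ?thesis using G unfolding k_def by blast
qed

section \<open>Blow-ups and the limit\<close>

lemma sorted_enumeration:
  assumes "finite (V :: nat set)"
  shows "\<exists>e. bij_betw e {..<card V} V \<and> (\<forall>a b. a < b \<and> b < card V \<longrightarrow> e a < e b)"
proof -
  let ?e = "\<lambda>a. sorted_list_of_set V ! a"
  have len: "length (sorted_list_of_set V) = card V" by simp
  have mono: "?e a < ?e b" if "a < b" "b < card V" for a b
    using sorted_wrt_nth_less[OF strict_sorted_list_of_set, of a b V] that len by simp
  have "bij_betw ?e {..<card V} V"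
    using bij_betw_nth[OF distinct_sorted_list_of_set, of "{..<card V}" V] len assms by simp
  then show ?thesis using mono by blast
qed

lemma den_singleton: "den w {a} {b} = w a b"
  by (simp add: den_def)

text \<open>Averaging over the transversals of the blocks: on some transversal the number of changes
  is at most \<open>1 / q\<^sup>2\<close> times the number between blocks, and pulling
  \<open>B'\<close> back along it gives a member on the vertices of \<open>G\<close>.\<close>

lemma blowup:
  assumes P: "palette P" "P \<noteq> {}" and F: "forbidden_family P \<H> \<F>" and G: "G \<in> digraphs_over P"
    and N: "card (verts G) = N" "1 \<le> N" "N \<le> M"
  shows "\<exists>B\<in>digraphs_over P. verts B = {..<M} \<and> (\<forall>B'\<in>\<H>. verts B' = verts B \<longrightarrow>
    (\<exists>G'\<in>\<H>. verts G' = verts G \<and>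
       real (card (changes G G')) * (real (M div N))\<^sup>2 \<le> real (card (changes B B'))))"
proof -
  define q where "q = M div N"
  have q: "q \<ge> 1" "N * q \<le> M" using N by (auto simp: q_def div_greater_zero_iff Suc_le_eq)
  have finG: "finite (verts G)" using digraphs_over_D(1)[OF G] .
  \<comment> \<open>The enumeration is increasing so that the order of the blocks agrees with the
    order of the vertices of \<open>G\<close>; both \<open>changes\<close> and
    \<open>oriented_by\<close> look at increasing pairs.\<close>
  obtain e where e: "bij_betw e {..<N} (verts G)" "\<And>a b. a < b \<Longrightarrow> b < N \<Longrightarrow> e a < e b"
    using sorted_enumeration[OF finG] N(1) by blast
  have ein: "e i \<in> verts G" if "i < N" for i using bij_betwE[OF e(1)] that by auto
  have einj: "e i \<noteq> e j" if "i < N" "j < N" "i \<noteq> j" for i j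
    using that e(1) by (auto simp: bij_betw_def dest: inj_onD)
  obtain c0 where c0: "c0 \<in> P" using P by auto
  \<comment> \<open>\<open>mod N\<close> also places the vertices left over when \<open>N\<close>
    does not divide \<open>M\<close>.\<close>
  define blk where "blk v = (v div q) mod N" for v
  define a where "a v w = (if blk v = blk w then c0 else col G (e (blk v)) (e (blk w)))" for v w
  define B where "B = oriented_by {..<M} a"
  have blkN: "blk v < N" for v using N(2) by (simp add: blk_def)
  have B: "B \<in> digraphs_over P"
    unfolding B_def
  proof (rule oriented_by_in_digraphs_over[OF P(1)])
    fix v w
    show "a v w \<in> P"
      using c0 digraphs_over_D(3)[OF G ein[OF blkN] ein[OF blkN] einj[OF blkN blkN]] by (simp add: a_def)
  qed simp
  have vB: "verts B = {..<M}" by (simp add: B_def)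
  have "\<exists>G'\<in>\<H>. verts G' = verts G \<and> real (card (changes G G')) * (real q)\<^sup>2 \<le> real (card (changes B B'))"
    if B': "B' \<in> \<H>" "verts B' = verts B" for B'
  proof -
    define w :: "nat \<Rightarrow> nat \<Rightarrow> real" where "w = (\<lambda>a b. of_bool (col B a b \<noteq> col B' a b))"
    have "\<exists>u. (\<forall>i<N. u i \<in> block q i) \<and> cyl w N (\<lambda>i. {u i}) \<le> cyl w N (block q)"
      using q(1) by (intro cyl_transversal) (auto simp: block_def)
    then obtain u where u: "\<And>i. i < N \<Longrightarrow> u i \<in> block q i" "cyl w N (\<lambda>i. {u i}) \<le> cyl w N (block q)"
      by blast
    have uM: "u i < M" if "i < N" for i
      using block_subset[OF that, of q] u(1)[OF that] q(2) by auto
    have ublk: "blk (u i) = i" if "i < N" for i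
      using block_div[OF u(1)[OF that]] that by (simp add: blk_def)
    have uless: "u i < u j" if "i < j" "j < N" for i j
      using block_less[OF that(1) u(1) u(1)] that by simp
    define d where "d = inv_into {..<N} e"
    have d: "d v < N" "e (d v) = v" if "v \<in> verts G" for v
    proof -
      have "v \<in> e ` {..<N}" using that e(1) by (simp add: bij_betw_def)
      then show "d v < N" "e (d v) = v"
        using inv_into_into[of v e "{..<N}"] f_inv_into_f[of v e "{..<N}"] by (simp_all add: d_def)
    qed
    define G' where "G' = Digraph (verts G) (\<lambda>v z. col B' (u (d v)) (u (d z)))"
    have "G' \<in> \<H>"
      unfolding G'_def
    proof (rule pullback_in_property[OF F B'(1) finG, of "\<lambda>v. u (d v)"])
      show "inj_on (\<lambda>v. u (d v)) (verts G)"
      proof (rule inj_onI)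
        fix v z assume vz: "v \<in> verts G" "z \<in> verts G" "u (d v) = u (d z)"
        then have "d v = d z" using ublk[OF d(1)[OF vz(1)]] ublk[OF d(1)[OF vz(2)]] by metis
        then show "v = z" using d(2)[OF vz(1)] d(2)[OF vz(2)] by metis
      qed
      show "(\<lambda>v. u (d v)) ` verts G \<subseteq> verts B'"
        using uM d(1) by (auto simp: B'(2) vB)
    qed
    have "card (changes G G') \<le> card {(i, j). (i < j \<and> j < N) \<and> col B (u i) (u j) \<noteq> col B' (u i) (u j)}"
    proof (rule card_inj_on_le[of "\<lambda>(v, z). (d v, d z)"])
      show "inj_on (\<lambda>(v, z). (d v, d z)) (changes G G')"
        by (rule inj_onI) (auto simp: changes_def, (metis d(2))+)
      show "(\<lambda>(v, z). (d v, d z)) ` changes G G' \<subseteq>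
          {(i, j). (i < j \<and> j < N) \<and> col B (u i) (u j) \<noteq> col B' (u i) (u j)}"
      proof clarify
        fix v z assume "(v, z) \<in> changes G G'"
        then have vz: "v \<in> verts G" "z \<in> verts G" "v < z" "col G v z \<noteq> col B' (u (d v)) (u (d z))"
          by (auto simp: changes_def G'_def)
        have lt: "d v < d z"
        proof (rule ccontr)
          assume "\<not> d v < d z"
          then have "e (d z) \<le> e (d v)"
            using e(2)[of "d z" "d v"] d(1)[OF vz(1)] by (cases "d z = d v") auto
          then show False using d(2) vz by simp
        qed
        have "col B (u (d v)) (u (d z)) = col G v z"
          using uless[OF lt d(1)[OF vz(2)]] lt ublk[OF d(1)[OF vz(1)]] ublk[OF d(1)[OF vz(2)]] d(2) vz
          by (simp add: B_def col_oriented_by a_def)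
        then show "(d v < d z \<and> d z < N) \<and> col B (u (d v)) (u (d z)) \<noteq> col B' (u (d v)) (u (d z))"
          using lt d(1)[OF vz(2)] vz(4) by simp
      qed
      show "finite {(i, j). (i < j \<and> j < N) \<and> col B (u i) (u j) \<noteq> col B' (u i) (u j)}"
        by (rule finite_subset[OF _ finite_index_pairs[of N]]) auto
    qed
    moreover have "cyl w N (\<lambda>i. {u i}) = real (card {(i, j). (i < j \<and> j < N) \<and> col B (u i) (u j) \<noteq> col B' (u i) (u j)})"
    proof -
      have "cyl w N (\<lambda>i. {u i}) = (\<Sum>e\<in>{(i, j). i < j \<and> j < N}. of_bool (col B (u (fst e)) (u (snd e)) \<noteq> col B' (u (fst e)) (u (snd e))))"
        by (simp add: cyl_def den_singleton w_def case_prod_beta)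
      also have "\<dots> = real (card ({(i, j). i < j \<and> j < N} \<inter> {e. col B (u (fst e)) (u (snd e)) \<noteq> col B' (u (fst e)) (u (snd e))}))"
        by simp
      also have "{(i, j). i < j \<and> j < N} \<inter> {e. col B (u (fst e)) (u (snd e)) \<noteq> col B' (u (fst e)) (u (snd e))} =
        {(i, j). (i < j \<and> j < N) \<and> col B (u i) (u j) \<noteq> col B' (u i) (u j)}" by auto
      finally show ?thesis .
    qed
    ultimately have "real (card (changes G G')) \<le> cyl w N (block q)" using u(2) by linarith
    then have "real (card (changes G G')) * (real q)\<^sup>2 \<le> cyl w N (block q) * (real q)\<^sup>2"
      by (rule mult_right_mono) simp
    also have "\<dots> \<le> real (card (changes B B'))"
      unfolding w_def using vB q by (intro block_cyl_le_changes) auto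
    finally have "real (card (changes G G')) * (real q)\<^sup>2 \<le> real (card (changes B B'))" .
    moreover have "verts G' = verts G" by (simp add: G'_def)
    ultimately show ?thesis using \<open>G' \<in> \<H>\<close> by blast
  qed
  then show ?thesis using B vB unfolding q_def by blast
qed

text \<open>One change in \<open>G\<close> accounts for \<open>(M div N)\<^sup>2\<close> changes in
  the blow-up; the binomial coefficients convert both counts into distances.\<close>

definition blowup_factor :: "nat \<Rightarrow> nat \<Rightarrow> real" where
  "blowup_factor N M = (real (M div N))\<^sup>2 * real (N choose 2) / real (M choose 2)"

lemma real_choose_two: "real (n choose 2) = real n * (real n - 1) / 2"
proof -
  have "even (n * (n - 1))" by (cases n) auto
  then have "2 * (n choose 2) = n * (n - 1)" unfolding choose_two by (rule dvd_mult_div_cancel)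
  then have "2 * real (n choose 2) = real (n * (n - 1))" by (metis of_nat_mult of_nat_numeral)
  then show ?thesis by (cases n) (auto simp: algebra_simps)
qed

lemma dist_n_blowup:
  assumes P: "palette P" "P \<noteq> {}" and F: "forbidden_family P \<H> \<F>" and G: "G \<in> digraphs_over P"
    and N: "card (verts G) = N" "2 \<le> N" "N \<le> M"
  shows "ereal (blowup_factor N M) * dist_property G \<H> \<le> dist_n P \<H> M"
proof -
  obtain B where B: "B \<in> digraphs_over P" "verts B = {..<M}" and blow: "\<And>B'. B' \<in> \<H> \<Longrightarrow> verts B' = verts B \<Longrightarrow>
    \<exists>G'\<in>\<H>. verts G' = verts G \<and> real (card (changes G G')) * (real (M div N))\<^sup>2 \<le> real (card (changes B B'))"
    using blowup[OF P F G N(1) _ N(3)] N(2) by auto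
  have "ereal (blowup_factor N M) * dist_property G \<H> \<le> ereal (dist_digraph B B')"
    if B': "B' \<in> \<H>" "verts B' = verts B" for B'
  proof -
    obtain G' where G': "G' \<in> \<H>" "verts G' = verts G"
      "real (card (changes G G')) * (real (M div N))\<^sup>2 \<le> real (card (changes B B'))"
      using blow[OF B'] by blast
    have "real (N choose 2) > 0" using N by (simp add: real_choose_two)
    then have "blowup_factor N M * dist_digraph G G' =
       real (card (changes G G')) * (real (M div N))\<^sup>2 / real (M choose 2)"
      using dist_digraph_eq[OF G forbidden_family_digraphs_over(1)[OF F G'(1)] G'(2)] N(1)
      by (simp add: blowup_factor_def)
    also have "\<dots> \<le> real (card (changes B B')) / real (M choose 2)"
      using G'(3) by (rule divide_right_mono) simp
    also have "\<dots> = dist_digraph B B'"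
      using dist_digraph_eq[OF B(1) forbidden_family_digraphs_over(1)[OF F B'(1)] B'(2)] B(2) by simp
    finally have le: "blowup_factor N M * dist_digraph G G' \<le> dist_digraph B B'" .
    have "dist_property G \<H> \<le> ereal (dist_digraph G G')"
      unfolding dist_property_def using G' by (intro INF_lower) auto
    then have "ereal (blowup_factor N M) * dist_property G \<H> \<le> ereal (blowup_factor N M) * ereal (dist_digraph G G')"
      by (intro ereal_mult_left_mono) (auto simp: blowup_factor_def)
    also have "\<dots> \<le> ereal (dist_digraph B B')" using le by simp
    finally show ?thesis .
  qed
  then have "ereal (blowup_factor N M) * dist_property G \<H> \<le> dist_property B \<H>"
    unfolding dist_property_def[of B] by (intro INF_greatest) auto
  also have "\<dots> \<le> dist_n P \<H> M"
    unfolding dist_n_def using B by (intro SUP_upper) auto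
  finally show ?thesis .
qed

lemma div_over_tendsto:
  assumes "N \<ge> 1"
  shows "(\<lambda>M. real (M div N) / real M) \<longlonglongrightarrow> 1 / real N"
proof (rule tendsto_sandwich)
  show "\<forall>\<^sub>F M in sequentially. 1 / real N - 1 / real M \<le> real (M div N) / real M"
    using eventually_gt_at_top[of 0]
  proof eventually_elim
    case (elim M)
    have "M < (M div N + 1) * N" using assms
      by (metis add.commute dividend_less_div_times less_le_trans less_one linorder_not_le mult.commute mult_Suc_right plus_1_eq_Suc)
    then have "real M \<le> (real (M div N) + 1) * real N"
      by (metis less_imp_le of_nat_1 of_nat_add of_nat_le_iff of_nat_mult)
    then have "real M * real M \<le> real M * ((real (M div N) + 1) * real N)"
      by (rule mult_left_mono) simp
    then show ?case using elim assms by (simp add: field_simps)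
  qed
  show "\<forall>\<^sub>F M in sequentially. real (M div N) / real M \<le> 1 / real N"
    using eventually_gt_at_top[of 0]
  proof eventually_elim
    case (elim M)
    have "real (M div N) \<le> real M / real N" by (rule of_nat_div_le_of_nat)
    then show ?case using elim assms by (simp add: field_simps)
  qed
  have "(\<lambda>M. 1 / real N - 1 / real M) \<longlonglongrightarrow> 1 / real N - 0"
    by (intro tendsto_diff tendsto_const lim_1_over_n)
  then show "(\<lambda>M. 1 / real N - 1 / real M) \<longlonglongrightarrow> 1 / real N" by simp
qed simp

lemma ratio_tendsto_1: "(\<lambda>M. real M / (real M - 1)) \<longlonglongrightarrow> 1"
proof -
  have "(\<lambda>M. 1 / (1 - 1 / real M)) \<longlonglongrightarrow> 1 / (1 - 0)"
    by (intro tendsto_divide tendsto_diff tendsto_const lim_1_over_n) auto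
  moreover have "\<forall>\<^sub>F M in sequentially. 1 / (1 - 1 / real M) = real M / (real M - 1)"
    using eventually_gt_at_top[of 1] by eventually_elim (simp add: field_simps)
  ultimately show ?thesis by (simp add: tendsto_cong)
qed

lemma blowup_factor_tendsto:
  assumes "N \<ge> 2"
  shows "blowup_factor N \<longlonglongrightarrow> 1 - 1 / real N"
proof -
  have "(\<lambda>M. (real (M div N) / real M)\<^sup>2 * (real N * (real N - 1)) * (real M / (real M - 1)))
     \<longlonglongrightarrow> (1 / real N)\<^sup>2 * (real N * (real N - 1)) * 1"
    using assms by (intro tendsto_mult tendsto_power tendsto_const div_over_tendsto ratio_tendsto_1) auto
  moreover have "(1 / real N)\<^sup>2 * (real N * (real N - 1)) * 1 = 1 - 1 / real N"
    using assms by (simp add: power2_eq_square field_simps)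
  moreover have "\<forall>\<^sub>F M in sequentially. (real (M div N) / real M)\<^sup>2 * (real N * (real N - 1)) * (real M / (real M - 1)) = blowup_factor N M"
    using eventually_gt_at_top[of 1]
    by eventually_elim (simp add: blowup_factor_def real_choose_two power2_eq_square field_simps)
  ultimately show ?thesis by (simp add: tendsto_cong)
qed

section \<open>Existence of the limit\<close>

lemma exists_digraph:
  assumes "palette P" "P \<noteq> {}"
  shows "\<exists>G\<in>digraphs_over P. card (verts G) = n"
proof -
  obtain c where "c \<in> P" using assms by auto
  then have "oriented_by {..<n} (\<lambda>_ _. c) \<in> digraphs_over P"
    using assms by (intro oriented_by_in_digraphs_over) auto
  then show ?thesis by (intro bexI) auto
qed

lemma dist_n_nonneg:
  assumes "palette P" "P \<noteq> {}"
  shows "0 \<le> dist_n P \<H> n"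
proof -
  obtain G where G: "G \<in> digraphs_over P" "card (verts G) = n" using exists_digraph[OF assms] by blast
  have "0 \<le> dist_property G \<H>"
    unfolding dist_property_def by (intro INF_greatest) (auto simp: dist_digraph_def)
  also have "\<dots> \<le> dist_n P \<H> n" unfolding dist_n_def using G by (intro SUP_upper) auto
  finally show ?thesis .
qed

text \<open>With \<open>d n\<close> the maximal distance on \<open>n\<close> vertices, blowing up gives
  \<open>liminf d \<ge> (1 - 1 / N) * d N\<close> for every \<open>N\<close>, so that \<open>d\<close> tends to the supremum of
  the right-hand sides.\<close>

lemma dist_n_tendsto:
  assumes P: "palette P" "P \<noteq> {}" and F: "forbidden_family P \<H> \<F>"
  shows "dist_n P \<H> \<longlonglongrightarrow> (SUP N\<in>{2..}. ereal (1 - 1 / real N) * dist_n P \<H> N)"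
    (is "_ \<longlonglongrightarrow> ?S")
proof (rule order_tendstoI)
  fix y assume "y < ?S"
  then obtain N where N: "N \<ge> 2" "y < ereal (1 - 1 / real N) * dist_n P \<H> N"
    by (auto simp: less_SUP_iff)
  have pos: "1 - 1 / real N > 0" using N(1) by simp
  \<comment> \<open>Blowing up needs a single digraph. As the supremum may be infinite, it is found
    by dividing the opposite inequalities by the positive factor.\<close>
  obtain G where G: "G \<in> digraphs_over P" "card (verts G) = N" "y < ereal (1 - 1 / real N) * dist_property G \<H>"
  proof (rule ccontr)
    assume "\<not> thesis"
    then have *: "ereal (1 - 1 / real N) * dist_property G \<H> \<le> y" if "G \<in> digraphs_over P" "card (verts G) = N" for G
      using that not_le \<open>\<And>G. \<lbrakk>G \<in> digraphs_over P; card (verts G) = N; y < ereal (1 - 1 / real N) * dist_property G \<H>\<rbrakk> \<Longrightarrow> thesis\<close> by blast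
    have "dist_n P \<H> N \<le> y / ereal (1 - 1 / real N)"
      unfolding dist_n_def using * pos by (intro SUP_least) (auto simp: ereal_le_divide_pos)
    then have "ereal (1 - 1 / real N) * dist_n P \<H> N \<le> y" using pos by (simp add: ereal_le_divide_pos)
    then show False using N(2) by simp
  qed
  have "(\<lambda>M. ereal (blowup_factor N M) * dist_property G \<H>) \<longlonglongrightarrow> ereal (1 - 1 / real N) * dist_property G \<H>"
    unfolding mult.commute[of _ "dist_property G \<H>"]
    using pos by (intro tendsto_cmult_ereal_not_0 tendsto_ereal blowup_factor_tendsto N(1)) auto
  then have "\<forall>\<^sub>F M in sequentially. y < ereal (blowup_factor N M) * dist_property G \<H>"
    using G(3) by (rule order_tendstoD(1))
  then show "\<forall>\<^sub>F M in sequentially. y < dist_n P \<H> M"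
    using eventually_ge_at_top[of N]
    by eventually_elim (use dist_n_blowup[OF P F G(1,2) N(1)] in \<open>blast intro: less_le_trans\<close>)
next
  fix y assume y: "?S < y"
  \<comment> \<open>Nonnegativity excludes \<open>-\<infinity>\<close> and \<open>y\<close> excludes
    \<open>\<infinity>\<close>, so the supremum is a real number.\<close>
  have "0 \<le> ereal (1 - 1 / real 2) * dist_n P \<H> 2" using dist_n_nonneg[OF P] by simp
  also have "\<dots> \<le> ?S" by (intro SUP_upper) auto
  finally have "0 \<le> ?S" .
  then obtain r where r: "?S = ereal r" using y by (cases ?S) auto
  have "(\<lambda>M. ereal (r * (real M / (real M - 1)))) \<longlonglongrightarrow> ereal (r * 1)"
    by (intro tendsto_intros ratio_tendsto_1)
  then have "\<forall>\<^sub>F M in sequentially. ereal (r * (real M / (real M - 1))) < y"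
    using y r by (auto intro!: order_tendstoD(2))
  then show "\<forall>\<^sub>F M in sequentially. dist_n P \<H> M < y"
    using eventually_ge_at_top[of 2]
  proof eventually_elim
    case (elim M)
    have pos: "1 - 1 / real M > 0" using elim by simp
    have "ereal (1 - 1 / real M) * dist_n P \<H> M \<le> ereal r"
      using elim unfolding r[symmetric] by (intro SUP_upper) auto
    then have "dist_n P \<H> M \<le> ereal r / ereal (1 - 1 / real M)"
      by (subst ereal_le_divide_pos) (use pos in auto)
    also have "\<dots> = ereal (r * (real M / (real M - 1)))"
      using elim pos by (simp add: field_simps)
    finally show ?case using elim by simp
  qed
qed

lemma dist_lim_tendsto:
  assumes "palette P" "P \<noteq> {}" "forbidden_family P \<H> \<F>"
  shows "dist_n P \<H> \<longlonglongrightarrow> dist_lim P \<H>"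
  using limI[OF dist_n_tendsto[OF assms]] dist_n_tendsto[OF assms] unfolding dist_lim_def by simp

lemma dist_lim_nonneg:
  assumes "palette P" "P \<noteq> {}" "forbidden_family P \<H> \<F>"
  shows "0 \<le> dist_lim P \<H>"
  by (rule LIMSEQ_le_const[OF dist_lim_tendsto[OF assms]]) (use dist_n_nonneg[OF assms(1,2)] in blast)

lemma dist_lim_upper:
  assumes "palette P" "P \<noteq> {}" "forbidden_family P \<H> \<F>"
    and "\<And>n. n \<ge> 2 \<Longrightarrow> dist_n P \<H> n \<le> b"
  shows "dist_lim P \<H> \<le> b"
  by (rule LIMSEQ_le_const2[OF dist_lim_tendsto[OF assms(1-3)]]) (use assms(4) in blast)

text \<open>The limit is itself a supremum over all sizes, so a single digraph bounds it from below,
  at the cost of the factor lost in blowing up.\<close>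

lemma dist_lim_lower:
  assumes "palette P" "P \<noteq> {}" "forbidden_family P \<H> \<F>"
    and G: "G \<in> digraphs_over P" "card (verts G) \<ge> 2"
  shows "ereal (1 - 1 / real (card (verts G))) * dist_property G \<H> \<le> dist_lim P \<H>"
proof -
  let ?N = "card (verts G)"
  have "ereal (1 - 1 / real ?N) * dist_property G \<H> \<le> ereal (1 - 1 / real ?N) * dist_n P \<H> ?N"
    unfolding dist_n_def using G by (intro ereal_mult_left_mono SUP_upper) auto
  also have "\<dots> \<le> (SUP N\<in>{2..}. ereal (1 - 1 / real N) * dist_n P \<H> N)"
    using G by (intro SUP_upper) auto
  also have "\<dots> = dist_lim P \<H>"
    using limI[OF dist_n_tendsto[OF assms(1-3)]] by (simp add: dist_lim_def)
  finally show ?thesis .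
qed

section \<open>Editing into the property\<close>

definition same_class :: "nat set \<Rightarrow> (nat \<Rightarrow> nat) \<Rightarrow> (nat \<times> nat) set" where
  "same_class V cls = {(v, w). v \<in> V \<and> w \<in> V \<and> v < w \<and> cls v = cls w}"

text \<open>Within a residue class the quotient by \<open>l\<close> is injective with values up to
  \<open>(card V - 1) div l\<close>, so a vertex shares its class with at most that many others.
  Hence the proportion \<open>1 / l\<close> holds without an error term.\<close>

lemma card_same_class:
  assumes V: "finite V" and e: "bij_betw e V {0..<card V}" and l: "l \<ge> 1"
  shows "2 * real l * real (card (same_class V (\<lambda>v. e v mod l))) \<le> real (card V) * (real (card V) - 1)"
proof -
  let ?n = "card V" and ?W = "same_class V (\<lambda>v. e v mod l)"
  define D where "D v = {w \<in> V. w \<noteq> v \<and> e w mod l = e v mod l}" for v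
  have card_D: "real l * real (card (D v)) \<le> real ?n - 1" if v: "v \<in> V" for v
  proof -
    have n: "?n \<ge> 1" using v V by (auto simp: Suc_le_eq card_gt_0_iff)
    have inj: "inj_on (\<lambda>w. e w div l) (insert v (D v))"
    proof (rule inj_onI)
      fix x y assume xy: "x \<in> insert v (D v)" "y \<in> insert v (D v)" "e x div l = e y div l"
      then have "e x mod l = e y mod l" by (auto simp: D_def)
      then have "e x = e y" using xy(3) by (metis div_mult_mod_eq)
      moreover have "x \<in> V" "y \<in> V" using xy v by (auto simp: D_def)
      ultimately show "x = y" using e by (auto simp: bij_betw_def dest: inj_onD)
    qed
    have "(\<lambda>w. e w div l) ` insert v (D v) \<subseteq> {..(?n - 1) div l}"
    proof (rule image_subsetI)
      fix x assume "x \<in> insert v (D v)"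
      then have "x \<in> V" using v by (auto simp: D_def)
      then have "e x < ?n" using bij_betwE[OF e] by auto
      then have "e x \<le> ?n - 1" by simp
      then show "e x div l \<in> {..(?n - 1) div l}" by (simp add: div_le_mono)
    qed
    then have "card (insert v (D v)) \<le> Suc ((?n - 1) div l)"
      using card_inj_on_le[OF inj] by (metis card_atMost finite_atMost)
    moreover have "card (insert v (D v)) = Suc (card (D v))"
      using V by (subst card_insert_disjoint) (auto simp: D_def)
    ultimately have "card (D v) \<le> (?n - 1) div l" by simp
    then have "l * card (D v) \<le> l * ((?n - 1) div l)" by simp
    also have "\<dots> \<le> ?n - 1" by simp
    finally have "real (l * card (D v)) \<le> real (?n - 1)" by (rule of_nat_mono)
    then show ?thesis using n by (simp add: of_nat_diff)
  qed
  have finW: "finite ?W" using V by (auto simp: same_class_def intro: finite_subset[of _ "V \<times> V"])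
  have "card ?W + card (prod.swap ` ?W) = card (?W \<union> prod.swap ` ?W)"
    using finW by (intro card_Un_disjoint[symmetric]) (auto simp: same_class_def)
  also have "\<dots> \<le> card (Sigma V D)"
    using V by (intro card_mono) (auto simp: same_class_def D_def)
  also have "card (Sigma V D) = (\<Sum>v\<in>V. card (D v))"
    using V by (intro card_SigmaI) (auto simp: D_def)
  finally have "2 * card ?W \<le> (\<Sum>v\<in>V. card (D v))" by (simp add: card_image)
  then have "2 * real (card ?W) \<le> real (\<Sum>v\<in>V. card (D v))" by linarith
  then have "real l * (2 * real (card ?W)) \<le> real l * real (\<Sum>v\<in>V. card (D v))"
    by (rule mult_left_mono) simp
  also have "\<dots> = (\<Sum>v\<in>V. real l * real (card (D v)))" by (simp add: sum_distrib_left)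
  also have "\<dots> \<le> real ?n * (real ?n - 1)"
    using sum_bounded_above[of V "\<lambda>v. real l * real (card (D v))", OF card_D] by simp
  finally show ?thesis by simp
qed

lemma splits_into_preimage:
  assumes "\<And>j. j < a \<Longrightarrow> Q {v \<in> S. h v = b + j}" and "\<And>v. v \<in> S \<Longrightarrow> b \<le> h v \<and> h v < b + a"
  shows "splits_into Q a S"
  unfolding splits_into_def
proof (intro exI[of _ "\<lambda>j. {v \<in> S. h v = b + j}"] conjI allI impI)
  show "S = (\<Union>j<a. {v \<in> S. h v = b + j})"
  proof
    show "S \<subseteq> (\<Union>j<a. {v \<in> S. h v = b + j})"
    proof
      fix v assume v: "v \<in> S"
      then have "h v - b < a" "h v = b + (h v - b)" using assms(2)[OF v] by auto
      then show "v \<in> (\<Union>j<a. {v \<in> S. h v = b + j})" using v by blast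
    qed
  qed auto
qed (use assms(1) in \<open>auto simp: disjoint_family_on_def\<close>)

text \<open>The classes of the images of its vertices would split a surviving forbidden copy as weak
  goodness describes: in the first and last kind of class the offending colour has been replaced,
  and in the middle kind all single arcs follow the order of the labels or, for
  \<open>dir = Backward\<close>, its reverse, so they form no cycle. The final clause serves the
  tournament bound.\<close>

lemma edited_in_property:
  fixes cls :: "nat \<Rightarrow> nat"
  assumes P: "palette P" and F: "forbidden_family P \<H> \<F>" and G: "G \<in> digraphs_over P"
    and notgood: "\<not> weakly_good \<F> (a0, a1, a2)" and cls: "\<And>v. v \<in> verts G \<Longrightarrow> cls v < a0 + a1 + a2"
    and r0: "r0 \<in> P" "r0 \<noteq> Nonedge" and r2: "r2 \<in> P" "r2 \<noteq> Bidir" and dir: "dir \<in> {Backward, Forward}"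
  shows "\<exists>G'\<in>\<H>. verts G' = verts G \<and> changes G G' \<subseteq> same_class (verts G) cls \<and>
    (\<forall>(v, w)\<in>changes G G'. a0 \<le> cls v \<and> cls v < a0 + a1 \<longrightarrow> col G v w \<noteq> dir)"
proof -
  define edit where "edit i q = (if i < a0 then (if q = Nonedge then r0 else q)
     else if i < a0 + a1 then (if q \<in> {Backward, Forward} then dir else q)
     else (if q = Bidir then r2 else q))" for i q
  define a where "a v w = (if cls v = cls w then edit (cls v) (col G v w) else col G v w)" for v w
  define G' where "G' = oriented_by (verts G) a"
  have "edit i q \<in> P" if "q \<in> P" for i q
    using that r0 r2 dir P by (auto simp: edit_def palette_def)
  then have G': "G' \<in> digraphs_over P"
    unfolding G'_def using digraphs_over_D(1,3)[OF G]
    by (intro oriented_by_in_digraphs_over P) (auto simp: a_def)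
  have "G' \<in> \<H>"
  proof (rule member_if_no_copy[OF F G'])
    fix H f
    assume H: "H \<in> \<F>" and f: "inj_on f (verts H)" "f ` verts H \<subseteq> verts G'"
      and copy: "\<And>v w. v \<in> verts H \<Longrightarrow> w \<in> verts H \<Longrightarrow> v \<noteq> w \<Longrightarrow> col G' (f v) (f w) = col H v w"
    have fV: "f v \<in> verts G" if "v \<in> verts H" for v using f(2) that by (auto simp: G'_def)
    have colH: "\<exists>q. col H v w = (if f v < f w then edit (cls (f v)) q else conv (edit (cls (f v)) q))"
      if "v \<in> verts H" "w \<in> verts H" "v \<noteq> w" "cls (f v) = cls (f w)" for v w
    proof (intro exI)
      show "col H v w = (if f v < f w
          then edit (cls (f v)) (if f v < f w then col G (f v) (f w) else col G (f w) (f v))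
          else conv (edit (cls (f v)) (if f v < f w then col G (f v) (f w) else col G (f w) (f v))))"
        using copy[OF that(1-3)] that(4) by (cases "f v < f w") (simp_all add: G'_def col_oriented_by a_def)
    qed
    define h where "h v = cls (f v)" for v
    let ?S0 = "{v \<in> verts H. h v < a0}" and ?S1 = "{v \<in> verts H. a0 \<le> h v \<and> h v < a0 + a1}"
      and ?S2 = "{v \<in> verts H. a0 + a1 \<le> h v}"
    have e0: "edit i q \<noteq> Nonedge" "conv (edit i q) \<noteq> Nonedge" if "i < a0" for i q
      using that r0 by (cases q; cases r0; auto simp: edit_def)+
    have e2: "edit i q \<noteq> Bidir" "conv (edit i q) \<noteq> Bidir" if "a0 + a1 \<le> i" for i q
      using that r2 by (cases q; cases r2; auto simp: edit_def)+
    have "splits_into (avoids_color Nonedge H) a0 ?S0"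
    proof (rule splits_into_preimage[where b = 0 and h = h])
      fix j assume "j < a0"
      then show "avoids_color Nonedge H {v \<in> ?S0. h v = 0 + j}"
        unfolding avoids_color_def using colH e0 by (auto simp: h_def) (metis e0)
    qed auto
    moreover have "splits_into (avoids_color Bidir H) a2 ?S2"
    proof (rule splits_into_preimage[where b = "a0 + a1" and h = h])
      fix j assume "j < a2"
      then show "avoids_color Bidir H {v \<in> ?S2. h v = a0 + a1 + j}"
        unfolding avoids_color_def using colH e2 by (auto simp: h_def) (metis e2 le_add1)
    qed (use cls fV in \<open>auto simp: h_def\<close>)
    moreover have "splits_into (acyclic_part H) a1 ?S1"
    proof (rule splits_into_preimage[where b = a0 and h = h])
      fix j assume j: "j < a1"
      let ?X = "{v \<in> ?S1. h v = a0 + j}"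
      have order: "(f v < f w \<longleftrightarrow> dir = Forward)" if "(v, w) \<in> dir_arcs H ?X" for v w
      proof -
        have vw: "v \<in> verts H" "w \<in> verts H" "v \<noteq> w" "h v = a0 + j" "h w = a0 + j" "col H v w = Forward"
          using that by (auto simp: dir_arcs_def)
        have "cls (f v) = cls (f w)" using vw(4,5) by (simp add: h_def)
        note same = colH[OF vw(1-3) this]
        have "cls (f v) = a0 + j" using vw(4) by (simp add: h_def)
        from same[unfolded this vw(6)] obtain q
          where q: "Forward = (if f v < f w then edit (a0 + j) q else conv (edit (a0 + j) q))" ..
        have "edit (a0 + j) q = dir \<or> edit (a0 + j) q \<in> {Nonedge, Bidir}"
          using j by (cases q) (auto simp: edit_def)
        then show ?thesis using q dir by (auto split: if_splits)
      qed
      have neq: "f v \<noteq> f w" if "(v, w) \<in> dir_arcs H ?X" for v w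
        using that f(1) by (auto simp: dir_arcs_def dest: inj_onD)
      show "acyclic_part H ?X"
      proof (cases "dir = Forward")
        case True
        then have "dir_arcs H ?X \<subseteq> measure f" using order by auto
        then show ?thesis unfolding acyclic_part_def by (meson acyclic_subset wf_acyclic wf_measure)
      next
        case False
        have "dir_arcs H ?X \<subseteq> (measure f)\<inverse>"
        proof (rule subrelI)
          fix v w assume vw: "(v, w) \<in> dir_arcs H ?X"
          have "f w < f v" using order[OF vw] neq[OF vw] False by linarith
          then show "(v, w) \<in> (measure f)\<inverse>" by simp
        qed
        then show ?thesis unfolding acyclic_part_def
          by (meson acyclic_subset acyclic_converse wf_acyclic wf_measure)
      qed
    qed auto
    moreover have "verts H = ?S0 \<union> ?S1 \<union> ?S2" by auto
    moreover have "?S0 \<inter> ?S1 = {}" "?S0 \<inter> ?S2 = {}" "?S1 \<inter> ?S2 = {}" by auto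
    ultimately have "weakly_good \<F> (a0, a1, a2)"
      unfolding weakly_good_def case_prod_conv using H by blast
    then show False using notgood by simp
  qed
  moreover have "changes G G' \<subseteq> same_class (verts G) cls"
    by (auto simp: changes_def same_class_def G'_def col_oriented_by a_def split: if_splits)
  moreover have "\<forall>(v, w)\<in>changes G G'. a0 \<le> cls v \<and> cls v < a0 + a1 \<longrightarrow> col G v w \<noteq> dir"
    using dir by (auto simp: changes_def G'_def col_oriented_by a_def edit_def split: if_splits)
  moreover have "verts G' = verts G" by (simp add: G'_def)
  ultimately show ?thesis by blast
qed

section \<open>Chromatic numbers\<close>

lemma splits_into_cong:
  assumes "\<And>X. X \<subseteq> S \<Longrightarrow> Q X \<longleftrightarrow> Q' X"
  shows "splits_into Q a S \<longleftrightarrow> splits_into Q' a S"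
proof -
  have "(S = (\<Union>j<a. V j) \<and> disjoint_family_on V {..<a} \<and> (\<forall>j<a. Q (V j))) \<longleftrightarrow>
    (S = (\<Union>j<a. V j) \<and> disjoint_family_on V {..<a} \<and> (\<forall>j<a. Q' (V j)))" for V :: "nat \<Rightarrow> nat set"
    using assms by (metis (no_types, lifting) UN_upper lessThan_iff)
  then show ?thesis unfolding splits_into_def by simp
qed

lemma splits_into_0: "splits_into Q 0 S \<longleftrightarrow> S = {}"
  by (auto simp: splits_into_def disjoint_family_on_def)

text \<open>For arcs from \<open>a\<close> to \<open>b\<close> to \<open>c\<close>, acyclicity rules
  out the arc from \<open>c\<close> to \<open>a\<close>, and a tournament then has the one from
  \<open>a\<close> to \<open>c\<close>. Conversely a transitive relation is its own transitive
  closure, so irreflexivity excludes cycles.\<close>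

lemma acyclic_iff_transitive:
  assumes H: "H \<in> digraphs_over P" and X: "X \<subseteq> verts H" and P: "P = {Backward, Forward}"
  shows "acyclic_part H X \<longleftrightarrow> transitive_tournament H X"
proof -
  let ?R = "dir_arcs H X"
  have col: "col H v w \<in> {Backward, Forward}" "col H w v = conv (col H v w)" if "v \<in> X" "w \<in> X" "v \<noteq> w" for v w
    using digraphs_over_D(2,3)[OF H, of v w] that X P by auto
  have irr: "(v, v) \<notin> ?R" for v by (simp add: dir_arcs_def)
  have total: "(v, w) \<in> ?R \<or> (w, v) \<in> ?R" if "v \<in> X" "w \<in> X" "v \<noteq> w" for v w
    using col[OF that] that by (auto simp: dir_arcs_def)
  show ?thesis
  proof
    assume "acyclic_part H X"
    then have ac: "acyclic ?R" by (simp add: acyclic_part_def)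
    have "trans ?R"
    proof (rule transI)
      fix a b c assume abc: "(a, b) \<in> ?R" "(b, c) \<in> ?R"
      then have ac': "(a, c) \<in> ?R\<^sup>+" by (meson trancl.r_into_trancl trancl_into_trancl)
      have "a \<in> X" "c \<in> X" using abc by (auto simp: dir_arcs_def)
      moreover have "a \<noteq> c" using ac ac' by (auto simp: acyclic_def)
      moreover have "(c, a) \<notin> ?R"
        using ac trancl_into_trancl[OF ac', of a] by (auto simp: acyclic_def)
      ultimately show "(a, c) \<in> ?R" using total by blast
    qed
    then show "transitive_tournament H X"
      using col(1) unfolding transitive_tournament_def by blast
  next
    assume "transitive_tournament H X"
    then have "trans ?R" by (simp add: transitive_tournament_def)
    then show "acyclic_part H X"
      using irr by (simp add: acyclic_part_def acyclic_def)
  qed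
qed

text \<open>Admissible triples have the form \<open>(0, a1, 0)\<close>, and in a tournament the
  acyclic parts are the transitive ones.\<close>

lemma chi_tournament:
  assumes F: "forbidden_family P \<H> \<F>" and P: "P = {Backward, Forward}"
  shows "chi_wk P \<F> = chi_st P \<F>"
proof -
  have "weakly_good \<F> (0, a1, 0) \<longleftrightarrow> strongly_good \<F> (0, a1, 0)" for a1
  proof -
    have "splits_into (acyclic_part H) a1 S \<longleftrightarrow> splits_into (transitive_tournament H) a1 S"
      if "H \<in> \<F>" "S \<subseteq> verts H" for H S
      using acyclic_iff_transitive[OF forbidden_family_digraphs_over(2)[OF F that(1)] _ P] that(2)
      by (intro splits_into_cong) blast
    then show ?thesis unfolding weakly_good_def strongly_good_def case_prod_conv splits_into_0
      by (intro bex_cong refl ex_cong1) auto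
  qed
  then have "weak_spectrum P \<F> = strong_spectrum P \<F>"
    unfolding weak_spectrum_def strong_spectrum_def by (auto simp: admissible_def P)
  then show ?thesis by (simp add: chi_wk_def chi_st_def)
qed

text \<open>With two symmetric colours, avoiding one means having the other throughout, so the weak
  triple \<open>(a, 0, b)\<close> becomes the strong triple \<open>(b, 0, a)\<close>; exchanging the
  outer entries keeps the sum.\<close>

lemma chi_undirected:
  assumes F: "forbidden_family P \<H> \<F>" and P: "P = {Nonedge, Bidir}"
  shows "chi_wk P \<F> = chi_st P \<F>"
proof -
  have eq: "weakly_good \<F> (a, 0, b) \<longleftrightarrow> strongly_good \<F> (b, 0, a)" for a b
  proof -
    have col: "col H v w \<in> {Nonedge, Bidir}" if "H \<in> \<F>" "v \<in> verts H" "w \<in> verts H" "v \<noteq> w" for H v w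
      using digraphs_over_D(3)[OF forbidden_family_digraphs_over(2)[OF F that(1)] that(2-4)] P by simp
    have 1: "splits_into (avoids_color Nonedge H) n S \<longleftrightarrow> splits_into (all_color Bidir H) n S"
      and 2: "splits_into (avoids_color Bidir H) n S \<longleftrightarrow> splits_into (all_color Nonedge H) n S"
      if "H \<in> \<F>" "S \<subseteq> verts H" for H S n
    proof -
      have "avoids_color Nonedge H X \<longleftrightarrow> all_color Bidir H X" "avoids_color Bidir H X \<longleftrightarrow> all_color Nonedge H X"
        if "X \<subseteq> S" for X
        unfolding avoids_color_def all_color_def
        using col[OF \<open>H \<in> \<F>\<close>] that \<open>S \<subseteq> verts H\<close> by (metis color.distinct(1) empty_iff insertE subsetD)+
      then show "splits_into (avoids_color Nonedge H) n S \<longleftrightarrow> splits_into (all_color Bidir H) n S"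
        "splits_into (avoids_color Bidir H) n S \<longleftrightarrow> splits_into (all_color Nonedge H) n S"
        by (intro splits_into_cong; blast)+
    qed
    show ?thesis
    proof
      assume "weakly_good \<F> (a, 0, b)"
      then obtain H S0 S2 where "H \<in> \<F>" "verts H = S0 \<union> S2" "S0 \<inter> S2 = {}"
        "splits_into (avoids_color Nonedge H) a S0" "splits_into (avoids_color Bidir H) b S2"
        unfolding weakly_good_def case_prod_conv splits_into_0 by auto
      then show "strongly_good \<F> (b, 0, a)"
        unfolding strongly_good_def case_prod_conv splits_into_0
        using 1[of H S0 a] 2[of H S2 b]
        by (intro bexI[of _ H] exI[of _ S2] exI[of _ "{}"] exI[of _ S0]) auto
    next
      assume "strongly_good \<F> (b, 0, a)"
      then obtain H S0 S2 where "H \<in> \<F>" "verts H = S0 \<union> S2" "S0 \<inter> S2 = {}"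
        "splits_into (all_color Nonedge H) b S0" "splits_into (all_color Bidir H) a S2"
        unfolding strongly_good_def case_prod_conv splits_into_0 by auto
      then show "weakly_good \<F> (a, 0, b)"
        unfolding weakly_good_def case_prod_conv splits_into_0
        using 1[of H S2 a] 2[of H S0 b]
        by (intro bexI[of _ H] exI[of _ S2] exI[of _ "{}"] exI[of _ S0]) auto
    qed
  qed
  let ?sw = "\<lambda>(a0, a1, a2). (a2, a1, a0) :: nat \<times> nat \<times> nat"
  have "strong_spectrum P \<F> = ?sw ` weak_spectrum P \<F>"
  proof (intro set_eqI iffI)
    fix x assume x: "x \<in> strong_spectrum P \<F>"
    obtain a0 a1 a2 where x_eq: "x = (a0, a1, a2)" by (cases x)
    then have "(a2, a1, a0) \<in> weak_spectrum P \<F>"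
      using x eq[of a2 a0] by (auto simp: strong_spectrum_def weak_spectrum_def admissible_def P)
    then show "x \<in> ?sw ` weak_spectrum P \<F>" by (intro image_eqI) (auto simp: x_eq)
  next
    fix x assume "x \<in> ?sw ` weak_spectrum P \<F>"
    then obtain a0 a1 a2 where "(a0, a1, a2) \<in> weak_spectrum P \<F>" "x = (a2, a1, a0)" by auto
    then show "x \<in> strong_spectrum P \<F>"
      using eq[of a0 a2] by (auto simp: strong_spectrum_def weak_spectrum_def admissible_def P)
  qed
  then have "chi_st P \<F> = (SUP x\<in>weak_spectrum P \<F>. (case ?sw x of (a0, a1, a2) \<Rightarrow> enat (a0 + a1 + a2 + 1)))"
    unfolding chi_st_def by (simp add: image_image)
  also have "\<dots> = chi_wk P \<F>"
    unfolding chi_wk_def by (intro SUP_cong refl) (auto simp: add_ac)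
  finally show ?thesis by simp
qed

text \<open>In the application \<open>m x\<close> is the number of parts belonging to a triple \<open>x\<close> of the spectrum \<open>T\<close>.\<close>

lemma chi_upper_bound:
  fixes m :: "'a \<Rightarrow> nat" and D :: ereal and r :: real
  assumes r: "r > 0" and D: "\<And>x. x \<in> T \<Longrightarrow> m x \<ge> 1 \<Longrightarrow> D \<le> ereal (1 / (r * real (m x)))"
  shows "D \<le> 1 / (ereal r * ereal_of_enat ((SUP x\<in>T. enat (m x + 1)) - 1))"
proof (cases "(SUP x\<in>T. enat (m x + 1))")
  case infinity
  \<comment> \<open>Arbitrarily large values \<open>m x\<close> push \<open>D\<close> below every
    positive \<open>e\<close>.\<close>
  have "D \<le> 0"
  proof (rule ereal_le_epsilon2)
    fix e :: real assume e: "0 < e"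
    obtain N :: nat where N: "1 / (r * e) < real N" using reals_Archimedean2 by blast
    have "\<exists>x\<in>T. m x \<ge> Suc N"
    proof (rule ccontr)
      assume "\<not> ?thesis"
      then have "enat (m x + 1) \<le> enat (N + 1)" if "x \<in> T" for x
        using that by (simp add: not_less_eq_eq)
      then have "(SUP x\<in>T. enat (m x + 1)) \<le> enat (N + 1)" by (intro SUP_least)
      then show False using infinity by simp
    qed
    then obtain x where x: "x \<in> T" "m x \<ge> Suc N" by blast
    then have mx: "real (m x) > real N" by simp
    then have "1 / (r * e) < real (m x)" using N by linarith
    then have "1 / (r * real (m x)) \<le> e" using e r mx by (simp add: field_simps)
    then show "D \<le> 0 + ereal e" using D[OF x(1)] x(2) by (metis Suc_leD add_0 add_leE ereal_less_eq(3) le_add2 order_trans plus_1_eq_Suc)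
  qed
  then show ?thesis using infinity r by simp
next
  case (enat c)
  show ?thesis
  proof (cases "c \<le> 1")
    \<comment> \<open>The truncated difference is 0 here, so the right-hand side is
      \<open>\<infinity>\<close>.\<close>
    case True
    then show ?thesis using enat by (simp add: one_enat_def divide_ereal_def flip: zero_ereal_def)
  next
    case False
    have "\<exists>x\<in>T. m x + 1 \<ge> c"
    proof (rule ccontr)
      assume "\<not> ?thesis"
      then have "enat (m x + 1) \<le> enat (c - 1)" if "x \<in> T" for x using that by force
      then have "(SUP x\<in>T. enat (m x + 1)) \<le> enat (c - 1)" by (intro SUP_least)
      then show False using enat False by simp
    qed
    then obtain x where x: "x \<in> T" "m x + 1 \<ge> c" by blast
    have "enat (m x + 1) \<le> enat c" unfolding enat[symmetric] using x(1) by (rule SUP_upper)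
    then have "m x = c - 1" using x by simp
    then show ?thesis
      using D[OF x(1)] enat False r by (simp add: one_enat_def one_ereal_def)
  qed
qed

text \<open>If the supremum is a finite \<open>c\<close>, every \<open>m x\<close> is at most
  \<open>c - 1\<close>, so the hypothesis applies with \<open>l = c - 1\<close>; for
  \<open>l = 0\<close> it demands \<open>D = \<infinity>\<close>, in agreement with
  \<open>1 / 0\<close>.\<close>

lemma chi_lower_bound:
  fixes m :: "'a \<Rightarrow> nat" and D :: ereal and r :: real
  assumes r: "r > 0" and D: "D \<ge> 0" "\<And>l. (\<And>x. x \<in> T \<Longrightarrow> m x \<noteq> Suc l) \<Longrightarrow> D \<ge> 1 / ereal (r * real l)"
  shows "1 / (ereal r * ereal_of_enat ((SUP x\<in>T. enat (m x + 1)) - 1)) \<le> D"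
proof (cases "(SUP x\<in>T. enat (m x + 1))")
  case infinity
  then show ?thesis using r D(1) by simp
next
  case (enat c)
  have "m x \<noteq> Suc (c - 1)" if "x \<in> T" for x
  proof -
    have "enat (m x + 1) \<le> enat c" unfolding enat[symmetric] using that by (rule SUP_upper)
    then show ?thesis by simp
  qed
  then show ?thesis using D(2)[of "c - 1"] enat by (simp add: one_enat_def)
qed

section \<open>The bounds\<close>

lemma two_colors:
  assumes "card (P :: color set) \<ge> 2"
  shows "\<exists>r\<in>P. r \<noteq> q"
proof (rule ccontr)
  assume "\<not> ?thesis"
  then have "P \<subseteq> {q}" by blast
  then have "card P \<le> card {q}" by (intro card_mono) auto
  then show False using assms by simp
qed

lemma dist_digraph_le_of_changes:
  assumes F: "forbidden_family P \<H> \<F>" and G: "G \<in> digraphs_over P" and G': "G' \<in> \<H>" "verts G' = verts G"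
    and n: "card (verts G) \<ge> 2" and r: "r > 0"
    and ch: "2 * r * real (card (changes G G')) \<le> real (card (verts G)) * (real (card (verts G)) - 1)"
  shows "dist_property G \<H> \<le> ereal (1 / r)"
proof -
  let ?n = "real (card (verts G))"
  have pos: "?n * (?n - 1) > 0" using n by simp
  have "dist_digraph G G' = real (card (changes G G')) / (?n * (?n - 1) / 2)"
    using dist_digraph_eq[OF G forbidden_family_digraphs_over(1)[OF F G'(1)] G'(2)]
    by (simp add: real_choose_two)
  also have "\<dots> \<le> 1 / r"
    using pos r ch by (simp add: field_simps)
  finally have "ereal (dist_digraph G G') \<le> ereal (1 / r)" by simp
  moreover have "dist_property G \<H> \<le> ereal (dist_digraph G G')"
    unfolding dist_property_def using G' by (intro INF_lower) auto
  ultimately show ?thesis by (rule order_trans[rotated])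
qed

lemma dist_lim_le_weak:
  assumes P: "palette P" "card P \<ge> 2" and F: "forbidden_family P \<H> \<F>"
    and x: "(a0, a1, a2) \<in> weak_spectrum P \<F>" and l: "a0 + a1 + a2 \<ge> 1"
  shows "dist_lim P \<H> \<le> ereal (1 / real (a0 + a1 + a2))"
proof (rule dist_lim_upper[OF P(1) _ F])
  show "P \<noteq> {}" using P(2) by auto
  fix n :: nat assume n: "n \<ge> 2"
  let ?l = "a0 + a1 + a2"
  obtain r0 r2 where r: "r0 \<in> P" "r0 \<noteq> Nonedge" "r2 \<in> P" "r2 \<noteq> Bidir"
    using two_colors[OF P(2)] by meson
  have ng: "\<not> weakly_good \<F> (a0, a1, a2)" using x by (simp add: weak_spectrum_def)
  show "dist_n P \<H> n \<le> ereal (1 / real ?l)"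
    unfolding dist_n_def
  proof (rule SUP_least)
    fix G assume "G \<in> {G \<in> digraphs_over P. card (verts G) = n}"
    then have G: "G \<in> digraphs_over P" "card (verts G) = n" by auto
    have fin: "finite (verts G)" using digraphs_over_D(1)[OF G(1)] .
    obtain e where e: "bij_betw e (verts G) {0..<card (verts G)}"
      using ex_bij_betw_finite_nat[OF fin] by blast
    let ?cls = "\<lambda>v. e v mod ?l"
    have "?cls v < ?l" for v by (rule mod_less_divisor) (use l in linarith)
    then obtain G' where G': "G' \<in> \<H>" "verts G' = verts G" "changes G G' \<subseteq> same_class (verts G) ?cls"
      using edited_in_property[OF P(1) F G(1) ng _ r, of ?cls Forward] by blast
    have "finite (same_class (verts G) ?cls)"
      using fin by (auto simp: same_class_def intro: finite_subset[of _ "verts G \<times> verts G"])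
    then have "card (changes G G') \<le> card (same_class (verts G) ?cls)"
      using G'(3) by (rule card_mono)
    then have "2 * real ?l * real (card (changes G G')) \<le> 2 * real ?l * real (card (same_class (verts G) ?cls))"
      by (intro mult_left_mono) auto
    also have "\<dots> \<le> real (card (verts G)) * (real (card (verts G)) - 1)"
      by (rule card_same_class[OF fin e l])
    finally show "dist_property G \<H> \<le> ereal (1 / real ?l)"
      using G n l by (intro dist_digraph_le_of_changes[OF F G(1) G'(1,2)]) auto
  qed
qed

text \<open>In a tournament the two orders of the vertices reverse complementary sets of arcs.\<close>

lemma dist_lim_le_tournament:
  assumes P: "P = {Backward, Forward}" and F: "forbidden_family P \<H> \<F>"
    and x: "(a0, a1, a2) \<in> weak_spectrum P \<F>" and l: "a0 + a1 + a2 \<ge> 1"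
  shows "dist_lim P \<H> \<le> ereal (1 / (2 * real (a0 + a1 + a2)))"
proof (rule dist_lim_upper[OF _ _ F])
  show pal: "palette P" and "P \<noteq> {}" by (auto simp: P palette_def)
  fix n :: nat assume n: "n \<ge> 2"
  have a: "a0 = 0" "a2 = 0" using x by (auto simp: weak_spectrum_def admissible_def P)
  have a1: "a1 \<ge> 1" using l a by simp
  have r: "Forward \<in> P" "Forward \<noteq> Nonedge" "Forward \<in> P" "Forward \<noteq> Bidir" by (auto simp: P)
  have ng: "\<not> weakly_good \<F> (0, a1, 0)" using x a by (simp add: weak_spectrum_def)
  show "dist_n P \<H> n \<le> ereal (1 / (2 * real (a0 + a1 + a2)))"
    unfolding dist_n_def
  proof (rule SUP_least)
    fix G assume "G \<in> {G \<in> digraphs_over P. card (verts G) = n}"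
    then have G: "G \<in> digraphs_over P" "card (verts G) = n" by auto
    have fin: "finite (verts G)" using digraphs_over_D(1)[OF G(1)] .
    obtain e where e: "bij_betw e (verts G) {0..<card (verts G)}"
      using ex_bij_betw_finite_nat[OF fin] by blast
    let ?cls = "\<lambda>v. e v mod a1"
    have cls: "?cls v < 0 + a1 + 0" for v using a1 by simp
    have edit: "\<exists>G'\<in>\<H>. verts G' = verts G \<and> changes G G' \<subseteq> same_class (verts G) ?cls \<and>
      (\<forall>(v, w)\<in>changes G G'. col G v w \<noteq> dir)" if "dir \<in> {Backward, Forward}" for dir
      using edited_in_property[OF pal F G(1) ng _ r that, of ?cls] cls by simp
    obtain G1 where G1: "G1 \<in> \<H>" "verts G1 = verts G" "changes G G1 \<subseteq> same_class (verts G) ?cls"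
      "\<forall>(v, w)\<in>changes G G1. col G v w \<noteq> Forward"
      using edit[of Forward] by blast
    obtain G2 where G2: "G2 \<in> \<H>" "verts G2 = verts G" "changes G G2 \<subseteq> same_class (verts G) ?cls"
      "\<forall>(v, w)\<in>changes G G2. col G v w \<noteq> Backward"
      using edit[of Backward] by blast
    have finW: "finite (same_class (verts G) ?cls)"
      using fin by (auto simp: same_class_def intro: finite_subset[of _ "verts G \<times> verts G"])
    have colP: "col G v w = Backward \<or> col G v w = Forward" if "(v, w) \<in> changes G G1" for v w
      using digraphs_over_D(3)[OF G(1), of v w] that by (auto simp: changes_def P)
    have "changes G G1 \<inter> changes G G2 = {}"
      using G1(4) G2(4) colP by fastforce
    then have "card (changes G G1) + card (changes G G2) = card (changes G G1 \<union> changes G G2)"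
      using fin by (simp add: card_Un_disjoint)
    also have "\<dots> \<le> card (same_class (verts G) ?cls)"
      using G1(3) G2(3) finW by (intro card_mono) auto
    finally have "real (card (changes G G1)) + real (card (changes G G2)) \<le> real (card (same_class (verts G) ?cls))"
      by linarith
    then have "2 * real a1 * (real (card (changes G G1)) + real (card (changes G G2))) \<le>
       2 * real a1 * real (card (same_class (verts G) ?cls))"
      by (intro mult_left_mono) auto
    also have "\<dots> \<le> real (card (verts G)) * (real (card (verts G)) - 1)"
      by (rule card_same_class[OF fin e a1])
    finally have sum: "2 * real a1 * real (card (changes G G1)) + 2 * real a1 * real (card (changes G G2))
       \<le> real (card (verts G)) * (real (card (verts G)) - 1)" by (simp add: distrib_left)
    then consider "2 * (2 * real a1) * real (card (changes G G1)) \<le> real (card (verts G)) * (real (card (verts G)) - 1)"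
      | "2 * (2 * real a1) * real (card (changes G G2)) \<le> real (card (verts G)) * (real (card (verts G)) - 1)"
      by linarith
    then have "dist_property G \<H> \<le> ereal (1 / (2 * real a1))"
    proof cases
      case 1
      then show ?thesis
        using G n a1 by (intro dist_digraph_le_of_changes[OF F G(1) G1(1,2)]) auto
    next
      case 2
      then show ?thesis
        using G n a1 by (intro dist_digraph_le_of_changes[OF F G(1) G2(1,2)]) auto
    qed
    then show "dist_property G \<H> \<le> ereal (1 / (2 * real (a0 + a1 + a2)))" using a by simp
  qed
qed

text \<open>A pattern with a single part prescribes no colours and is realised by any
  \<open>n\<close> vertices. So members have fewer than \<open>n\<close> vertices, and on
  \<open>n + 2\<close> vertices the infimum runs over the empty set.\<close>

lemma dist_lim_infinite:
  assumes P: "palette P" "P \<noteq> {}" and F: "forbidden_family P \<H> \<F>"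
    and nu: "\<forall>G\<in>\<H>. \<not> universal P G (Suc 0) n 0"
  shows "dist_lim P \<H> = \<infinity>"
proof -
  have small: "card (verts G) < n" if G: "G \<in> \<H>" for G
  proof (rule ccontr)
    assume "\<not> card (verts G) < n"
    moreover obtain e where e: "bij_betw e {0..<card (verts G)} (verts G)"
      using ex_bij_betw_nat_finite digraphs_over_D(1)[OF forbidden_family_digraphs_over(1)[OF F G]] by blast
    ultimately have "inj_on (\<lambda>v :: nat \<times> nat. e (snd v)) ({..<Suc 0} \<times> {..<n})"
      "(\<lambda>v. e (snd v)) ` ({..<Suc 0} \<times> {..<n}) \<subseteq> verts G"
      by (auto simp: bij_betw_def inj_on_def image_subset_iff)
    then have "universal P G (Suc 0) n 0"
      unfolding universal_def realizes_def homogeneous_below_def by auto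
    then show False using nu G by blast
  qed
  obtain G where G: "G \<in> digraphs_over P" "card (verts G) = n + 2" using exists_digraph[OF P] by blast
  have "G' \<notin> \<H>" if "verts G' = verts G" for G' using small[of G'] that G(2) by auto
  then have "{G' \<in> \<H>. verts G' = verts G} = {}" by blast
  then have "dist_property G \<H> = \<infinity>" unfolding dist_property_def by (simp only:) (simp add: top_ereal_def)
  then have "ereal (1 - 1 / real (n + 2)) * \<infinity> \<le> dist_lim P \<H>"
    using dist_lim_lower[OF P F G(1)] G(2) by simp
  moreover have "1 - 1 / real (n + 2) > 0" by simp
  ultimately show ?thesis by (simp del: of_nat_add)
qed

text \<open>For \<open>l = 0\<close> the distance is infinite. Otherwise \<open>eps = 1 / i\<close>
  and \<open>t = i\<close> are coupled, so that one limit in \<open>i\<close> removes all error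
  terms.\<close>

lemma dist_lim_ge_strong:
  assumes P: "palette P" "P \<noteq> {}" and F: "forbidden_family P \<H> \<F>"
    and good: "\<And>a0 a1 a2. (a0, a1, a2) \<in> strong_spectrum P \<F> \<Longrightarrow> a0 + a1 + a2 \<noteq> Suc l"
  shows "1 / ereal (real (card P) * real l) \<le> dist_lim P \<H>"
proof -
  have "strongly_good \<F> (a0, a1, a2)" if "admissible P (a0, a1, a2)" "a0 + a1 + a2 = Suc l" for a0 a1 a2
    using good[of a0 a1 a2] that by (auto simp: strong_spectrum_def)
  then obtain n where n: "n \<ge> 1" "\<forall>G\<in>\<H>. \<not> universal P G (Suc l) n 0"
    using not_universal[OF P F, of "Suc l"] by auto
  show ?thesis
  proof (cases "l = 0")
    case True
    then show ?thesis using dist_lim_infinite[OF P F] n(2) by simp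
  next
    case False
    define k where "k = real (card P)"
    have k: "k > 0" using P(2) by (simp add: k_def card_gt_0_iff)
    have l: "real l > 0" using False by simp
    \<comment> \<open>The leading factor is the loss in \<open>dist_lim_lower\<close>; the rest is
      the bound of \<open>far_digraph\<close>.\<close>
    define b where "b i = (1 - 1 / real i) * ((1 / real l - 1 / real i) * (1 / k - 2 * (1 / real i)) * (1 - 1 / real i))" for i
    have "b \<longlonglongrightarrow> (1 - 0) * ((1 / real l - 0) * (1 / k - 2 * 0) * (1 - 0))"
      unfolding b_def by (intro tendsto_intros lim_1_over_n)
    then have b: "(\<lambda>i. ereal (b i)) \<longlonglongrightarrow> ereal (1 / (k * real l))" by (simp add: mult.commute)
    have "ereal (b i) \<le> dist_lim P \<H>" if i: "i \<ge> 2 + l + 2 * card P" for i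
    proof -
      have eps: "0 < 1 / real i" "1 / real i < 1" "2 * (1 / real i) \<le> 1 / real (card P)"
      proof -
        show "0 < 1 / real i" "1 / real i < 1" using i by auto
        have "2 * real (card P) \<le> real i" using i by linarith
        then show "2 * (1 / real i) \<le> 1 / real (card P)" using k i by (simp add: k_def field_simps)
      qed
      define c where "c = (1 / real l - 1 / real i) * (1 / k - 2 * (1 / real i)) * (1 - 1 / real i)"
      obtain G where G: "G \<in> digraphs_over P" "card (verts G) \<ge> i"
        and far: "\<And>G'. G' \<in> \<H> \<Longrightarrow> verts G' = verts G \<Longrightarrow> dist_digraph G G' \<ge> c"
        using far_digraph[OF P F _ n eps, of i] False i unfolding c_def k_def by auto
      have "1 / real i \<le> 1 / real l" using i l by (simp add: field_simps)
      then have c0: "c \<ge> 0" using eps unfolding c_def k_def by (intro mult_nonneg_nonneg) auto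
      have dp: "ereal c \<le> dist_property G \<H>"
        unfolding dist_property_def using far by (intro INF_greatest) auto
      have "b i = (1 - 1 / real i) * c" by (simp add: b_def c_def)
      also have "\<dots> \<le> (1 - 1 / real (card (verts G))) * c"
        using G(2) i c0 by (intro mult_right_mono) (auto simp: field_simps)
      finally have "ereal (b i) \<le> ereal (1 - 1 / real (card (verts G))) * ereal c" by simp
      also have "\<dots> \<le> ereal (1 - 1 / real (card (verts G))) * dist_property G \<H>"
        using dp G(2) i by (intro ereal_mult_left_mono) auto
      also have "\<dots> \<le> dist_lim P \<H>"
        using G i by (intro dist_lim_lower[OF P F]) auto
      finally show ?thesis .
    qed
    then have "ereal (1 / (k * real l)) \<le> dist_lim P \<H>"
      by (intro LIMSEQ_le_const2[OF b]) blast
    then show ?thesis using k l P(2) by (simp add: k_def one_ereal_def)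
  qed
qed

lemma strong_bound:
  assumes P: "palette P" "P \<noteq> {}" and F: "forbidden_family P \<H> \<F>"
  shows "1 / (ereal (real (card P)) * ereal_of_enat (chi_st P \<F> - 1)) \<le> dist_lim P \<H>"
proof -
  have chi: "chi_st P \<F> = (SUP x\<in>strong_spectrum P \<F>. enat ((case x of (a0, a1, a2) \<Rightarrow> a0 + a1 + a2) + 1))"
    unfolding chi_st_def by (intro SUP_cong) auto
  show ?thesis
    unfolding chi
  proof (rule chi_lower_bound)
    show "real (card P) > 0" using P(2) by (simp add: card_gt_0_iff)
    show "0 \<le> dist_lim P \<H>" by (rule dist_lim_nonneg[OF P F])
    fix l assume "\<And>x. x \<in> strong_spectrum P \<F> \<Longrightarrow> (case x of (a0, a1, a2) \<Rightarrow> a0 + a1 + a2) \<noteq> Suc l"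
    then show "1 / ereal (real (card P) * real l) \<le> dist_lim P \<H>"
      by (intro dist_lim_ge_strong[OF P F]) fastforce
  qed
qed

text \<open>The factor \<open>r\<close> is 1 in general and 2 for tournaments.\<close>

lemma weak_bound:
  assumes r: "r > 0"
    and D: "\<And>a0 a1 a2. (a0, a1, a2) \<in> weak_spectrum P \<F> \<Longrightarrow> a0 + a1 + a2 \<ge> 1 \<Longrightarrow>
      D \<le> ereal (1 / (r * real (a0 + a1 + a2)))"
  shows "D \<le> 1 / (ereal r * ereal_of_enat (chi_wk P \<F> - 1))"
proof -
  have chi: "chi_wk P \<F> = (SUP x\<in>weak_spectrum P \<F>. enat ((case x of (a0, a1, a2) \<Rightarrow> a0 + a1 + a2) + 1))"
    unfolding chi_wk_def by (intro SUP_cong) auto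
  show ?thesis
    unfolding chi using r by (rule chi_upper_bound) (use D in auto)
qed

theorem theorem18:
  fixes P :: "color set" and \<H> \<F> :: "digraph set"
  assumes "palette P"
    and "hereditary P \<H>"
    and "forbidden_family P \<H> \<F>"
  shows "(P = {Nonedge, Backward, Forward, Bidir} \<longrightarrow>
            1 / (4 * ereal_of_enat (chi_st P \<F> - 1)) \<le> dist_lim P \<H> \<and>
            dist_lim P \<H> \<le> 1 / ereal_of_enat (chi_wk P \<F> - 1))
       \<and> (P = {Bidir, Backward, Forward} \<longrightarrow>
            1 / (3 * ereal_of_enat (chi_st P \<F> - 1)) \<le> dist_lim P \<H> \<and>
            dist_lim P \<H> \<le> 1 / ereal_of_enat (chi_wk P \<F> - 1))
       \<and> (P = {Nonedge, Backward, Forward} \<longrightarrow>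
            1 / (3 * ereal_of_enat (chi_st P \<F> - 1)) \<le> dist_lim P \<H> \<and>
            dist_lim P \<H> \<le> 1 / ereal_of_enat (chi_wk P \<F> - 1))
       \<and> (P = {Nonedge, Bidir} \<longrightarrow>
            chi_wk P \<F> = chi_st P \<F> \<and>
            1 / (2 * ereal_of_enat (chi_st P \<F> - 1)) \<le> dist_lim P \<H> \<and>
            dist_lim P \<H> \<le> 1 / ereal_of_enat (chi_st P \<F> - 1))
       \<and> (P = {Backward, Forward} \<longrightarrow>
            chi_wk P \<F> = chi_st P \<F> \<and>
            dist_lim P \<H> = 1 / (2 * ereal_of_enat (chi_st P \<F> - 1)))"
proof -
  note F = assms(3)
  have lower: "1 / (ereal (real c) * ereal_of_enat (chi_st P \<F> - 1)) \<le> dist_lim P \<H>"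
    if "card P = c" "c \<ge> 1" for c
    using strong_bound[OF assms(1) _ F] that by force
  have upper: "dist_lim P \<H> \<le> 1 / ereal_of_enat (chi_wk P \<F> - 1)" if "card P \<ge> 2"
    using weak_bound[of 1 P \<F> "dist_lim P \<H>"] dist_lim_le_weak[OF assms(1) that F]
    by (simp flip: one_ereal_def)
  have "1 / (2 * ereal_of_enat (chi_st P \<F> - 1)) \<ge> dist_lim P \<H>" if P: "P = {Backward, Forward}"
    using weak_bound[of 2 P \<F> "dist_lim P \<H>"] dist_lim_le_tournament[OF P F] chi_tournament[OF F P] by simp
  then show ?thesis
    using lower[of 4] lower[of 3] lower[of 2] upper chi_undirected[OF F] chi_tournament[OF F]
    by (intro conjI impI order_antisym) simp_all
qed

end
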